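(* Let $V$ be an Orlicz function and $R\in(0,\infty)$. For each $n\in\mathbb N$ let $X_R^{n,V}=\big(X_R^{n,V}(1),\dots,X_R^{n,V}(n)\big)$ be uniformly distributed on the Orlicz ball $\mathbb B_R^{n,V}$. Then there exists a unique $\overline\alpha\in(-\infty,0)$ such that the sequence of empirical measures $$\mathcal L^{n,V}:=\frac1n\sum_{i=1}^n\delta_{X_R^{n,V}(i)},\qquad n\in\mathbb N,$$ satisfies a large deviation principle in $\mathscr M_1(\mathbb R)$ (with the weak topology) with the strictly convex good rate function $\mathbb I_V:\mathscr M_1(\mathbb R)\to[0,\infty]$, $$\mathbb I_V(\mu)=\begin{cases} H(\mu\,|\,\mu_{V,\overline\alpha})+\overline\alpha\,\big[m_V(\mu)-R\big] & \text{if } m_V(\mu)\le R,\\ \infty & \text{otherwise.}\end{cases}$$ In addition, if there exists another Orlicz function $W$ such that $V(x)/W(x)\to\infty$ as $|x|\to\infty$, then $(\mathcal L^{n,V})_{n\in\mathbb N}$ satisfies a large deviation principle in $(\mathscr M_1^W(\mathbb R),d_W)$ (with the same rate function $\mathbb I_V$).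
   Context: An Orlicz function is a convex, symmetric function $V:\mathbb R\to[0,\infty)$ with $V(0)=0$ and $V(x)>0$ for $x\neq0$. For $R>0$, $\mathbb B_R^{n,V}:=\{x\in\mathbb R^n:\sum_{k=1}^nV(x_k)\le Rn\}$. For $\beta<0$, the Gibbs measure $\mu_{V,\beta}$ is the probability measure on $\mathbb R$ with Lebesgue density $e^{\beta V(x)}/\int_{\mathbb R}e^{\beta V(t)}dt$. $\mathscr M_1(\mathbb R)$ is the set of Borel probability measures on $\mathbb R$; for $\mu\in\mathscr M_1(\mathbb R)$, $m_V(\mu):=\int V\,d\mu$, and $\mathscr M_1^V(\mathbb R):=\{\mu: m_V(\mu)<\infty\}$. For a metric $d_w$ inducing weak convergence on $\mathscr M_1(\mathbb R)$, $d_V(\mu,\nu):=d_w(\mu,\nu)+|m_V(\mu)-m_V(\nu)|$ on $\mathscr M_1^V(\mathbb R)$. $H(\mu|\nu)=\int\log\frac{d\mu}{d\nu}\,d\mu$ if $\mu\ll\nu$, and $\infty$ otherwise (relative entropy). A sequence $(\xi_n)$ of random elements of a topological space $X$ satisfies a large deviation principle (LDP) with good rate function $\mathbb I$ (i.e. $\mathbb I:X\to[0,\infty]$ with compact level sets) if for all Borel $A\subseteq X$: $-\inf_{A^\circ}\mathbb I\le\liminf_n\frac1n\log P[\xi_n\in A^\circ]\le\limsup_n\frac1n\log P[\xi_n\in\overline A]\le-\inf_{\overline A}\mathbb I$. *)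

theory Defs
  imports "HOL-Probability.Probability"
begin

definition orlicz :: "(real \<Rightarrow> real) \<Rightarrow> bool" where
  "orlicz V \<longleftrightarrow> convex_on UNIV V \<and> (\<forall>x. V (- x) = V x) \<and> V 0 = 0 \<and> (\<forall>x. x \<noteq> 0 \<longrightarrow> V x > 0)"

definition lebesgue_n :: "nat \<Rightarrow> (nat \<Rightarrow> real) measure" where
  "lebesgue_n n = PiM {..<n} (\<lambda>_. lborel)"

definition orlicz_ball :: "(real \<Rightarrow> real) \<Rightarrow> real \<Rightarrow> nat \<Rightarrow> (nat \<Rightarrow> real) set" where
  "orlicz_ball V R n = {x \<in> space (lebesgue_n n). (\<Sum>k<n. V (x k)) \<le> R * real n}"

definition empirical :: "nat \<Rightarrow> (nat \<Rightarrow> real) \<Rightarrow> real measure" where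
  "empirical n x = distr (uniform_measure (count_space UNIV) {..<n}) borel x"

definition emp_prob :: "(real \<Rightarrow> real) \<Rightarrow> real \<Rightarrow> nat \<Rightarrow> real measure set \<Rightarrow> real" where
  "emp_prob V R n A =
     measure (uniform_measure (lebesgue_n n) (orlicz_ball V R n))
             {x \<in> space (lebesgue_n n). empirical n x \<in> A}"

definition M1 :: "real measure set" where
  "M1 = {\<mu>. sets \<mu> = sets borel \<and> prob_space \<mu>}"

definition mV :: "(real \<Rightarrow> real) \<Rightarrow> real measure \<Rightarrow> ennreal" where
  "mV V \<mu> = (\<integral>\<^sup>+ x. ennreal (V x) \<partial>\<mu>)"

definition M1V :: "(real \<Rightarrow> real) \<Rightarrow> real measure set" where
  "M1V V = {\<mu> \<in> M1. mV V \<mu> < \<infinity>}"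

definition weak_subbase :: "real measure set set" where
  "weak_subbase = {{\<mu> \<in> M1. (\<integral>x. f x \<partial>\<mu>) \<in> U} | f U.
      continuous_on UNIV f \<and> bounded (range f) \<and> open (U :: real set)}"

definition weak_top :: "real measure topology" where
  "weak_top = topology_generated_by weak_subbase"

text \<open>Topology of d_W = d_w + |m_W(.) - m_W(.)| on M1^W, where d_w metrizes weak convergence:
  the initial topology on M1^W of the weak topology and of mu |-> m_W(mu).\<close>
definition dW_top :: "(real \<Rightarrow> real) \<Rightarrow> real measure topology" where
  "dW_top W = topology_generated_by
     ({S \<inter> M1V W | S. S \<in> weak_subbase} \<union>
      {{\<mu> \<in> M1V W. enn2real (mV W \<mu>) \<in> U} | U. open (U :: real set)})"

text \<open>Relative entropy H(mu|nu) = int log (dmu/dnu) dmu if mu << nu, infinity otherwise.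
  (The negative part of the integrand always has finite integral.)\<close>
definition rel_entropy :: "real measure \<Rightarrow> real measure \<Rightarrow> ereal" where
  "rel_entropy \<mu> \<nu> =
     (if absolutely_continuous \<nu> \<mu> then
        enn2ereal (\<integral>\<^sup>+ x. ennreal (max 0 (ln (enn2real (RN_deriv \<nu> \<mu> x)))) \<partial>\<mu>)
        - enn2ereal (\<integral>\<^sup>+ x. ennreal (max 0 (- ln (enn2real (RN_deriv \<nu> \<mu> x)))) \<partial>\<mu>)
      else \<infinity>)"

definition gibbs :: "(real \<Rightarrow> real) \<Rightarrow> real \<Rightarrow> real measure" where
  "gibbs V \<beta> = density lborel (\<lambda>x. ennreal (exp (\<beta> * V x) / (\<integral>t. exp (\<beta> * V t) \<partial>lborel)))"

definition rate_IV :: "(real \<Rightarrow> real) \<Rightarrow> real \<Rightarrow> real \<Rightarrow> real measure \<Rightarrow> ereal" where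
  "rate_IV V R \<alpha> \<mu> =
     (if mV V \<mu> \<le> ennreal R
      then rel_entropy \<mu> (gibbs V \<alpha>) + ereal (\<alpha> * (enn2real (mV V \<mu>) - R))
      else \<infinity>)"

definition mix :: "real \<Rightarrow> real measure \<Rightarrow> real measure \<Rightarrow> real measure" where
  "mix t \<mu> \<nu> = measure_of UNIV (sets borel)
      (\<lambda>A. ennreal t * emeasure \<mu> A + ennreal (1 - t) * emeasure \<nu> A)"

definition strictly_convex_rate :: "real measure set \<Rightarrow> (real measure \<Rightarrow> ereal) \<Rightarrow> bool" where
  "strictly_convex_rate S I \<longleftrightarrow>
     (\<forall>\<mu>\<in>S. \<forall>\<nu>\<in>S. \<forall>t. \<mu> \<noteq> \<nu> \<and> 0 < t \<and> t < 1 \<and> I \<mu> < \<infinity> \<and> I \<nu> < \<infinity> \<longrightarrow>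
        I (mix t \<mu> \<nu>) < ereal t * I \<mu> + ereal (1 - t) * I \<nu>)"

definition elog :: "real \<Rightarrow> ereal" where
  "elog p = (if p \<le> 0 then - \<infinity> else ereal (ln p))"

definition good_rate :: "'a topology \<Rightarrow> ('a \<Rightarrow> ereal) \<Rightarrow> bool" where
  "good_rate X I \<longleftrightarrow> (\<forall>x\<in>topspace X. 0 \<le> I x) \<and>
     (\<forall>c::real. compactin X {x \<in> topspace X. I x \<le> ereal c})"

definition borel_sets_of :: "'a topology \<Rightarrow> 'a set set" where
  "borel_sets_of X = sigma_sets (topspace X) {S. openin X S}"

text \<open>P n A stands for P[xi_n in A].\<close>
definition LDP :: "'a topology \<Rightarrow> (nat \<Rightarrow> 'a set \<Rightarrow> real) \<Rightarrow> ('a \<Rightarrow> ereal) \<Rightarrow> bool" where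
  "LDP X P I \<longleftrightarrow> good_rate X I \<and>
     (\<forall>A \<in> borel_sets_of X.
        - (INF x \<in> X interior_of A. I x)
            \<le> liminf (\<lambda>n. ereal (1 / real n) * elog (P n (X interior_of A))) \<and>
        limsup (\<lambda>n. ereal (1 / real n) * elog (P n (X closure_of A)))
            \<le> - (INF x \<in> X closure_of A. I x))"

end

theory Submission
  imports Defs "HOL-Real_Asymp.Real_Asymp"
begin

text \<open>
  Write \<open>Z(\<beta>) = \<integral> exp (\<beta> V)\<close> and \<open>\<phi>(\<beta>) = ln Z(\<beta>) - \<beta> R\<close>. On \<open>K = {\<mu>. m_V(\<mu>) \<le> R}\<close> the rate functions for
  different \<open>\<beta> < 0\<close> differ only by constants: each is \<open>\<integral> ln (d\<mu>/dx) d\<mu> + \<phi>(\<beta>)\<close>. The parameter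
  \<open>\<alpha>\<close> is the unique minimiser of \<open>\<phi>\<close>, characterised by \<open>m_V = R\<close> for the Gibbs measure.

  All empirical measures lie in \<open>K\<close>, which is weakly compact. For the upper bound, the exponential
  Chebyshev inequality with the tilt \<open>exp (f + \<beta> V)\<close>, \<open>f\<close> bounded continuous and \<open>\<beta> < 0\<close>, bounds the
  volume of \<open>{x. L_n(x) \<in> G}\<close> inside the ball for half-spaces \<open>G = {\<mu>. \<integral> f d\<mu> > s}\<close>; by the
  Donsker-Varadhan formula, letting \<open>\<beta>\<close> tend to 0, finitely many such \<open>G\<close> cover any closed subset of
  \<open>K\<close> at the right exponential cost. For the lower bound, sample from \<open>\<mu>\<close> itself and
  compare with Lebesgue measure, using the weak law of large numbers for \<open>V\<close> and for \<open>ln (d\<mu>/dx)\<close>.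
  The topology of \<open>d_W\<close> is no finer than the weak topology on \<open>K\<close>, because \<open>W\<close> is uniformly
  integrable there, so the second principle follows from the first.
\<close>

section \<open>Orlicz functions and Gibbs measures\<close>

text \<open>The obstacle is that the moment m_V is only lower semicontinuous in the weak topology
  while \<alpha> < 0: the summand \<alpha> * m_V is then upper semicontinuous, so closedness of the
  level sets cannot be read off the two summands of the rate. Using every \<beta> < 0 at once
  resolves this. On m_V \<le> R the term \<beta> * (m_V - R) lies between 0 and - \<beta> * R, so
  dropping it costs nothing in the limit \<beta> -> 0, and only relative entropies remain, which are
  suprema of weakly continuous functionals. The same family of inequalities serves for goodness of
  the rate and for the upper bound. The parameter \<alpha> enters through the normalisation. Each
  exp (n * \<phi>(\<beta>)) bounds the volume of the ball, and the smallest of these bounds is exact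
  on the exponential scale, because the Gibbs measure at \<alpha> has moment R and therefore rate 0.
  The whole space has probability 1, so a rate function must have infimum 0; the shift
  \<phi>(\<beta>) - \<phi>(\<alpha>) > 0 excludes every other parameter.\<close>

locale orlicz_function =
  fixes V :: "real \<Rightarrow> real"
  assumes orlicz: "orlicz V"
begin

definition Z :: "real \<Rightarrow> real" where
  "Z \<beta> = (\<integral>x. exp (\<beta> * V x) \<partial>lborel)"

lemma V_0 [simp]: "V 0 = 0" and V_pos: "x \<noteq> 0 \<Longrightarrow> 0 < V x" and V_minus: "V (- x) = V x"
  using orlicz by (auto simp: orlicz_def)

lemma V_nonneg [simp]: "0 \<le> V x"
  using V_pos[of x] by (cases "x = 0") auto

lemma V_abs: "V \<bar>x\<bar> = V x"
  by (auto simp: abs_if V_minus)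

lemma V_continuous: "continuous_on A V"
proof -
  have "continuous_on UNIV V"
    using orlicz by (intro convex_on_continuous) (auto simp: orlicz_def)
  then show ?thesis by (rule continuous_on_subset) auto
qed

lemma V_measurable [measurable]: "V \<in> borel_measurable borel"
  by (rule borel_measurable_continuous_onI) (rule V_continuous)

lemma V_scale_le: "0 \<le> t \<Longrightarrow> t \<le> 1 \<Longrightarrow> V (t * x) \<le> t * V x"
  using orlicz convex_onD[of UNIV V t 0 x] by (auto simp: orlicz_def)

lemma V_mono: assumes "\<bar>x\<bar> \<le> \<bar>y\<bar>" shows "V x \<le> V y"
proof (cases "y = 0")
  case False
  have "V (\<bar>x\<bar> / \<bar>y\<bar> * \<bar>y\<bar>) \<le> \<bar>x\<bar> / \<bar>y\<bar> * V \<bar>y\<bar>"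
    using assms False by (intro V_scale_le) auto
  also have "\<dots> \<le> 1 * V \<bar>y\<bar>" using assms False by (intro mult_right_mono) auto
  finally show ?thesis using False by (simp add: V_abs)
qed (use assms in auto)

text \<open>Convexity and V(0) = 0 make V(x) / |x| nondecreasing in |x|, which gives V(x) \<ge> V(1)
  * |x| beyond 1; inside the unit interval the right-hand side is at most 0.\<close>

lemma V_ge_linear: "V x \<ge> V 1 * (\<bar>x\<bar> - 1)"
proof (cases "\<bar>x\<bar> \<ge> 1")
  case True
  have "V (1 / \<bar>x\<bar> * \<bar>x\<bar>) \<le> 1 / \<bar>x\<bar> * V \<bar>x\<bar>"
    using True by (intro V_scale_le) auto
  moreover have "1 / \<bar>x\<bar> * \<bar>x\<bar> = 1" using True by auto
  ultimately have "V 1 \<le> V x / \<bar>x\<bar>" by (simp add: V_abs)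
  then have "V 1 * \<bar>x\<bar> \<le> V x" using True by (subst (asm) pos_le_divide_eq) auto
  moreover have "V 1 * (\<bar>x\<bar> - 1) \<le> V 1 * \<bar>x\<bar>" by (intro mult_left_mono) auto
  ultimately show ?thesis by simp
next
  case False
  then have "V 1 * (\<bar>x\<bar> - 1) \<le> 0" by (intro mult_nonneg_nonpos) auto
  then show ?thesis using V_nonneg[of x] by linarith
qed

lemma V_gt_outside: "\<exists>r>0. \<forall>x. \<bar>x\<bar> \<ge> r \<longrightarrow> V x > C"
proof -
  have p: "V 1 > 0" by (rule V_pos) auto
  define r where "r = 2 + \<bar>C\<bar> / V 1"
  have "V x > C" if "\<bar>x\<bar> \<ge> r" for x
  proof -
    have "C \<le> V 1 * (\<bar>C\<bar> / V 1)" using p by simp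
    also have "\<dots> < V 1 * (\<bar>x\<bar> - 1)" using that p by (intro mult_strict_left_mono) (auto simp: r_def)
    also have "\<dots> \<le> V x" by (rule V_ge_linear)
    finally show ?thesis .
  qed
  moreover have "r > 0" using p by (auto simp: r_def intro!: add_pos_nonneg)
  ultimately show ?thesis by blast
qed

lemma V_lt_inside: assumes "C > 0" shows "\<exists>r>0. \<forall>x. \<bar>x\<bar> \<le> r \<longrightarrow> V x < C"
proof -
  have "isCont V 0" using V_continuous[of UNIV] by (simp add: continuous_on_eq_continuous_at)
  then obtain d where d: "d > 0" "\<And>x. dist x 0 < d \<Longrightarrow> dist (V x) (V 0) < C"
    using assms unfolding continuous_at_eps_delta[abs_def] by blast
  show ?thesis
    by (rule exI[of _ "d / 2"]) (use d in \<open>force simp: dist_real_def\<close>)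
qed

section \<open>Integrability of the exponential tilts\<close>

text \<open>Linear growth of V bounds the integrand by a multiple of exp (- c |x|), and the
  quadratic Taylor bound of exp places this below a multiple of the integrable 1 / (1 +
  x^2).\<close>

lemma integrable_exp_V: assumes "\<beta> < 0" shows "integrable lborel (\<lambda>x. exp (\<beta> * V x))"
proof -
  define c where "c = - \<beta> * V 1"
  have c: "c > 0" using assms V_pos[of 1] by (simp add: c_def mult_neg_pos)
  \<comment> \<open>The two bounds on \<open>k\<close> are those needed for k * (1 + x^2) \<le> 1 +
    c^2 x^2 / 2, term by term.\<close>
  define k where "k = min 1 (c\<^sup>2 / 2)"
  have k: "k > 0" using c by (auto simp: k_def)
  have "integrable lborel (\<lambda>x::real. exp c / k * inverse (1 + x\<^sup>2))"
    using integrable_inverse_1_plus_square by (auto simp: set_integrable_def)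
  then show ?thesis
  proof (rule Bochner_Integration.integrable_bound)
    show "AE x in lborel. norm (exp (\<beta> * V x)) \<le> norm (exp c / k * inverse (1 + x\<^sup>2))"
    proof (rule AE_I2)
      fix x :: real
      have "k * (1 + x\<^sup>2) \<le> 1 + c\<^sup>2 / 2 * x\<^sup>2"
      proof -
        have "k * x\<^sup>2 \<le> c\<^sup>2 / 2 * x\<^sup>2" by (intro mult_right_mono) (auto simp: k_def)
        moreover have "k \<le> 1" by (simp add: k_def)
        ultimately show ?thesis by (simp add: algebra_simps)
      qed
      also have "\<dots> \<le> 1 + c * \<bar>x\<bar> + (c * \<bar>x\<bar>)\<^sup>2 / 2"
        using c by (simp add: power_mult_distrib)
      also have "\<dots> \<le> exp (c * \<bar>x\<bar>)"
        using c by (intro exp_lower_Taylor_quadratic) auto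
      finally have 1: "k * (1 + x\<^sup>2) \<le> exp (c * \<bar>x\<bar>)" .
      have "\<beta> * V x \<le> \<beta> * (V 1 * (\<bar>x\<bar> - 1))"
        using V_ge_linear assms by (intro mult_left_mono_neg) auto
      also have "\<dots> = c - c * \<bar>x\<bar>" by (simp add: c_def algebra_simps)
      finally have "exp (\<beta> * V x) \<le> exp c * inverse (exp (c * \<bar>x\<bar>))"
        by (simp flip: exp_minus exp_add)
      also have "\<dots> \<le> exp c * inverse (k * (1 + x\<^sup>2))"
        using 1 k by (intro mult_left_mono le_imp_inverse_le mult_pos_pos add_pos_nonneg) auto
      finally show "norm (exp (\<beta> * V x)) \<le> norm (exp c / k * inverse (1 + x\<^sup>2))"
        using k by (auto simp: field_simps abs_mult)
    qed
  qed auto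
qed

text \<open>The inequality y \<le> exp y at y = - \<beta> V / 2 pays for the factor V with half of
  the exponent, so the tilt at \<beta> / 2 dominates.\<close>

lemma V_exp_le: assumes "\<beta> < 0" shows "V x * exp (\<beta> * V x) \<le> 2 / (- \<beta>) * exp (\<beta> / 2 * V x)"
proof -
  have "- \<beta> / 2 * V x \<le> exp (- \<beta> / 2 * V x)"
    using exp_ge_add_one_self[of "- \<beta> / 2 * V x"] by linarith
  then have "V x \<le> 2 / (- \<beta>) * exp (- \<beta> / 2 * V x)" using assms by (simp add: field_simps)
  then have "V x * exp (\<beta> * V x) \<le> 2 / (- \<beta>) * exp (- \<beta> / 2 * V x) * exp (\<beta> * V x)"
    by (intro mult_right_mono) auto
  also have "\<dots> = 2 / (- \<beta>) * exp (\<beta> / 2 * V x)"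
    by (simp add: mult.assoc flip: exp_add)
  finally show ?thesis .
qed

lemma integrable_V_exp_V: assumes "\<beta> < 0" shows "integrable lborel (\<lambda>x. V x * exp (\<beta> * V x))"
proof (rule Bochner_Integration.integrable_bound)
  show "integrable lborel (\<lambda>x. 2 / (- \<beta>) * exp (\<beta> / 2 * V x))"
    using assms by (intro integrable_mult_right integrable_exp_V) auto
  show "AE x in lborel. norm (V x * exp (\<beta> * V x)) \<le> norm (2 / (- \<beta>) * exp (\<beta> / 2 * V x))"
    using assms V_exp_le[OF assms] by (auto simp: abs_mult)
qed auto

lemma Z_pos: assumes "\<beta> < 0" shows "Z \<beta> > 0"
  unfolding Z_def
proof -
  have "(\<integral>x. exp (\<beta> * V x) \<partial>lborel) \<noteq> 0"
  proof
    assume "(\<integral>x. exp (\<beta> * V x) \<partial>lborel) = 0"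
    then have "AE x in lborel. exp (\<beta> * V x) = 0"
      using integral_nonneg_eq_0_iff_AE[OF integrable_exp_V[OF assms]] by auto
    then have "AE x::real in lborel. False" by simp
    then show False by (simp add: ae_filter_eq_bot_iff emeasure_lborel_UNIV)
  qed
  then show "0 < (\<integral>x. exp (\<beta> * V x) \<partial>lborel)"
    by (simp add: less_le)
qed

text \<open>The sign of this integral is the sign of \<open>m_V - R\<close> for the Gibbs measure.\<close>
definition excess :: "real \<Rightarrow> real \<Rightarrow> real" where
  "excess R \<beta> = (\<integral>x. (V x - R) * exp (\<beta> * V x) \<partial>lborel)"

lemma integrable_excess: "\<beta> < 0 \<Longrightarrow> integrable lborel (\<lambda>x. (V x - R) * exp (\<beta> * V x))"
  using integrable_V_exp_V[of \<beta>] integrable_exp_V[of \<beta>] by (auto simp: left_diff_distrib)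



section \<open>Solving the moment equation of the Gibbs measures\<close>

lemma continuous_excess: assumes b: "b < 0" shows "continuous_on {..b} (excess R)"
  unfolding continuous_on_sequentially
proof safe
  fix X :: "nat \<Rightarrow> real" and a
  assume a: "a \<le> b" and X: "\<forall>n. X n \<in> {..b}" "X \<longlonglongrightarrow> a"
  show "(excess R \<circ> X) \<longlonglongrightarrow> excess R a"
    unfolding excess_def comp_def
  proof (rule integral_dominated_convergence)
    show "integrable lborel (\<lambda>x. V x * exp (b * V x) + \<bar>R\<bar> * exp (b * V x))"
      using integrable_V_exp_V[OF b] integrable_exp_V[OF b] by auto
    show "AE x in lborel. (\<lambda>i. (V x - R) * exp (X i * V x)) \<longlonglongrightarrow> (V x - R) * exp (a * V x)"
      using X by (auto intro!: tendsto_intros)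
    show "AE x in lborel. norm ((V x - R) * exp (X i * V x)) \<le> V x * exp (b * V x) + \<bar>R\<bar> * exp (b * V x)" for i
    proof (rule AE_I2)
      fix x
      have "X i * V x \<le> b * V x" using X by (intro mult_right_mono) auto
      moreover have "\<bar>V x - R\<bar> \<le> V x + \<bar>R\<bar>" using V_nonneg[of x] by linarith
      ultimately have "\<bar>V x - R\<bar> * exp (X i * V x) \<le> (V x + \<bar>R\<bar>) * exp (b * V x)"
        by (intro mult_mono) auto
      then show "norm ((V x - R) * exp (X i * V x)) \<le> V x * exp (b * V x) + \<bar>R\<bar> * exp (b * V x)"
        by (simp add: abs_mult distrib_right)
    qed
  qed auto
qed

text \<open>After multiplication by exp (- \<beta> R), the region V \<ge> R contributes at most the
  integral of \<open>g\<close>, uniformly in \<beta> \<le> -1, whereas an interval around 0 where V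
  < R / 2 contributes a negative amount growing like exp (- \<beta> R / 2). The free bound
  \<open>b\<close> lets the solution be placed to the left of any given point, as bracketing a root
  requires.\<close>

lemma excess_neg:
  assumes R: "R > 0" shows "\<exists>\<beta><b. \<beta> < 0 \<and> excess R \<beta> < 0"
proof -
  obtain a where a: "a > 0" "\<And>x. \<bar>x\<bar> \<le> a \<Longrightarrow> V x < R / 2"
    using V_lt_inside[of "R / 2"] R by auto
  define g where "g x = max 0 (V x - R) * exp (- (V x - R))" for x
  have [measurable]: "g \<in> borel_measurable borel" unfolding g_def by measurable
  have g: "integrable lborel g"
  proof (rule Bochner_Integration.integrable_bound)
    show "integrable lborel (\<lambda>x. exp R * (V x * exp (-1 * V x)))"
      using integrable_V_exp_V[of "-1"] by auto
    show "AE x in lborel. norm (g x) \<le> norm (exp R * (V x * exp (-1 * V x)))"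
    proof (rule AE_I2)
      fix x
      have "max 0 (V x - R) * exp (- (V x - R)) \<le> V x * exp (- (V x - R))"
        using R V_nonneg[of x] by (intro mult_right_mono) auto
      also have "\<dots> = exp R * (V x * exp (-1 * V x))"
        by (simp add: exp_diff exp_minus field_simps)
      finally show "norm (g x) \<le> norm (exp R * (V x * exp (-1 * V x)))"
        by (simp add: g_def abs_mult)
    qed
  qed auto
  define C where "C = integral\<^sup>L lborel g"
  have C: "0 \<le> C" unfolding C_def by (intro Bochner_Integration.integral_nonneg) (auto simp: g_def)
  \<comment> \<open>The third entry gives C \<le> R a (- \<beta> R / 2), which is less than R a exp
    (- \<beta> R / 2), the contribution of the interval of length 2a with height R / 2 * exp (-
    \<beta> R / 2).\<close>
  define \<beta> where "\<beta> = min (-1) (min (b - 1) (- 2 * C / (R * (R * a))))"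
  have \<beta>: "\<beta> \<le> -1" "\<beta> < b" "- 2 * C / (R * (R * a)) \<ge> \<beta>" unfolding \<beta>_def by auto
  have int: "integrable lborel (\<lambda>x. (V x - R) * exp (\<beta> * V x))"
    using \<beta> by (intro integrable_excess) auto
  have "exp (- \<beta> * R) * excess R \<beta> = (\<integral>x. exp (- \<beta> * R) * ((V x - R) * exp (\<beta> * V x)) \<partial>lborel)"
    unfolding excess_def using int by simp
  also have "\<dots> \<le> (\<integral>x. g x - R / 2 * exp (- \<beta> * R / 2) * indicator {-a..a} x \<partial>lborel)"
  proof (rule integral_mono)
    show "integrable lborel (\<lambda>x. exp (- \<beta> * R) * ((V x - R) * exp (\<beta> * V x)))" using int by simp
    show "integrable lborel (\<lambda>x. g x - R / 2 * exp (- \<beta> * R / 2) * indicator {-a..a} x)"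
      using g by (intro Bochner_Integration.integrable_diff integrable_mult_right integrable_real_indicator)
        (auto simp: emeasure_lborel_Icc_eq)
    fix x
    have *: "exp (- \<beta> * R) * ((V x - R) * exp (\<beta> * V x)) = (V x - R) * exp (\<beta> * (V x - R))"
    proof -
      have "exp (- \<beta> * R) * exp (\<beta> * V x) = exp (\<beta> * (V x - R))"
        by (simp add: algebra_simps flip: exp_add)
      then show ?thesis by (metis mult.left_commute)
    qed
    show "exp (- \<beta> * R) * ((V x - R) * exp (\<beta> * V x))
       \<le> g x - R / 2 * exp (- \<beta> * R / 2) * indicator {-a..a} x"
    proof (cases "V x \<ge> R")
      case True
      then have "x \<notin> {-a..a}" using a(2)[of x] R by (auto simp: abs_le_iff)
      moreover have "\<beta> * (V x - R) \<le> (-1) * (V x - R)"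
        using True \<beta> by (intro mult_right_mono) auto
      ultimately show ?thesis unfolding * g_def using True by (auto intro!: mult_left_mono)
    next
      case False
      show ?thesis
      proof (cases "x \<in> {-a..a}")
        case True
        then have V: "V x < R / 2" using a(2)[of x] by auto
        have "- \<beta> * R / 2 = - \<beta> * (R / 2)" by simp
        also have "\<dots> \<le> - \<beta> * (R - V x)" using V \<beta> by (intro mult_left_mono) auto
        also have "\<dots> = \<beta> * (V x - R)" by (simp add: algebra_simps)
        finally have "R / 2 * exp (- \<beta> * R / 2) \<le> (R - V x) * exp (\<beta> * (V x - R))"
          using V R by (intro mult_mono) auto
        then have "(V x - R) * exp (\<beta> * (V x - R)) \<le> - (R / 2 * exp (- \<beta> * R / 2))"
          by (simp add: algebra_simps)
        moreover have "g x \<ge> 0" by (simp add: g_def)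
        ultimately show ?thesis unfolding * using True by simp
      next
        case False
        have "(V x - R) * exp (\<beta> * (V x - R)) \<le> 0"
          using \<open>\<not> R \<le> V x\<close> by (intro mult_nonpos_nonneg) auto
        moreover have "g x \<ge> 0" by (simp add: g_def)
        ultimately show ?thesis unfolding * using False by simp
      qed
    qed
  qed
  also have "\<dots> = C - R / 2 * exp (- \<beta> * R / 2) * (2 * a)"
    using g a by (subst Bochner_Integration.integral_diff)
      (auto simp: C_def emeasure_lborel_Icc_eq intro!: integrable_mult_right integrable_real_indicator)
  also have "\<dots> < 0"
  proof -
    have "C = R * a * (2 * C / (R * (R * a)) * R / 2)" using R a by (simp add: field_simps)
    also have "\<dots> \<le> R * a * (- \<beta> * R / 2)"
      using \<beta> R a by (intro mult_left_mono divide_right_mono mult_right_mono) auto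
    also have "\<dots> < R * a * exp (- \<beta> * R / 2)"
      using exp_ge_add_one_self[of "- \<beta> * R / 2"] R a by (intro mult_strict_left_mono mult_pos_pos) linarith+
    finally show ?thesis by (simp add: field_simps)
  qed
  finally have "excess R \<beta> < 0" by (simp add: mult_less_0_iff)
  then show ?thesis using \<beta> by (intro exI[of _ \<beta>]) auto
qed

text \<open>For \<beta> near 0 the weight stays above 1/2 on a long stretch where V > 2R. The gain
  on (b, 6b] is at least (R / 2) * 5b, the loss on [-b, b] at most R * 2b, and the net amount R b /
  2 is positive.\<close>

lemma excess_pos:
  assumes R: "R > 0" shows "\<exists>\<beta><0. excess R \<beta> > 0"
proof -
  obtain b where b: "b > 0" "\<And>x. \<bar>x\<bar> \<ge> b \<Longrightarrow> V x > 2 * R" using V_gt_outside[of "2 * R"] by auto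
  \<comment> \<open>Normalised so that the weight equals exactly 1/2 at the right end 6b, hence is
    at least 1/2 on the whole stretch.\<close>
  define \<beta> where "\<beta> = - ln 2 / V (6 * b)"
  have V6: "V (6 * b) > 0" using b by (intro V_pos) auto
  have \<beta>: "\<beta> < 0" using V6 by (auto simp: \<beta>_def)
  have e: "exp (\<beta> * V (6 * b)) = 1 / 2" using V6 by (simp add: \<beta>_def exp_minus)
  have "0 < R * b / 2" using R b by simp
  also have "\<dots> = (\<integral>x. R / 2 * indicator {b<..6 * b} x - R * indicator {-b..b} x \<partial>lborel)"
    using b by (subst Bochner_Integration.integral_diff)
      (auto simp: emeasure_lborel_Icc_eq intro!: integrable_mult_right integrable_real_indicator)
  also have "\<dots> \<le> excess R \<beta>" unfolding excess_def
  proof (rule integral_mono)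
    show "integrable lborel (\<lambda>x. R / 2 * indicator {b<..6 * b} x - R * indicator {-b..b} x)"
      using b by (intro Bochner_Integration.integrable_diff integrable_mult_right integrable_real_indicator)
        (auto simp: emeasure_lborel_Icc_eq)
    show "integrable lborel (\<lambda>x. (V x - R) * exp (\<beta> * V x))" using \<beta> by (rule integrable_excess)
    fix x
    consider "x \<in> {b<..6 * b}" | "x \<in> {-b..b}" | "x \<notin> {b<..6 * b}" "x \<notin> {-b..b}" by blast
    then show "R / 2 * indicator {b<..6 * b} x - R * indicator {-b..b} x \<le> (V x - R) * exp (\<beta> * V x)"
    proof cases
      case 1
      have "\<beta> * V x \<ge> \<beta> * V (6 * b)" using 1 b \<beta> by (intro mult_left_mono_neg V_mono) auto
      then have "exp (\<beta> * V x) \<ge> 1 / 2" unfolding e[symmetric] by simp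
      then have "R * (1 / 2) \<le> (V x - R) * exp (\<beta> * V x)"
        using 1 R b(2)[of x] b(1) by (intro mult_mono) auto
      then show ?thesis using 1 b by auto
    next
      case 2
      have "exp (\<beta> * V x) \<le> 1" using \<beta> by (simp add: mult_nonpos_nonneg)
      then have "R * exp (\<beta> * V x) \<le> R" using R by simp
      moreover have "(V x - R) * exp (\<beta> * V x) \<ge> - (R * exp (\<beta> * V x))"
        by (simp add: algebra_simps)
      ultimately show ?thesis using 2 b by auto
    next
      case 3
      then have "\<bar>x\<bar> \<ge> b" by auto
      then have "V x > 2 * R" by (rule b)
      then have "0 \<le> (V x - R) * exp (\<beta> * V x)" using R by (intro mult_nonneg_nonneg) auto
      then show ?thesis using 3 by simp
    qed
  qed
  finally show ?thesis using \<beta> by auto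
qed

text \<open>The intermediate value theorem between the two signs. It gives existence only;
  uniqueness comes out of \<open>phi_strict_min\<close>.\<close>

lemma excess_root: assumes R: "R > 0" shows "\<exists>\<alpha><0. excess R \<alpha> = 0"
proof -
  obtain b where b: "b < 0" "excess R b > 0" using excess_pos[OF R] by auto
  obtain a where a: "a < b" "excess R a < 0" using excess_neg[OF R] by blast
  obtain x where "a \<le> x" "x \<le> b" "excess R x = 0"
    using IVT'[of "excess R" a 0 b] a b continuous_on_subset[OF continuous_excess[OF b(1)], of "{a..b}"] by force
  then show ?thesis using b by (intro exI[of _ x]) auto
qed

lemma gibbs_eq: "gibbs V \<beta> = density lborel (\<lambda>x. ennreal (exp (\<beta> * V x) / Z \<beta>))"
  by (simp add: gibbs_def Z_def)

lemma sets_gibbs [simp, measurable_cong]: "sets (gibbs V \<beta>) = sets borel"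
  by (simp add: gibbs_def)

lemma nn_integral_gibbs:
  assumes "\<beta> < 0" and [measurable]: "f \<in> borel_measurable borel"
  shows "(\<integral>\<^sup>+x. f x \<partial>gibbs V \<beta>) = (\<integral>\<^sup>+x. ennreal (exp (\<beta> * V x) / Z \<beta>) * f x \<partial>lborel)"
  unfolding gibbs_eq by (subst nn_integral_density) auto

lemma prob_space_gibbs: assumes "\<beta> < 0" shows "prob_space (gibbs V \<beta>)"
proof
  have "emeasure (gibbs V \<beta>) (space (gibbs V \<beta>)) = (\<integral>\<^sup>+x. ennreal (exp (\<beta> * V x) / Z \<beta>) \<partial>lborel)"
    unfolding gibbs_eq by (subst emeasure_density) auto
  also have "\<dots> = ennreal (\<integral>x. exp (\<beta> * V x) / Z \<beta> \<partial>lborel)"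
    using integrable_exp_V[OF assms] Z_pos[OF assms] by (intro nn_integral_eq_integral) auto
  also have "(\<integral>x. exp (\<beta> * V x) / Z \<beta> \<partial>lborel) = 1"
    using Z_pos[OF assms] by (simp add: Z_def)
  finally show "emeasure (gibbs V \<beta>) (space (gibbs V \<beta>)) = 1" by simp
qed

lemma gibbs_in_M1: "\<beta> < 0 \<Longrightarrow> gibbs V \<beta> \<in> M1"
  by (simp add: M1_def prob_space_gibbs)

lemma mV_gibbs:
  assumes \<beta>: "\<beta> < 0"
  shows "mV V (gibbs V \<beta>) = ennreal (R + excess R \<beta> / Z \<beta>)"
proof -
  have "mV V (gibbs V \<beta>) = (\<integral>\<^sup>+x. ennreal (V x * exp (\<beta> * V x) / Z \<beta>) \<partial>lborel)"
    unfolding mV_def using Z_pos[OF \<beta>]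
    by (subst nn_integral_gibbs[OF \<beta>]) (auto intro!: nn_integral_cong simp: ennreal_mult'[symmetric] mult.commute)
  also have "\<dots> = ennreal (\<integral>x. V x * exp (\<beta> * V x) / Z \<beta> \<partial>lborel)"
    using integrable_V_exp_V[OF \<beta>] Z_pos[OF \<beta>] by (intro nn_integral_eq_integral) auto
  also have "(\<integral>x. V x * exp (\<beta> * V x) / Z \<beta> \<partial>lborel) = (excess R \<beta> + R * Z \<beta>) / Z \<beta>"
    using integrable_V_exp_V[OF \<beta>] integrable_exp_V[OF \<beta>]
    by (simp add: excess_def Z_def left_diff_distrib)
  also have "\<dots> = R + excess R \<beta> / Z \<beta>" using Z_pos[OF \<beta>] by (simp add: field_simps)
  finally show ?thesis .
qed

end

section \<open>Mixtures and approximation by continuous functions\<close>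

lemma liminf_le_const:
  fixes f :: "nat \<Rightarrow> 'a :: complete_linorder"
  assumes "\<And>n. f n \<le> C" shows "liminf f \<le> C"
  by (rule order_trans[OF Liminf_le_Limsup Limsup_bounded]) (use assms in auto)

lemma M1_D:
  assumes "\<mu> \<in> M1"
  shows "sets \<mu> = sets borel" "prob_space \<mu>" "space \<mu> = UNIV"
  using assms sets_eq_imp_space_eq[of \<mu> borel] by (auto simp: M1_def)

lemma sets_mix [simp, measurable_cong]: "sets (mix t \<mu> \<nu>) = sets borel"
  using sets.sigma_sets_eq[of "borel :: real measure"] by (simp add: mix_def)

lemma space_mix [simp]: "space (mix t \<mu> \<nu>) = UNIV"
  by (simp add: mix_def space_measure_of_conv)

lemma emeasure_mix:
  assumes "sets \<mu> = sets borel" "sets \<nu> = sets borel" "A \<in> sets borel"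
  shows "emeasure (mix t \<mu> \<nu>) A = ennreal t * emeasure \<mu> A + ennreal (1 - t) * emeasure \<nu> A"
proof (rule emeasure_measure_of[OF mix_def])
  show "countably_additive (sets (mix t \<mu> \<nu>)) (\<lambda>A. ennreal t * emeasure \<mu> A + ennreal (1 - t) * emeasure \<nu> A)"
  proof (rule countably_additiveI)
    fix B :: "nat \<Rightarrow> real set"
    assume B: "range B \<subseteq> sets (mix t \<mu> \<nu>)" "disjoint_family B"
    then have "(\<Sum>i. emeasure \<mu> (B i)) = emeasure \<mu> (\<Union>i. B i)" "(\<Sum>i. emeasure \<nu> (B i)) = emeasure \<nu> (\<Union>i. B i)"
      using assms by (auto intro!: suminf_emeasure)
    then show "(\<Sum>i. ennreal t * emeasure \<mu> (B i) + ennreal (1 - t) * emeasure \<nu> (B i)) =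
      ennreal t * emeasure \<mu> (\<Union>i. B i) + ennreal (1 - t) * emeasure \<nu> (\<Union>i. B i)"
      by (simp add: suminf_add[symmetric])
  qed
qed (use assms in \<open>auto simp: positive_def\<close>)

lemma nn_integral_mix:
  assumes s: "sets \<mu> = sets borel" "sets \<nu> = sets borel" and f: "f \<in> borel_measurable borel"
  shows "(\<integral>\<^sup>+x. f x \<partial>mix t \<mu> \<nu>) = ennreal t * (\<integral>\<^sup>+x. f x \<partial>\<mu>) + ennreal (1 - t) * (\<integral>\<^sup>+x. f x \<partial>\<nu>)"
proof -
  have [measurable_cong]: "sets \<mu> = sets borel" "sets \<nu> = sets borel" using s by auto
  have m: "\<And>g. g \<in> borel_measurable borel \<Longrightarrow> g \<in> borel_measurable \<mu> \<and> g \<in> borel_measurable \<nu>"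
    by (auto cong: measurable_cong_sets)
  show ?thesis using f
  proof (induction rule: borel_measurable_induct)
    case (cong f g)
    then show ?case by (simp add: ext[of f g])
  next
    case (set A)
    then show ?case using s by (simp add: emeasure_mix)
  next
    case (mult u c)
    then show ?case by (simp add: nn_integral_cmult m algebra_simps)
  next
    case (add u v)
    then show ?case by (simp add: nn_integral_add m algebra_simps)
  next
    case (seq U)
    have [measurable]: "U i \<in> borel_measurable borel" for i by (rule seq)
    have inc: "incseq (\<lambda>i. ennreal t * (\<integral>\<^sup>+x. U i x \<partial>\<mu>))" "incseq (\<lambda>i. ennreal (1 - t) * (\<integral>\<^sup>+x. U i x \<partial>\<nu>))"
      using seq(3) by (auto simp: incseq_def le_fun_def intro!: mult_left_mono nn_integral_mono)
    have "(\<integral>\<^sup>+x. (SUP i. U i) x \<partial>mix t \<mu> \<nu>) = (SUP i. \<integral>\<^sup>+x. U i x \<partial>mix t \<mu> \<nu>)"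
      using seq(3) unfolding SUP_apply by (intro nn_integral_monotone_convergence_SUP) auto
    also have "\<dots> = (SUP i. ennreal t * (\<integral>\<^sup>+x. U i x \<partial>\<mu>) + ennreal (1 - t) * (\<integral>\<^sup>+x. U i x \<partial>\<nu>))"
      using seq by simp
    also have "\<dots> = (SUP i. ennreal t * (\<integral>\<^sup>+x. U i x \<partial>\<mu>)) + (SUP i. ennreal (1 - t) * (\<integral>\<^sup>+x. U i x \<partial>\<nu>))"
      by (rule ennreal_SUP_add[OF inc])
    also have "\<dots> = ennreal t * (SUP i. \<integral>\<^sup>+x. U i x \<partial>\<mu>) + ennreal (1 - t) * (SUP i. \<integral>\<^sup>+x. U i x \<partial>\<nu>)"
      by (simp add: SUP_mult_left_ennreal)
    also have "\<dots> = ennreal t * (\<integral>\<^sup>+x. (SUP i. U i) x \<partial>\<mu>) + ennreal (1 - t) * (\<integral>\<^sup>+x. (SUP i. U i) x \<partial>\<nu>)"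
      using seq(3) unfolding SUP_apply by (subst (1 2) nn_integral_monotone_convergence_SUP) auto
    finally show ?case .
  qed
qed

lemma mix_in_M1:
  assumes "\<mu> \<in> M1" "\<nu> \<in> M1" "0 \<le> t" "t \<le> 1"
  shows "mix t \<mu> \<nu> \<in> M1"
proof -
  have "emeasure (mix t \<mu> \<nu>) UNIV = ennreal t + ennreal (1 - t)"
    using assms M1_D prob_space.emeasure_space_1[of \<mu>] prob_space.emeasure_space_1[of \<nu>]
    by (subst emeasure_mix) (auto dest: M1_D)
  also have "\<dots> = 1" using assms by (simp flip: ennreal_plus)
  finally show ?thesis by (auto simp: M1_def intro!: prob_spaceI)
qed

section \<open>Continuous functions are dense in L1\<close>

text \<open>Regularity of the measure encloses a Borel set between a compact K and an open U with U
  - K of small measure, and a Urysohn function for this pair approximates the indicator. Sums and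
  dominated limits carry the property to all integrable functions.\<close>

lemma L1_approx_continuous:
  fixes \<nu> :: "real measure" and g :: "real \<Rightarrow> real"
  assumes s: "sets \<nu> = sets borel" and fin: "finite_measure \<nu>" and g: "integrable \<nu> g"
  shows "\<forall>e>0. \<exists>f. continuous_on UNIV f \<and> integrable \<nu> f \<and> (\<integral>x. \<bar>f x - g x\<bar> \<partial>\<nu>) < e"
  using g
proof (induction rule: integrable_induct)
  case (base A c)
  interpret finite_measure \<nu> by fact
  have [measurable_cong]: "sets \<nu> = sets borel" by fact
  have [measurable]: "A \<in> sets borel" using base s by auto
  show ?case
  proof safe
    fix e :: real assume e: "e > 0"
    \<comment> \<open>The error of the Urysohn function times c is at most |c| on U - K, a set of
      measure below 2d. The summand 1 keeps the quotient meaningful for c = 0.\<close>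
    define d where "d = e / (2 * (\<bar>c\<bar> + 1))"
    have d: "d > 0" using e by (simp add: d_def)
    have "emeasure \<nu> A = (SUP K\<in>{K. K \<subseteq> A \<and> compact K}. emeasure \<nu> K)"
      by (rule inner_regular) (use s base in \<open>auto simp: emeasure_eq_measure\<close>)
    moreover have "{K. K \<subseteq> A \<and> compact K} \<noteq> {}" by (auto intro: exI[of _ "{}"])
    ultimately obtain K where K: "K \<subseteq> A" "compact K" "emeasure \<nu> A < emeasure \<nu> K + ennreal d"
      using SUP_approx_ennreal[of d "{K. K \<subseteq> A \<and> compact K}" "emeasure \<nu> A" "emeasure \<nu>"] d
        emeasure_finite[of A] by (metis (no_types, lifting) infinity_ennreal_def mem_Collect_eq)
    have "emeasure \<nu> A = (INF U\<in>{U. A \<subseteq> U \<and> open U}. emeasure \<nu> U)"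
      by (rule outer_regular) (use s base in \<open>auto simp: emeasure_eq_measure\<close>)
    moreover have "{U. A \<subseteq> U \<and> open U} \<noteq> {}" by (auto intro: exI[of _ "UNIV"])
    ultimately obtain U where U: "A \<subseteq> U" "open U" "emeasure \<nu> U < emeasure \<nu> A + ennreal d"
      using INF_approx_ennreal[of d "emeasure \<nu> A" "emeasure \<nu>" "{U. A \<subseteq> U \<and> open U}"] d
        emeasure_finite[of A] by (metis (no_types, lifting) infinity_ennreal_def mem_Collect_eq)
    have [measurable]: "K \<in> sets borel" "U \<in> sets borel" using K U by (auto intro: borel_compact)
    have "closed K" "closed (- U)" "K \<inter> - U = {}" using K U by (auto intro: compact_imp_closed)
    then obtain f :: "real \<Rightarrow> real" where f: "continuous_on UNIV f" "\<And>x. f x \<in> closed_segment 1 0"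
        "\<And>x. x \<in> K \<Longrightarrow> f x = 1" "\<And>x. x \<in> - U \<Longrightarrow> f x = 0"
      using Urysohn[of K "- U" "1::real" "0::real"] by metis
    have f01: "0 \<le> f x" "f x \<le> 1" for x using f(2)[of x] by (auto simp: closed_segment_eq_real_ivl)
    have [measurable]: "f \<in> borel_measurable borel" by (rule borel_measurable_continuous_onI) fact
    have intf: "integrable \<nu> f" by (rule integrable_const_bound[of _ 1]) (use f01 in auto)
    have "measure \<nu> (U - K) = measure \<nu> U - measure \<nu> K" using K U by (intro finite_measure_Diff) auto
    also have "\<dots> < 2 * d" using K(3) U(3) d
      by (simp add: emeasure_eq_measure ennreal_less_iff flip: ennreal_plus)
    finally have m: "measure \<nu> (U - K) < 2 * d" .
    have "(\<integral>x. \<bar>c * f x - indicator A x *\<^sub>R c\<bar> \<partial>\<nu>) \<le> (\<integral>x. \<bar>c\<bar> * indicator (U - K) x \<partial>\<nu>)"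
    proof (rule integral_mono)
      show "integrable \<nu> (\<lambda>x. \<bar>c * f x - indicator A x *\<^sub>R c\<bar>)"
        using intf by (intro integrable_abs Bochner_Integration.integrable_diff) (auto simp: emeasure_eq_measure)
      show "integrable \<nu> (\<lambda>x. \<bar>c\<bar> * indicator (U - K) x)" by (auto simp: emeasure_eq_measure)
      fix x
      have "\<bar>f x - indicator A x\<bar> \<le> indicator (U - K) x"
        using f01[of x] f(3)[of x] f(4)[of x] K U by (auto simp: indicator_def)
      then have "\<bar>c\<bar> * \<bar>f x - indicator A x\<bar> \<le> \<bar>c\<bar> * indicator (U - K) x" by (intro mult_left_mono) auto
      moreover have "c * f x - indicator A x *\<^sub>R c = c * (f x - indicator A x)" by (simp add: algebra_simps)
      ultimately show "\<bar>c * f x - indicator A x *\<^sub>R c\<bar> \<le> \<bar>c\<bar> * indicator (U - K) x" by (simp add: abs_mult)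
    qed
    also have "\<dots> = \<bar>c\<bar> * measure \<nu> (U - K)" by simp
    also have "\<dots> \<le> \<bar>c\<bar> * (2 * d)" using m by (intro mult_left_mono) auto
    also have "\<dots> < (\<bar>c\<bar> + 1) * (2 * d)" using d by (intro mult_strict_right_mono) auto
    also have "\<dots> = e" by (simp add: d_def field_simps)
    finally show "\<exists>f. continuous_on UNIV f \<and> integrable \<nu> f \<and> (\<integral>x. \<bar>f x - indicator A x *\<^sub>R c\<bar> \<partial>\<nu>) < e"
      using f intf by (intro exI[of _ "\<lambda>x. c * f x"]) (auto intro!: continuous_intros)
  qed
next
  case (add g h)
  show ?case
  proof safe
    fix e :: real assume "e > 0"
    then obtain f1 f2 where f: "continuous_on UNIV f1" "integrable \<nu> f1" "(\<integral>x. \<bar>f1 x - g x\<bar> \<partial>\<nu>) < e / 2"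
      "continuous_on UNIV f2" "integrable \<nu> f2" "(\<integral>x. \<bar>f2 x - h x\<bar> \<partial>\<nu>) < e / 2"
      using add(3,4) by (meson half_gt_zero)
    have "(\<integral>x. \<bar>f1 x + f2 x - (g x + h x)\<bar> \<partial>\<nu>) \<le> (\<integral>x. \<bar>f1 x - g x\<bar> + \<bar>f2 x - h x\<bar> \<partial>\<nu>)"
      using f add(1,2) by (intro integral_mono) auto
    also have "\<dots> = (\<integral>x. \<bar>f1 x - g x\<bar> \<partial>\<nu>) + (\<integral>x. \<bar>f2 x - h x\<bar> \<partial>\<nu>)"
      using f add(1,2) by (intro Bochner_Integration.integral_add) auto
    also have "\<dots> < e" using f by linarith
    finally show "\<exists>f. continuous_on UNIV f \<and> integrable \<nu> f \<and> (\<integral>x. \<bar>f x - (g x + h x)\<bar> \<partial>\<nu>) < e"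
      using f by (intro exI[of _ "\<lambda>x. f1 x + f2 x"]) (auto intro!: continuous_intros)
  qed
next
  case (lim g s)
  show ?case
  proof safe
    fix e :: real assume e: "e > 0"
    \<comment> \<open>The approximating functions of the induction rule satisfy |s i| \<le> 2 |g|,
      whence the dominating function 3 |g|.\<close>
    have "(\<lambda>i. \<integral>x. \<bar>s i x - g x\<bar> \<partial>\<nu>) \<longlonglongrightarrow> (\<integral>x. 0 \<partial>\<nu>)"
    proof (rule integral_dominated_convergence)
      show "integrable \<nu> (\<lambda>x. 3 * \<bar>g x\<bar>)" using lim(4) by auto
      show "AE x in \<nu>. (\<lambda>i. \<bar>s i x - g x\<bar>) \<longlonglongrightarrow> 0"
        using lim(2) by (intro AE_I2 tendsto_rabs_zero) (auto simp: LIM_zero_iff)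
      show "AE x in \<nu>. norm \<bar>s i x - g x\<bar> \<le> 3 * \<bar>g x\<bar>" for i
        using lim(3)[of _ i] by (intro AE_I2) (fastforce intro: order_trans[OF abs_triangle_ineq4])
    qed (use lim(1,4) in auto)
    then have "eventually (\<lambda>i. (\<integral>x. \<bar>s i x - g x\<bar> \<partial>\<nu>) < e / 2) sequentially"
      using e by (intro order_tendstoD) auto
    then obtain i where i: "(\<integral>x. \<bar>s i x - g x\<bar> \<partial>\<nu>) < e / 2" by (auto simp: eventually_sequentially)
    obtain f where f: "continuous_on UNIV f" "integrable \<nu> f" "(\<integral>x. \<bar>f x - s i x\<bar> \<partial>\<nu>) < e / 2"
      using lim(5)[of i] e by (meson half_gt_zero)
    have "(\<integral>x. \<bar>f x - g x\<bar> \<partial>\<nu>) \<le> (\<integral>x. \<bar>f x - s i x\<bar> + \<bar>s i x - g x\<bar> \<partial>\<nu>)"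
      using f lim(1,4) by (intro integral_mono) auto
    also have "\<dots> = (\<integral>x. \<bar>f x - s i x\<bar> \<partial>\<nu>) + (\<integral>x. \<bar>s i x - g x\<bar> \<partial>\<nu>)"
      using f lim(1,4) by (intro Bochner_Integration.integral_add) auto
    also have "\<dots> < e" using f i by linarith
    finally show "\<exists>f. continuous_on UNIV f \<and> integrable \<nu> f \<and> (\<integral>x. \<bar>f x - g x\<bar> \<partial>\<nu>) < e"
      using f by blast
  qed
qed

section \<open>Relative entropy\<close>

text \<open>On (0, 1) the inequality ln (1/x) \<le> 1/x - 1 gives - x ln x \<le> 1 - x. With x a
  density, this bounds the negative part of the entropy integrand.\<close>

lemma neg_xlnx_le_1: "x * max 0 (- ln x) \<le> 1" if "0 \<le> x" for x :: real
proof (cases "x = 0 \<or> x \<ge> 1")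
  case True
  then show ?thesis by auto
next
  case False
  then have x: "0 < x" "x < 1" using that by auto
  have "- ln x = ln (1 / x)" using x by (simp add: ln_div)
  also have "\<dots> \<le> 1 / x - 1" using x by (intro ln_le_minus_one) auto
  finally have "x * (- ln x) \<le> x * (1 / x - 1)" using x by (intro mult_left_mono) auto
  also have "\<dots> = 1 - x" using x by (simp add: field_simps)
  finally show ?thesis using x by (simp add: max_def)
qed

text \<open>The difference of extended integrals in \<open>rel_entropy\<close> is never \<infinity>
  - \<infinity>: integrated against \<mu>, the negative part of ln p equals the \<gamma>-integral of
  p * max 0 (- ln p), hence is at most 1. The entropy is therefore infinite exactly when ln p fails
  to be integrable. The a.e. uniqueness of the Radon-Nikodym derivative allows any version
  p.\<close>

lemma rel_entropy_density:
  assumes \<gamma>: "\<gamma> \<in> M1" and [measurable]: "p \<in> borel_measurable borel" and p0: "\<And>x. 0 \<le> p x"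
    and \<mu>: "\<mu> \<in> M1" "\<mu> = density \<gamma> (\<lambda>x. ennreal (p x))"
  shows "rel_entropy \<mu> \<gamma> = (if integrable \<mu> (\<lambda>x. ln (p x)) then ereal (\<integral>x. ln (p x) \<partial>\<mu>) else \<infinity>)"
    and "(\<integral>\<^sup>+x. ennreal (max 0 (- ln (p x))) \<partial>\<mu>) \<le> 1"
proof -
  interpret G: prob_space \<gamma> using \<gamma> by (rule M1_D)
  interpret M: prob_space \<mu> using \<mu>(1) by (rule M1_D)
  note [measurable_cong] = M1_D(1)[OF \<gamma>] M1_D(1)[OF \<mu>(1)]
  have ac: "absolutely_continuous \<gamma> \<mu>" unfolding \<mu>(2) by (rule absolutely_continuousI_density) simp
  have "AE x in \<gamma>. ennreal (p x) = RN_deriv \<gamma> \<mu> x"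
    by (rule G.RN_deriv_unique) (auto simp: \<mu>(2))
  then have "AE x in \<gamma>. p x = enn2real (RN_deriv \<gamma> \<mu> x)"
    by eventually_elim (metis enn2real_ennreal p0)
  then have ae: "AE x in \<mu>. p x = enn2real (RN_deriv \<gamma> \<mu> x)"
    using absolutely_continuous_AE[OF _ ac] M1_D[OF \<gamma>] M1_D[OF \<mu>(1)] by auto
  let ?P = "\<integral>\<^sup>+x. ennreal (max 0 (ln (p x))) \<partial>\<mu>"
  let ?N = "\<integral>\<^sup>+x. ennreal (max 0 (- ln (p x))) \<partial>\<mu>"
  have "?N = (\<integral>\<^sup>+x. ennreal (p x * max 0 (- ln (p x))) \<partial>\<gamma>)"
    unfolding \<mu>(2) using p0 by (subst nn_integral_density) (auto simp: ennreal_mult)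
  also have "\<dots> \<le> (\<integral>\<^sup>+x. 1 \<partial>\<gamma>)"
    using neg_xlnx_le_1[OF p0] by (intro nn_integral_mono) (auto simp: ennreal_le_1)
  also have "\<dots> = 1" by (simp add: G.emeasure_space_1)
  finally show N: "?N \<le> 1" .
  then have Nfin: "?N < \<infinity>" using order.strict_trans1 by fastforce
  have H: "rel_entropy \<mu> \<gamma> = enn2ereal ?P - enn2ereal ?N"
    unfolding rel_entropy_def using ac ae
    by (auto intro!: arg_cong2[where f = "(-)"] arg_cong[where f = enn2ereal] nn_integral_cong_AE elim!: eventually_mono)
  show "rel_entropy \<mu> \<gamma> = (if integrable \<mu> (\<lambda>x. ln (p x)) then ereal (\<integral>x. ln (p x) \<partial>\<mu>) else \<infinity>)"
  proof (cases "?P < \<infinity>")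
    case True
    then have i: "integrable \<mu> (\<lambda>x. max 0 (ln (p x)))" "integrable \<mu> (\<lambda>x. max 0 (- ln (p x)))"
      using Nfin by (auto intro!: integrableI_nonneg)
    have eq: "ln (p x) = max 0 (ln (p x)) - max 0 (- ln (p x))" for x by auto
    have 1: "integrable \<mu> (\<lambda>x. ln (p x))" by (subst eq) (rule Bochner_Integration.integrable_diff[OF i])
    have 2: "(\<integral>x. ln (p x) \<partial>\<mu>) = (\<integral>x. max 0 (ln (p x)) \<partial>\<mu>) - (\<integral>x. max 0 (- ln (p x)) \<partial>\<mu>)"
      by (subst eq) (rule Bochner_Integration.integral_diff[OF i])
    have "?P = ennreal (\<integral>x. max 0 (ln (p x)) \<partial>\<mu>)" "?N = ennreal (\<integral>x. max 0 (- ln (p x)) \<partial>\<mu>)"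
      using i by (simp_all only: nn_integral_eq_integral max.cobounded1 eventually_True)
    then show ?thesis unfolding H 2 using 1 by (simp add: enn2ereal_ennreal)
  next
    case False
    then have P: "?P = \<infinity>" by (metis infinity_ennreal_def less_top)
    have "\<not> integrable \<mu> (\<lambda>x. ln (p x))"
    proof
      assume "integrable \<mu> (\<lambda>x. ln (p x))"
      then have "integrable \<mu> (\<lambda>x. max 0 (ln (p x)))" by auto
      then have "?P < \<infinity>" by (subst nn_integral_eq_integral) auto
      with False show False by simp
    qed
    moreover have "enn2ereal ?N \<noteq> \<infinity>" using Nfin by (metis less_irrefl enn2ereal_eq_top_iff infinity_ennreal_def)
    ultimately show ?thesis unfolding H using P by (cases "enn2ereal ?N") auto
  qed
qed

lemma absolutely_continuous_density:
  assumes \<gamma>: "\<gamma> \<in> M1" and \<mu>: "\<mu> \<in> M1" and ac: "absolutely_continuous \<gamma> \<mu>"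
  obtains p where "p \<in> borel_measurable borel" "\<And>x. 0 \<le> p x" "\<mu> = density \<gamma> (\<lambda>x. ennreal (p x))"
proof -
  interpret G: prob_space \<gamma> using \<gamma> by (rule M1_D)
  interpret M: prob_space \<mu> using \<mu>(1) by (rule M1_D)
  note [measurable_cong] = M1_D(1)[OF \<gamma>] M1_D(1)[OF \<mu>(1)]
  have s: "sets \<mu> = sets \<gamma>" using M1_D[OF \<gamma>] M1_D[OF \<mu>] by simp
  obtain D where D: "D \<in> borel_measurable \<gamma>" "AE x in \<gamma>. RN_deriv \<gamma> \<mu> x = ennreal (D x)" "\<And>x. 0 \<le> D x"
    using G.real_RN_deriv[OF M.finite_measure_axioms ac s] by blast
  have "\<mu> = density \<gamma> (RN_deriv \<gamma> \<mu>)" using G.density_RN_deriv[OF ac s] by simp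
  also have "\<dots> = density \<gamma> (\<lambda>x. ennreal (D x))" using D by (intro density_cong) auto
  finally show ?thesis using that[of D] D by auto
qed

lemma density_pos_AE:
  assumes [measurable]: "p \<in> borel_measurable M" and "\<mu> = density M (\<lambda>x. ennreal (p x))"
  shows "AE x in \<mu>. 0 < p x"
  unfolding assms(2) by (subst AE_density) (auto simp: ennreal_zero_less_mult_iff)

text \<open>Only an inequality holds: where p vanishes, the quotient is 0 and the mass of f is
  lost.\<close>

lemma nn_integral_density_divide_le:
  assumes [measurable]: "p \<in> borel_measurable M" "f \<in> borel_measurable M" and p: "\<And>x. 0 \<le> p x" and f: "\<And>x. 0 \<le> f x"
  shows "(\<integral>\<^sup>+x. ennreal (f x / p x) \<partial>density M (\<lambda>x. ennreal (p x))) \<le> (\<integral>\<^sup>+x. ennreal (f x) \<partial>M)"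
proof (subst nn_integral_density)
  show "(\<integral>\<^sup>+x. ennreal (p x) * ennreal (f x / p x) \<partial>M) \<le> (\<integral>\<^sup>+x. ennreal (f x) \<partial>M)"
  proof (intro nn_integral_mono)
    fix x
    have "p x * (f x / p x) \<le> f x" using f by auto
    then show "ennreal (p x) * ennreal (f x / p x) \<le> ennreal (f x)"
      using p f by (subst ennreal_mult[symmetric]) (auto intro!: ennreal_leI simp del: times_divide_eq_right)
  qed
qed auto

section \<open>The variational formula for relative entropy\<close>

text \<open>The easy half of the duality. With c the logarithm of the exponential integral, the
  bound y \<le> exp y - 1 is applied at y = f - c - ln p and integrated against \<mu>; the
  exponential term has integral at most 1 by the choice of c.\<close>

lemma gibbs_variational:
  fixes f :: "real \<Rightarrow> real"
  assumes \<gamma>: "\<gamma> \<in> M1" and \<mu>: "\<mu> \<in> M1" and f[measurable]: "f \<in> borel_measurable borel" and bd: "\<And>x. \<bar>f x\<bar> \<le> B"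
    and H: "rel_entropy \<mu> \<gamma> \<le> ereal h"
  shows "(\<integral>x. f x \<partial>\<mu>) \<le> h + ln (\<integral>x. exp (f x) \<partial>\<gamma>)"
proof -
  interpret G: prob_space \<gamma> using \<gamma> by (rule M1_D)
  interpret M: prob_space \<mu> using \<mu>(1) by (rule M1_D)
  note [measurable_cong] = M1_D(1)[OF \<gamma>] M1_D(1)[OF \<mu>(1)]
  have "absolutely_continuous \<gamma> \<mu>" using H by (auto simp: rel_entropy_def split: if_splits)
  then obtain p where p[measurable]: "p \<in> borel_measurable borel" and p0: "\<And>x. 0 \<le> p x" and \<mu>p: "\<mu> = density \<gamma> (\<lambda>x. ennreal (p x))"
    using absolutely_continuous_density[OF \<gamma> \<mu>] by metis
  have i: "integrable \<mu> (\<lambda>x. ln (p x))" and Hh: "(\<integral>x. ln (p x) \<partial>\<mu>) \<le> h"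
    using H rel_entropy_density(1)[OF \<gamma> p p0 \<mu> \<mu>p] by (auto split: if_splits)
  have pos: "AE x in \<mu>. 0 < p x" using density_pos_AE[OF _ \<mu>p] by simp
  have fi: "integrable \<mu> f" by (rule M.integrable_const_bound[of _ B]) (use bd in auto)
  have ei: "integrable \<gamma> (\<lambda>x. exp (f x))"
    using bd by (intro G.integrable_const_bound[of _ "exp B"]) (auto intro: order_trans[OF abs_ge_self])
  have Ipos: "(\<integral>x. exp (f x) \<partial>\<gamma>) > 0"
    by (rule G.expectation_greater) (use ei in auto)
  define c where "c = ln (\<integral>x. exp (f x) \<partial>\<gamma>)"
  have ec: "exp c = (\<integral>x. exp (f x) \<partial>\<gamma>)" using Ipos by (simp add: c_def)
  have "(\<integral>\<^sup>+x. ennreal (exp (f x - c) / p x) \<partial>\<mu>) \<le> (\<integral>\<^sup>+x. ennreal (exp (f x - c)) \<partial>\<gamma>)"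
    unfolding \<mu>p by (rule nn_integral_density_divide_le) (use p0 in auto)
  also have "\<dots> = ennreal (\<integral>x. exp (f x - c) \<partial>\<gamma>)"
    using ei by (intro nn_integral_eq_integral) (auto simp: exp_diff)
  also have "(\<integral>x. exp (f x - c) \<partial>\<gamma>) = 1" using Ipos by (simp add: exp_diff ec)
  finally have le1: "(\<integral>\<^sup>+x. ennreal (exp (f x - c) / p x) \<partial>\<mu>) \<le> 1" by simp
  then have gi: "integrable \<mu> (\<lambda>x. exp (f x - c) / p x)"
    using p0 by (intro integrableI_nonneg) (auto intro: order.strict_trans1)
  have "ennreal (\<integral>x. exp (f x - c) / p x \<partial>\<mu>) \<le> 1"
    using le1 gi p0 by (subst nn_integral_eq_integral[symmetric]) auto
  then have g1: "(\<integral>x. exp (f x - c) / p x \<partial>\<mu>) \<le> 1" by (simp add: ennreal_le_1)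
  have "(\<integral>x. f x - c - ln (p x) \<partial>\<mu>) \<le> (\<integral>x. exp (f x - c) / p x - 1 \<partial>\<mu>)"
  proof (rule integral_mono_AE)
    show "AE x in \<mu>. f x - c - ln (p x) \<le> exp (f x - c) / p x - 1"
      using pos
    proof eventually_elim
      case (elim x)
      have "f x - c - ln (p x) \<le> exp (f x - c - ln (p x)) - 1"
        using exp_ge_add_one_self[of "f x - c - ln (p x)"] by linarith
      also have "exp (f x - c - ln (p x)) = exp (f x - c) / p x" using elim by (simp add: exp_diff)
      finally show ?case .
    qed
  qed (use fi i gi in auto)
  also have "\<dots> \<le> 0" using gi g1 by (simp add: M.prob_space)
  finally have "(\<integral>x. f x \<partial>\<mu>) - c - (\<integral>x. ln (p x) \<partial>\<mu>) \<le> 0" using fi i by (simp add: M.prob_space)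
  then show ?thesis using Hh by (simp add: c_def)
qed

text \<open>Extends the hypothesis from bounded continuous to bounded measurable test functions,
  since the extremal test function is a clipped log-density, which need not be continuous.\<close>

lemma donsker_varadhan_measurable:
  fixes g :: "real \<Rightarrow> real"
  assumes \<gamma>: "\<gamma> \<in> M1" and \<mu>: "\<mu> \<in> M1"
    and le: "\<And>f :: real \<Rightarrow> real. continuous_on UNIV f \<Longrightarrow> bounded (range f) \<Longrightarrow> (\<integral>x. f x \<partial>\<mu>) \<le> c + ln (\<integral>x. exp (f x) \<partial>\<gamma>)"
    and g[measurable]: "g \<in> borel_measurable borel" and bd: "\<And>x. \<bar>g x\<bar> \<le> B"
  shows "(\<integral>x. g x \<partial>\<mu>) \<le> c + ln (\<integral>x. exp (g x) \<partial>\<gamma>)"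
proof -
  interpret G: prob_space \<gamma> using \<gamma> by (rule M1_D)
  interpret M: prob_space \<mu> using \<mu>(1) by (rule M1_D)
  note [measurable_cong] = M1_D(1)[OF \<gamma>] M1_D(1)[OF \<mu>(1)]
  \<comment> \<open>Approximation in L1 of the average of the two measures gives one continuous
    function close to g in both: an error e for the average is at most 2e for each.\<close>
  define \<nu> where "\<nu> = mix (1/2) \<mu> \<gamma>"
  have \<nu>: "\<nu> \<in> M1" unfolding \<nu>_def using \<mu> \<gamma> by (intro mix_in_M1) auto
  interpret N: prob_space \<nu> using \<nu> by (rule M1_D)
  have [measurable_cong]: "sets \<nu> = sets borel" using \<nu> by (rule M1_D)
  have B0: "0 \<le> B" using bd[of 0] by linarith
  have giM: "integrable \<mu> g" by (rule M.integrable_const_bound[of _ B]) (use bd in auto)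
  have giN: "integrable \<nu> g" by (rule N.integrable_const_bound[of _ B]) (use bd in auto)
  have eg: "integrable \<gamma> (\<lambda>x. exp (g x))"
    using bd by (intro G.integrable_const_bound[of _ "exp B"]) (auto intro: order_trans[OF abs_ge_self])
  have Ipos: "(\<integral>x. exp (g x) \<partial>\<gamma>) > 0"
    by (rule G.expectation_greater) (use eg in auto)
  have step: "(\<integral>x. g x \<partial>\<mu>) \<le> 2 * e + (c + ln ((\<integral>x. exp (g x) \<partial>\<gamma>) + exp B * (2 * e)))" if e: "e > 0" for e
  proof -
    obtain f0 where f0: "continuous_on UNIV f0" "integrable \<nu> f0" "(\<integral>x. \<bar>f0 x - g x\<bar> \<partial>\<nu>) < e"
      using L1_approx_continuous[OF M1_D(1)[OF \<nu>] N.finite_measure_axioms giN] e by blast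
    \<comment> \<open>Clipping to [-B, B] does not increase the distance to g, which takes values
      there, and it makes f bounded, so that exp B controls the exponentials.\<close>
    define f where "f x = max (- B) (min B (f0 x))" for x
    have fc: "continuous_on UNIV f" unfolding f_def by (intro continuous_intros f0)
    have fb: "\<bar>f x\<bar> \<le> B" for x unfolding f_def using B0 by auto
    have [measurable]: "f \<in> borel_measurable borel" "f0 \<in> borel_measurable borel"
      using fc f0 by (auto intro: borel_measurable_continuous_onI)
    have fiM: "integrable \<mu> f" by (rule M.integrable_const_bound[of _ B]) (use fb in auto)
    have fiG: "integrable \<gamma> f" by (rule G.integrable_const_bound[of _ B]) (use fb in auto)
    have giG: "integrable \<gamma> g" by (rule G.integrable_const_bound[of _ B]) (use bd in auto)
    have ef: "integrable \<gamma> (\<lambda>x. exp (f x))"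
      using fb by (intro G.integrable_const_bound[of _ "exp B"]) (auto intro: order_trans[OF abs_ge_self])
    have "\<bar>f x - g x\<bar> \<le> \<bar>f0 x - g x\<bar>" for x using bd[of x] by (auto simp: f_def)
    then have "(\<integral>\<^sup>+x. ennreal \<bar>f x - g x\<bar> \<partial>\<nu>) \<le> (\<integral>\<^sup>+x. ennreal \<bar>f0 x - g x\<bar> \<partial>\<nu>)"
      by (intro nn_integral_mono ennreal_leI)
    also have "\<dots> = ennreal (\<integral>x. \<bar>f0 x - g x\<bar> \<partial>\<nu>)" using f0 giN by (intro nn_integral_eq_integral) auto
    also have "\<dots> \<le> ennreal e" using f0 by (intro ennreal_leI) auto
    finally have "ennreal (1/2) * (\<integral>\<^sup>+x. ennreal \<bar>f x - g x\<bar> \<partial>\<mu>) + ennreal (1/2) * (\<integral>\<^sup>+x. ennreal \<bar>f x - g x\<bar> \<partial>\<gamma>) \<le> ennreal e"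
      unfolding \<nu>_def using nn_integral_mix[OF M1_D(1)[OF \<mu>] M1_D(1)[OF \<gamma>], of "\<lambda>x. ennreal \<bar>f x - g x\<bar>" "1/2"] by simp
    moreover have "(\<integral>\<^sup>+x. ennreal \<bar>f x - g x\<bar> \<partial>\<mu>) = ennreal (\<integral>x. \<bar>f x - g x\<bar> \<partial>\<mu>)"
      "(\<integral>\<^sup>+x. ennreal \<bar>f x - g x\<bar> \<partial>\<gamma>) = ennreal (\<integral>x. \<bar>f x - g x\<bar> \<partial>\<gamma>)"
      using fiM fiG giM giG by (auto intro!: nn_integral_eq_integral)
    ultimately have half: "1/2 * (\<integral>x. \<bar>f x - g x\<bar> \<partial>\<mu>) + 1/2 * (\<integral>x. \<bar>f x - g x\<bar> \<partial>\<gamma>) \<le> e"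
    proof -
      have h: "ennreal (1/2) * ennreal a + ennreal (1/2) * ennreal b = ennreal (1/2 * a + 1/2 * b)"
        if "0 \<le> a" "0 \<le> b" for a b :: real
        using that by (simp only: ennreal_plus ennreal_mult mult_nonneg_nonneg zero_le_divide_1_iff zero_le_numeral)
      assume "ennreal (1/2) * (\<integral>\<^sup>+x. ennreal \<bar>f x - g x\<bar> \<partial>\<mu>) + ennreal (1/2) * (\<integral>\<^sup>+x. ennreal \<bar>f x - g x\<bar> \<partial>\<gamma>) \<le> ennreal e"
        "(\<integral>\<^sup>+x. ennreal \<bar>f x - g x\<bar> \<partial>\<mu>) = ennreal (\<integral>x. \<bar>f x - g x\<bar> \<partial>\<mu>)"
        "(\<integral>\<^sup>+x. ennreal \<bar>f x - g x\<bar> \<partial>\<gamma>) = ennreal (\<integral>x. \<bar>f x - g x\<bar> \<partial>\<gamma>)"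
      then show ?thesis using e by (simp only: h integral_nonneg_AE eventually_True abs_ge_zero) (simp add: ennreal_le_iff flip: ennreal_plus)
    qed
    have "0 \<le> (\<integral>x. \<bar>f x - g x\<bar> \<partial>\<mu>)" "0 \<le> (\<integral>x. \<bar>f x - g x\<bar> \<partial>\<gamma>)" by auto
    with half have dM: "(\<integral>x. \<bar>f x - g x\<bar> \<partial>\<mu>) \<le> 2 * e" and dG: "(\<integral>x. \<bar>f x - g x\<bar> \<partial>\<gamma>) \<le> 2 * e" by linarith+
    have "(\<integral>x. g x \<partial>\<mu>) \<le> (\<integral>x. \<bar>f x - g x\<bar> + f x \<partial>\<mu>)"
      using fiM giM by (intro integral_mono) auto
    also have "\<dots> = (\<integral>x. \<bar>f x - g x\<bar> \<partial>\<mu>) + (\<integral>x. f x \<partial>\<mu>)"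
      using fiM giM by (intro Bochner_Integration.integral_add) auto
    also have "\<dots> \<le> 2 * e + (c + ln (\<integral>x. exp (f x) \<partial>\<gamma>))"
      using dM fb by (intro add_mono le fc) (auto intro!: boundedI)
    finally have **: "(\<integral>x. g x \<partial>\<mu>) \<le> 2 * e + (c + ln (\<integral>x. exp (f x) \<partial>\<gamma>))" .
    have "(\<integral>x. exp (f x) \<partial>\<gamma>) \<le> (\<integral>x. exp (g x) + exp B * \<bar>f x - g x\<bar> \<partial>\<gamma>)"
    proof (rule integral_mono)
      fix x
      \<comment> \<open>Convexity of exp in the form of its tangent at f x turns an L1 error of the
        exponents into an L1 error of the exponentials.\<close>
      have "exp (f x) * (1 + (g x - f x)) \<le> exp (f x) * exp (g x - f x)"
        by (intro mult_left_mono exp_ge_add_one_self) auto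
      then have "exp (f x) \<le> exp (g x) + exp (f x) * (f x - g x)"
        by (simp add: algebra_simps flip: exp_add)
      also have "exp (f x) * (f x - g x) \<le> exp B * \<bar>f x - g x\<bar>"
        using fb[of x] by (intro order_trans[OF mult_left_mono[OF abs_ge_self] mult_right_mono]) auto
      finally show "exp (f x) \<le> exp (g x) + exp B * \<bar>f x - g x\<bar>" by simp
    qed (use ef eg fiG giG in auto)
    also have "\<dots> = (\<integral>x. exp (g x) \<partial>\<gamma>) + exp B * (\<integral>x. \<bar>f x - g x\<bar> \<partial>\<gamma>)"
      using eg fiG giG by (subst Bochner_Integration.integral_add) auto
    also have "\<dots> \<le> (\<integral>x. exp (g x) \<partial>\<gamma>) + exp B * (2 * e)" using dG by (intro add_left_mono mult_left_mono) auto
    finally have *: "(\<integral>x. exp (f x) \<partial>\<gamma>) \<le> (\<integral>x. exp (g x) \<partial>\<gamma>) + exp B * (2 * e)" .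
    have "0 < (\<integral>x. exp (f x) \<partial>\<gamma>)" by (rule G.expectation_greater) (use ef in auto)
    then have "ln (\<integral>x. exp (f x) \<partial>\<gamma>) \<le> ln ((\<integral>x. exp (g x) \<partial>\<gamma>) + exp B * (2 * e))"
      using * by simp
    then show ?thesis using ** by linarith
  qed
  let ?X = "\<lambda>n. 2 * (1 / real (Suc n)) + (c + ln ((\<integral>x. exp (g x) \<partial>\<gamma>) + exp B * (2 * (1 / real (Suc n)))))"
  have "?X \<longlonglongrightarrow> 2 * 0 + (c + ln ((\<integral>x. exp (g x) \<partial>\<gamma>) + exp B * (2 * 0)))"
    using Ipos by (intro tendsto_intros LIMSEQ_Suc[OF lim_1_over_n]) auto
  moreover have "(\<integral>x. g x \<partial>\<mu>) \<le> ?X n" for n by (rule step) simp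
  ultimately have "(\<integral>x. g x \<partial>\<mu>) \<le> 2 * 0 + (c + ln ((\<integral>x. exp (g x) \<partial>\<gamma>) + exp B * (2 * 0)))"
    by (meson LIMSEQ_le_const)
  then show ?thesis by simp
qed

text \<open>The hard half of the duality, with clipped log-densities as test functions. The
  \<gamma>-integral of exp (g n) is at most that of p plus exp (- n), so the logarithm on the right
  is at most exp (- n) and disappears in the limit.\<close>

theorem donsker_varadhan:
  assumes \<gamma>: "\<gamma> \<in> M1" and \<mu>: "\<mu> \<in> M1"
    and le: "\<And>f :: real \<Rightarrow> real. continuous_on UNIV f \<Longrightarrow> bounded (range f) \<Longrightarrow> (\<integral>x. f x \<partial>\<mu>) \<le> c + ln (\<integral>x. exp (f x) \<partial>\<gamma>)"
  shows "rel_entropy \<mu> \<gamma> \<le> ereal c"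
proof -
  interpret G: prob_space \<gamma> using \<gamma> by (rule M1_D)
  interpret M: prob_space \<mu> using \<mu>(1) by (rule M1_D)
  note sets_eq[measurable_cong] = M1_D(1)[OF \<gamma>] M1_D(1)[OF \<mu>(1)]
  note le' = donsker_varadhan_measurable[OF \<gamma> \<mu> le]
  have "absolutely_continuous \<gamma> \<mu>"
    unfolding absolutely_continuous_def
  proof
    fix A assume A: "A \<in> null_sets \<gamma>"
    then have [measurable]: "A \<in> sets borel" using sets_eq by auto
    have "AE x in \<gamma>. x \<notin> A" using A by (rule AE_not_in)
    \<comment> \<open>On a \<gamma>-null set A the test function n * 1_A has exponential integral 1,
      so the hypothesis reads n * \<mu>(A) \<le> c for all n.\<close>
    have "real n * measure \<mu> A \<le> c" for n
    proof -
      have "(\<integral>x. real n * indicator A x \<partial>\<mu>) \<le> c + ln (\<integral>x. exp (real n * indicator A x) \<partial>\<gamma>)"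
        by (rule le'[where B = "real n"]) (auto simp: indicator_def)
      also have "(\<integral>x. exp (real n * indicator A x) \<partial>\<gamma>) = (\<integral>x. 1 \<partial>\<gamma>)"
      proof (rule integral_cong_AE)
        show "AE x in \<gamma>. exp (real n * indicator A x) = (1::real)"
          using \<open>AE x in \<gamma>. x \<notin> A\<close> by eventually_elim simp
      qed auto
      finally show ?thesis by (simp add: G.prob_space)
    qed
    then have "measure \<mu> A = 0"
      by (metis (no_types) ex_less_of_nat_mult measure_nonneg not_le le_less)
    then show "A \<in> null_sets \<mu>" using sets_eq by (auto simp: null_sets_def M.emeasure_eq_measure)
  qed
  then obtain p where p[measurable]: "p \<in> borel_measurable borel" and p0: "\<And>x. 0 \<le> p x" and \<mu>p: "\<mu> = density \<gamma> (\<lambda>x. ennreal (p x))"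
    using absolutely_continuous_density[OF \<gamma> \<mu>] by metis
  have pos: "AE x in \<mu>. 0 < p x" using density_pos_AE[OF _ \<mu>p] by simp
  have N: "(\<integral>\<^sup>+x. ennreal (max 0 (- ln (p x))) \<partial>\<mu>) \<le> 1" by (rule rel_entropy_density(2)[OF \<gamma> p p0 \<mu> \<mu>p])
  then have Ni: "integrable \<mu> (\<lambda>x. max 0 (- ln (p x)))" by (intro integrableI_nonneg) (auto intro: order.strict_trans1)
  then have N1: "(\<integral>x. max 0 (- ln (p x)) \<partial>\<mu>) \<le> 1"
    using N by (subst (asm) nn_integral_eq_integral) (auto simp: ennreal_le_1)
  have pi: "(\<integral>\<^sup>+x. ennreal (p x) \<partial>\<gamma>) = 1"
  proof -
    have "emeasure \<mu> UNIV = (\<integral>\<^sup>+x. ennreal (p x) \<partial>\<gamma>)" unfolding \<mu>p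
      using M1_D[OF \<gamma>] by (subst emeasure_density) auto
    then show ?thesis using M.emeasure_space_1 M1_D[OF \<mu>] by simp
  qed
  then have pint: "integrable \<gamma> p" "(\<integral>x. p x \<partial>\<gamma>) = 1"
    using p0 by (auto intro!: integrableI_nonneg simp: integral_eq_nn_integral)
  \<comment> \<open>This is ln p clipped to [- n, n]. The clipping is done before taking the
    logarithm, so zeros of p need no separate treatment, and the lower clip accounts for the error
    exp (- n).\<close>
  define g where "g n x = ln (max (exp (- real n)) (min (exp (real n)) (p x)))" for n x
  have [measurable]: "g n \<in> borel_measurable borel" for n unfolding g_def by measurable
  have gpos: "max (exp (- real n)) (min (exp (real n)) (p x)) > 0" for n x by (simp add: less_max_iff_disj)
  have gb: "\<bar>g n x\<bar> \<le> real n" for n x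
  proof -
    have "g n x \<le> ln (exp (real n))" unfolding g_def using gpos[of n x] by (subst ln_le_cancel_iff) auto
    moreover have "g n x \<ge> ln (exp (- real n))" unfolding g_def using gpos[of n x] by (subst ln_le_cancel_iff) auto
    ultimately show ?thesis by auto
  qed
  have gclamp: "g n x = min (real n) (max 0 (ln (p x))) - min (real n) (max 0 (- ln (p x)))" if "p x > 0" for n x
  proof -
    have "p x \<le> exp (real n) \<longleftrightarrow> ln (p x) \<le> real n" "exp (- real n) \<le> p x \<longleftrightarrow> - real n \<le> ln (p x)"
      using that by (metis exp_le_cancel_iff exp_ln)+
    moreover have e: "exp (- real n) \<le> exp (real n)" by simp
    moreover have "exp (real n) \<le> p x \<Longrightarrow> exp (- real n) \<le> p x" by (rule order_trans[OF e])
    ultimately show ?thesis unfolding g_def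
      using gpos[of n x] by (cases "p x \<le> exp (real n)"; cases "exp (- real n) \<le> p x")
       (auto simp: max_def min_def)
  qed
  have gi: "integrable \<mu> (g n)" for n by (rule M.integrable_const_bound[of _ "real n"]) (use gb in auto)
  have gle: "(\<integral>x. g n x \<partial>\<mu>) \<le> c + exp (- real n)" for n
  proof -
    have ei: "integrable \<gamma> (\<lambda>x. exp (g n x))"
      using gb by (intro G.integrable_const_bound[of _ "exp (real n)"]) (auto intro: order_trans[OF abs_ge_self])
    then have "0 < (\<integral>x. exp (g n x) \<partial>\<gamma>)" by (rule G.expectation_greater) auto
    moreover have "(\<integral>x. g n x \<partial>\<mu>) \<le> c + ln (\<integral>x. exp (g n x) \<partial>\<gamma>)" by (rule le'[where B = "real n"]) (use gb in auto)
    moreover have "(\<integral>x. exp (g n x) \<partial>\<gamma>) \<le> (\<integral>x. p x + exp (- real n) \<partial>\<gamma>)"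
    proof (rule integral_mono)
      show "integrable \<gamma> (\<lambda>x. exp (g n x))" by (rule ei)
      show "exp (g n x) \<le> p x + exp (- real n)" for x
        using p0[of x] gpos[of n x] by (auto simp: g_def max_def min_def intro: add_increasing2)
    qed (use pint in auto)
    moreover have "(\<integral>x. p x + exp (- real n) \<partial>\<gamma>) = 1 + exp (- real n)" using pint by (simp add: G.prob_space)
    moreover have "ln (1 + exp (- real n)) \<le> exp (- real n)" by (rule ln_add_one_self_le_self) simp
    ultimately have "ln (\<integral>x. exp (g n x) \<partial>\<gamma>) \<le> ln (1 + exp (- real n))" by simp
    with \<open>ln (1 + exp (- real n)) \<le> exp (- real n)\<close> \<open>(\<integral>x. g n x \<partial>\<mu>) \<le> c + ln (\<integral>x. exp (g n x) \<partial>\<gamma>)\<close>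
    show ?thesis by linarith
  qed
  let ?P = "\<lambda>n x. min (real n) (max 0 (ln (p x)))" and ?N = "\<lambda>n x. min (real n) (max 0 (- ln (p x)))"
  have Pi: "integrable \<mu> (?P n)" "integrable \<mu> (?N n)" for n
    by (auto intro!: M.integrable_const_bound[of _ "real n"])
  \<comment> \<open>Integrability of ln p is still open here. Since the negative part costs at most
    1 and exp (- n) at most 1, the clipped positive parts have integrals bounded independently of n,
    and Fatou's lemma then gives integrability of the full positive part.\<close>
  have Pb: "(\<integral>x. ?P n x \<partial>\<mu>) \<le> \<bar>c\<bar> + 2" for n
  proof -
    have "(\<integral>x. ?P n x \<partial>\<mu>) = (\<integral>x. g n x + ?N n x \<partial>\<mu>)"
      using pos by (intro integral_cong_AE) (auto elim!: eventually_mono simp: gclamp)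
    also have "\<dots> = (\<integral>x. g n x \<partial>\<mu>) + (\<integral>x. ?N n x \<partial>\<mu>)" using gi Pi by (intro Bochner_Integration.integral_add) auto
    also have "(\<integral>x. ?N n x \<partial>\<mu>) \<le> (\<integral>x. max 0 (- ln (p x)) \<partial>\<mu>)" using Pi Ni by (intro integral_mono) auto
    finally have "(\<integral>x. ?P n x \<partial>\<mu>) \<le> (\<integral>x. g n x \<partial>\<mu>) + 1" using N1 by linarith
    moreover have "exp (- real n) \<le> 1" by simp
    ultimately show ?thesis using gle[of n] by linarith
  qed
  have "(\<integral>\<^sup>+x. ennreal (max 0 (ln (p x))) \<partial>\<mu>) \<le> (\<integral>\<^sup>+x. liminf (\<lambda>n. ennreal (?P n x)) \<partial>\<mu>)"
  proof (intro nn_integral_mono)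
    fix x
    obtain m :: nat where "max 0 (ln (p x)) \<le> real m" using real_arch_simple by blast
    then have "?P n x = max 0 (ln (p x))" if "n \<ge> m" for n
      using that by (metis min.absorb2 of_nat_mono order_trans)
    then have "eventually (\<lambda>n. ennreal (max 0 (ln (p x))) \<le> ennreal (?P n x)) sequentially"
      unfolding eventually_sequentially by (metis order_refl)
    then show "ennreal (max 0 (ln (p x))) \<le> liminf (\<lambda>n. ennreal (?P n x))" by (rule Liminf_bounded)
  qed
  also have "\<dots> \<le> liminf (\<lambda>n. \<integral>\<^sup>+x. ennreal (?P n x) \<partial>\<mu>)" by (rule nn_integral_liminf) auto
  also have "\<dots> \<le> ennreal (\<bar>c\<bar> + 2)"
  proof (rule liminf_le_const)
    fix n
    have "(\<integral>\<^sup>+x. ennreal (?P n x) \<partial>\<mu>) = ennreal (\<integral>x. ?P n x \<partial>\<mu>)"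
      by (rule nn_integral_eq_integral) (use Pi in auto)
    then show "(\<integral>\<^sup>+x. ennreal (?P n x) \<partial>\<mu>) \<le> ennreal (\<bar>c\<bar> + 2)" using Pb[of n] by (simp only: ennreal_leI)
  qed
  also have "\<dots> < \<infinity>" by simp
  finally have "integrable \<mu> (\<lambda>x. max 0 (ln (p x)))" by (intro integrableI_nonneg) auto
  then have "integrable \<mu> (\<lambda>x. max 0 (ln (p x)) - max 0 (- ln (p x)))" using Ni by (rule Bochner_Integration.integrable_diff)
  moreover have "max 0 (ln (p x)) - max 0 (- ln (p x)) = ln (p x)" for x by auto
  ultimately have Li: "integrable \<mu> (\<lambda>x. ln (p x))" by simp
  have "(\<lambda>n. \<integral>x. g n x \<partial>\<mu>) \<longlonglongrightarrow> (\<integral>x. ln (p x) \<partial>\<mu>)"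
  proof (rule integral_dominated_convergence)
    show "integrable \<mu> (\<lambda>x. \<bar>ln (p x)\<bar>)" using Li by simp
    show "AE x in \<mu>. (\<lambda>n. g n x) \<longlonglongrightarrow> ln (p x)"
      using pos
    proof eventually_elim
      case (elim x)
      obtain m :: nat where m: "\<bar>ln (p x)\<bar> \<le> real m" using real_arch_simple by blast
      have "g n x = ln (p x)" if "n \<ge> m" for n
        using that m gclamp[OF elim, of n] by (auto simp: min_def max_def)
      then show ?case by (intro tendsto_eventually) (auto simp: eventually_sequentially)
    qed
    show "AE x in \<mu>. norm (g n x) \<le> \<bar>ln (p x)\<bar>" for n
      using pos by eventually_elim (auto simp: gclamp)
  qed auto
  moreover have "(\<lambda>n. c + exp (- real n)) \<longlonglongrightarrow> c + 0"
    by (intro tendsto_intros) real_asymp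
  ultimately have "(\<integral>x. ln (p x) \<partial>\<mu>) \<le> c" using gle by (auto intro: LIMSEQ_le)
  then show ?thesis using rel_entropy_density(1)[OF \<gamma> p p0 \<mu> \<mu>p] Li by simp
qed

section \<open>Strict convexity of relative entropy\<close>

text \<open>The right-hand side is the tangent of x ln x at z. Divided by x > 0, the claim becomes
  ln (z/x) \<le> z/x - 1, with equality only at x = z; at x = 0 it reads 0 > - z.\<close>

lemma xlnx_tangent:
  fixes x z :: real
  assumes "0 \<le> x" "0 < z"
  shows "x * ln x \<ge> z * ln z + (1 + ln z) * (x - z)"
    and "x \<noteq> z \<Longrightarrow> x * ln x > z * ln z + (1 + ln z) * (x - z)"
proof -
  have "x * ln x > z * ln z + (1 + ln z) * (x - z)" if "x \<noteq> z"
  proof (cases "x = 0")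
    case False
    then have x: "0 < x" using assms by auto
    have "ln (z / x) \<noteq> z / x - 1" using ln_eq_minus_one[of "z / x"] x assms that by auto
    moreover have "ln (z / x) \<le> z / x - 1" using x assms by (intro ln_le_minus_one) auto
    ultimately have "ln z - ln x < z / x - 1" using x assms by (simp add: ln_div)
    then have "x * (ln z - ln x) < x * (z / x - 1)" using x by (intro mult_strict_left_mono) auto
    also have "\<dots> = z - x" using x by (simp add: field_simps)
    finally show ?thesis by (simp add: algebra_simps)
  qed (use assms in \<open>simp add: algebra_simps\<close>)
  then show "x \<noteq> z \<Longrightarrow> x * ln x > z * ln z + (1 + ln z) * (x - z)"
    and "x * ln x \<ge> z * ln z + (1 + ln z) * (x - z)" by (auto simp: less_le) (cases "x = z"; force)
qed

text \<open>Both endpoints are compared with the tangent at the mixture z; in the weighted sum the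
  slope terms cancel. Distinct endpoints force z > 0, so the tangent exists.\<close>

lemma xlnx_strict_convex:
  fixes x y t :: real
  assumes "0 \<le> x" "0 \<le> y" "0 < t" "t < 1"
  defines "z \<equiv> t * x + (1 - t) * y"
  shows "z * ln z \<le> t * (x * ln x) + (1 - t) * (y * ln y)"
    and "x \<noteq> y \<Longrightarrow> z * ln z < t * (x * ln x) + (1 - t) * (y * ln y)"
proof -
  have "z * ln z < t * (x * ln x) + (1 - t) * (y * ln y)" if "x \<noteq> y"
  proof -
    have "z \<ge> 0" unfolding z_def using assms by simp
    moreover have "z \<noteq> 0"
    proof
      assume "z = 0"
      then have "t * x = 0" "(1 - t) * y = 0" using assms add_nonneg_eq_0_iff[of "t * x" "(1 - t) * y"] by (auto simp: z_def)
      then show False using assms that by auto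
    qed
    ultimately have z: "z > 0" by simp
    have "x - z = (1 - t) * (x - y)" by (simp add: z_def algebra_simps)
    then have "x \<noteq> z" using that assms by auto
    then have "t * (x * ln x) > t * (z * ln z + (1 + ln z) * (x - z))"
      using xlnx_tangent(2)[OF _ z] assms by (intro mult_strict_left_mono) auto
    moreover have "(1 - t) * (y * ln y) \<ge> (1 - t) * (z * ln z + (1 + ln z) * (y - z))"
      using xlnx_tangent(1)[OF _ z] assms by (intro mult_left_mono) auto
    moreover have "t * (z * ln z + (1 + ln z) * (x - z)) + (1 - t) * (z * ln z + (1 + ln z) * (y - z))
       = z * ln z + (1 + ln z) * (t * x + (1 - t) * y - z)" by (simp add: algebra_simps)
    ultimately show ?thesis by (simp add: z_def)
  qed
  moreover have "z * ln z = t * (x * ln x) + (1 - t) * (y * ln y)" if "x = y"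
    using that by (simp add: z_def algebra_simps)
  ultimately show "z * ln z \<le> t * (x * ln x) + (1 - t) * (y * ln y)"
    and "x \<noteq> y \<Longrightarrow> z * ln z < t * (x * ln x) + (1 - t) * (y * ln y)" by (cases "x = y"; force intro: less_imp_le)+
qed

lemma mix_density:
  assumes \<gamma>: "sets \<gamma> = sets borel" and [measurable]: "p \<in> borel_measurable borel" "q \<in> borel_measurable borel"
    and "\<And>x. 0 \<le> p x" "\<And>x. 0 \<le> q x" "0 \<le> t" "t \<le> 1"
  shows "mix t (density \<gamma> (\<lambda>x. ennreal (p x))) (density \<gamma> (\<lambda>x. ennreal (q x))) =
    density \<gamma> (\<lambda>x. ennreal (t * p x + (1 - t) * q x))"
proof (rule measure_eqI)
  note [measurable_cong] = \<gamma>
  fix A assume "A \<in> sets (mix t (density \<gamma> (\<lambda>x. ennreal (p x))) (density \<gamma> (\<lambda>x. ennreal (q x))))"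
  then have A[measurable]: "A \<in> sets borel" by simp
  then have A'[measurable]: "A \<in> sets \<gamma>" using \<gamma> by simp
  have "emeasure (mix t (density \<gamma> (\<lambda>x. ennreal (p x))) (density \<gamma> (\<lambda>x. ennreal (q x)))) A =
    ennreal t * (\<integral>\<^sup>+x. ennreal (p x) * indicator A x \<partial>\<gamma>) + ennreal (1 - t) * (\<integral>\<^sup>+x. ennreal (q x) * indicator A x \<partial>\<gamma>)"
    using \<gamma> by (simp add: emeasure_mix emeasure_density)
  also have "\<dots> = (\<integral>\<^sup>+x. ennreal t * (ennreal (p x) * indicator A x) + ennreal (1 - t) * (ennreal (q x) * indicator A x) \<partial>\<gamma>)"
    by (simp add: nn_integral_add nn_integral_cmult)
  also have "\<dots> = (\<integral>\<^sup>+x. ennreal (t * p x + (1 - t) * q x) * indicator A x \<partial>\<gamma>)"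
    using assms by (intro nn_integral_cong) (auto simp: ennreal_mult ennreal_plus split: split_indicator)
  finally show "emeasure (mix t (density \<gamma> (\<lambda>x. ennreal (p x))) (density \<gamma> (\<lambda>x. ennreal (q x)))) A =
    emeasure (density \<gamma> (\<lambda>x. ennreal (t * p x + (1 - t) * q x))) A" by (simp add: emeasure_density)
qed (use \<gamma> in simp)

lemma rel_entropy_finite_density:
  assumes \<gamma>: "\<gamma> \<in> M1" and \<mu>: "\<mu> \<in> M1" and H: "rel_entropy \<mu> \<gamma> < \<infinity>"
  obtains p where "p \<in> borel_measurable borel" "\<And>x. 0 \<le> p x" "\<mu> = density \<gamma> (\<lambda>x. ennreal (p x))"
    "integrable \<mu> (\<lambda>x. ln (p x))" "rel_entropy \<mu> \<gamma> = ereal (\<integral>x. ln (p x) \<partial>\<mu>)"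
proof -
  have "absolutely_continuous \<gamma> \<mu>" using H by (auto simp: rel_entropy_def split: if_splits)
  then obtain p where p: "p \<in> borel_measurable borel" "\<And>x. 0 \<le> p x" "\<mu> = density \<gamma> (\<lambda>x. ennreal (p x))"
    using absolutely_continuous_density[OF \<gamma> \<mu>] by metis
  moreover note rel_entropy_density(1)[OF \<gamma> p(1,2) \<mu> p(3)]
  ultimately show ?thesis using H by (intro that[of p]) (auto split: if_splits)
qed

text \<open>In terms of densities the entropy is the \<gamma>-integral of p ln p. Pointwise strict
  convexity means that equality of the integrals would force p = q almost everywhere, that is, equal
  measures.\<close>

lemma rel_entropy_strict_convex:
  assumes \<gamma>: "\<gamma> \<in> M1" and \<mu>: "\<mu> \<in> M1" "\<nu> \<in> M1" "\<mu> \<noteq> \<nu>" and t: "0 < t" "t < 1"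
    and H: "rel_entropy \<mu> \<gamma> < \<infinity>" "rel_entropy \<nu> \<gamma> < \<infinity>"
  shows "rel_entropy (mix t \<mu> \<nu>) \<gamma> < ereal t * rel_entropy \<mu> \<gamma> + ereal (1 - t) * rel_entropy \<nu> \<gamma>"
proof -
  interpret G: prob_space \<gamma> using \<gamma> by (rule M1_D)
  note [measurable_cong] = M1_D(1)[OF \<gamma>]
  obtain p where p[measurable]: "p \<in> borel_measurable borel" and p0: "\<And>x. 0 \<le> p x" and \<mu>p: "\<mu> = density \<gamma> (\<lambda>x. ennreal (p x))"
    and pi: "integrable \<mu> (\<lambda>x. ln (p x))" and pH: "rel_entropy \<mu> \<gamma> = ereal (\<integral>x. ln (p x) \<partial>\<mu>)"
    using rel_entropy_finite_density[OF \<gamma> \<mu>(1) H(1)] by metis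
  obtain q where q[measurable]: "q \<in> borel_measurable borel" and q0: "\<And>x. 0 \<le> q x" and \<nu>q: "\<nu> = density \<gamma> (\<lambda>x. ennreal (q x))"
    and qi: "integrable \<nu> (\<lambda>x. ln (q x))" and qH: "rel_entropy \<nu> \<gamma> = ereal (\<integral>x. ln (q x) \<partial>\<nu>)"
    using rel_entropy_finite_density[OF \<gamma> \<mu>(2) H(2)] by metis
  define r where "r x = t * p x + (1 - t) * q x" for x
  have [measurable]: "r \<in> borel_measurable borel" unfolding r_def by measurable
  have r0: "0 \<le> r x" for x using p0[of x] q0[of x] t by (simp add: r_def)
  have mr: "mix t \<mu> \<nu> = density \<gamma> (\<lambda>x. ennreal (r x))"
    unfolding \<mu>p \<nu>q r_def using t p0 q0 M1_D(1)[OF \<gamma>] by (intro mix_density) auto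
  have mM: "mix t \<mu> \<nu> \<in> M1" using \<mu> t by (intro mix_in_M1) auto
  have gp: "integrable \<gamma> (\<lambda>x. p x * ln (p x))" "(\<integral>x. ln (p x) \<partial>\<mu>) = (\<integral>x. p x * ln (p x) \<partial>\<gamma>)"
    using pi p0 unfolding \<mu>p by (auto simp: integrable_density integral_density)
  have gq: "integrable \<gamma> (\<lambda>x. q x * ln (q x))" "(\<integral>x. ln (q x) \<partial>\<nu>) = (\<integral>x. q x * ln (q x) \<partial>\<gamma>)"
    using qi q0 unfolding \<nu>q by (auto simp: integrable_density integral_density)
  let ?S = "\<lambda>x. t * (p x * ln (p x)) + (1 - t) * (q x * ln (q x))"
  have Si: "integrable \<gamma> ?S" using gp gq by auto
  have rS: "r x * ln (r x) \<le> ?S x" for x unfolding r_def using p0 q0 t by (intro xlnx_strict_convex(1)) auto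
  \<comment> \<open>Above, r ln r is dominated by the integrable convex combination; below it is at
    least -1, a constant integrable for the probability \<gamma>.\<close>
  have gr: "integrable \<gamma> (\<lambda>x. r x * ln (r x))"
  proof (rule Bochner_Integration.integrable_bound)
    show "integrable \<gamma> (\<lambda>x. \<bar>?S x\<bar> + 1)" using Si by auto
    show "AE x in \<gamma>. norm (r x * ln (r x)) \<le> norm (\<bar>?S x\<bar> + 1)"
    proof (rule AE_I2)
      fix x
      have "- (r x * ln (r x)) \<le> r x * max 0 (- ln (r x))"
        using mult_left_mono[OF max.cobounded2[of "- ln (r x)" 0] r0] by simp
      also have "\<dots> \<le> 1" by (rule neg_xlnx_le_1[OF r0])
      finally show "norm (r x * ln (r x)) \<le> norm (\<bar>?S x\<bar> + 1)" using rS[of x] by (auto simp: abs_le_iff)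
    qed
  qed auto
  have ir: "integrable (mix t \<mu> \<nu>) (\<lambda>x. ln (r x))" "(\<integral>x. ln (r x) \<partial>mix t \<mu> \<nu>) = (\<integral>x. r x * ln (r x) \<partial>\<gamma>)"
    unfolding mr using gr r0 by (auto simp: integrable_density integral_density)
  have rH: "rel_entropy (mix t \<mu> \<nu>) \<gamma> = ereal (\<integral>x. r x * ln (r x) \<partial>\<gamma>)"
    using rel_entropy_density(1)[OF \<gamma> _ r0 mM mr] ir by simp
  have "(\<integral>x. r x * ln (r x) \<partial>\<gamma>) < (\<integral>x. ?S x \<partial>\<gamma>)"
  proof (rule ccontr)
    assume "\<not> ?thesis"
    then have "(\<integral>x. ?S x - r x * ln (r x) \<partial>\<gamma>) \<le> 0" using Si gr by (subst Bochner_Integration.integral_diff) auto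
    moreover have "(\<integral>x. ?S x - r x * ln (r x) \<partial>\<gamma>) \<ge> 0" using rS by (intro Bochner_Integration.integral_nonneg) simp
    ultimately have "(\<integral>x. ?S x - r x * ln (r x) \<partial>\<gamma>) = 0" by simp
    then have "AE x in \<gamma>. ?S x - r x * ln (r x) = 0"
      using rS Si gr by (subst (asm) integral_nonneg_eq_0_iff_AE) auto
    then have "AE x in \<gamma>. ennreal (p x) = ennreal (q x)"
    proof eventually_elim
      case (elim x)
      then show ?case using xlnx_strict_convex(2)[OF p0[of x] q0[of x] t] by (cases "p x = q x") (auto simp: r_def)
    qed
    then have "\<mu> = \<nu>" unfolding \<mu>p \<nu>q by (intro density_cong) auto
    with \<mu> show False by simp
  qed
  also have "(\<integral>x. ?S x \<partial>\<gamma>) = t * (\<integral>x. ln (p x) \<partial>\<mu>) + (1 - t) * (\<integral>x. ln (q x) \<partial>\<nu>)"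
    using gp gq by simp
  finally show ?thesis unfolding rH pH qH by simp
qed

section \<open>Weak compactness of moment sets\<close>

lemma topspace_weak_top [simp]: "topspace weak_top = M1"
proof -
  have "M1 = {\<mu> \<in> M1. (\<integral>x. (0::real) \<partial>\<mu>) \<in> UNIV}" by auto
  then have "M1 \<in> weak_subbase" unfolding weak_subbase_def
    by (auto intro!: exI[of _ "\<lambda>x. 0 :: real"] exI[of _ UNIV])
  then show ?thesis unfolding weak_top_def topology_generated_by_topspace by (auto simp: weak_subbase_def)
qed

lemma openin_weak_top:
  assumes "continuous_on UNIV f" "bounded (range f)" "open (U :: real set)"
  shows "openin weak_top {\<mu> \<in> M1. (\<integral>x. f x \<partial>\<mu>) \<in> U}"
  unfolding weak_top_def by (rule topology_generated_by_Basis) (use assms in \<open>auto simp: weak_subbase_def\<close>)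

lemma closedin_weak_top:
  assumes "continuous_on UNIV f" "bounded (range f)" "closed (C :: real set)"
  shows "closedin weak_top {\<mu> \<in> M1. (\<integral>x. f x \<partial>\<mu>) \<in> C}"
proof -
  have "topspace weak_top - {\<mu> \<in> M1. (\<integral>x. f x \<partial>\<mu>) \<in> C} = {\<mu> \<in> M1. (\<integral>x. f x \<partial>\<mu>) \<in> - C}" by auto
  then show ?thesis unfolding closedin_def using openin_weak_top[OF assms(1,2), of "- C"] assms(3) by auto
qed

lemma bounded_continuous_measurable:
  assumes "continuous_on UNIV f" "bounded (range f)"
  shows "f \<in> borel_measurable borel" "\<exists>B>0. \<forall>x. \<bar>f x :: real\<bar> \<le> B"
  using assms by (auto intro: borel_measurable_continuous_onI simp: bounded_pos)

lemma integrable_bounded_M1: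
  fixes f :: "real \<Rightarrow> real"
  assumes "\<mu> \<in> M1" "f \<in> borel_measurable borel" "\<And>x. \<bar>f x\<bar> \<le> B"
  shows "integrable \<mu> f"
proof -
  interpret prob_space \<mu> using assms by (auto dest: M1_D)
  have "f \<in> borel_measurable \<mu>" using assms M1_D[of \<mu>] by (auto cong: measurable_cong_sets)
  then show ?thesis using assms by (intro integrable_const_bound[of _ B]) auto
qed

text \<open>A countable family of bounded continuous functions whose linear combinations approximate every
  bounded continuous function uniformly in integral over a tight set. Their integrals embed such a set
  into a metrizable space, where compactness can be checked on sequences.\<close>
definition bern :: "nat \<times> nat \<times> nat \<Rightarrow> real \<Rightarrow> real" where
  "bern = (\<lambda>(i, n, k) x. Bernstein n k ((max (- real (Suc i)) (min (real (Suc i)) x) + real (Suc i)) / (2 * real (Suc i))))"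

lemma Bernstein_le_1: assumes "0 \<le> x" "x \<le> 1" shows "Bernstein n k x \<le> 1"
proof (cases "k \<le> n")
  case True
  then have "Bernstein n k x \<le> (\<Sum>k\<le>n. Bernstein n k x)"
    using assms by (intro member_le_sum) (auto intro: Bernstein_nonneg)
  then show ?thesis by simp
qed (simp add: Bernstein_def binomial_eq_0)

lemma clamp_unit: "0 \<le> (max (- r) (min r x) + r) / (2 * r)" "(max (- r) (min r x) + r) / (2 * r) \<le> 1" if "r > 0" for r x :: real
  using that by (auto simp: field_simps)

lemma bern_01: "0 \<le> bern j x" "bern j x \<le> 1"
  by (cases j; simp only: bern_def case_prod_conv; intro Bernstein_nonneg Bernstein_le_1 clamp_unit; simp)+

lemma bern_continuous: "continuous_on UNIV (bern j)"
  by (cases j) (auto simp: bern_def Bernstein_def intro!: continuous_intros)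

lemma bern_bounded: "bounded (range (bern j))"
proof (rule boundedI)
  fix y assume "y \<in> range (bern j)"
  then show "norm y \<le> 1" using bern_01[of j] by (metis abs_of_nonneg imageE real_norm_def)
qed

definition bern_coords :: "real measure \<Rightarrow> nat \<times> nat \<times> nat \<Rightarrow> real" where
  "bern_coords \<mu> j = (\<integral>x. bern j x \<partial>\<mu>)"

lemma tendsto_fun_coordinatewise:
  fixes X :: "nat \<Rightarrow> 'a \<Rightarrow> 'b :: topological_space"
  assumes "\<And>i. (\<lambda>n. X n i) \<longlonglongrightarrow> l i"
  shows "X \<longlonglongrightarrow> l"
proof -
  have "limitin (product_topology (\<lambda>i. euclidean) UNIV) X l sequentially"
    using assms by (subst limitin_componentwise) auto
  then show ?thesis by (simp add: euclidean_product_topology)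
qed

context orlicz_function
begin

definition moment_set :: "real \<Rightarrow> real measure set" where
  "moment_set R = {\<mu> \<in> M1. mV V \<mu> \<le> ennreal R}"

lemma moment_set_M1: "\<mu> \<in> moment_set R \<Longrightarrow> \<mu> \<in> M1"
  by (simp add: moment_set_def)

lemma moment_tail:
  assumes \<mu>: "\<mu> \<in> moment_set R" and R: "0 \<le> R" and C: "0 < C" and r: "\<And>x. r \<le> \<bar>x\<bar> \<Longrightarrow> C \<le> V x"
  shows "measure \<mu> {x. r \<le> \<bar>x\<bar>} \<le> R / C"
proof -
  interpret prob_space \<mu> using \<mu> moment_set_M1 M1_D by blast
  have [measurable_cong]: "sets \<mu> = sets borel" using \<mu> moment_set_M1 M1_D by blast
  have "ennreal (C * measure \<mu> {x. r \<le> \<bar>x\<bar>}) = (\<integral>\<^sup>+x. ennreal C * indicator {x. r \<le> \<bar>x\<bar>} x \<partial>\<mu>)"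
    using C by (subst nn_integral_cmult_indicator) (auto simp: emeasure_eq_measure ennreal_mult)
  also have "\<dots> \<le> (\<integral>\<^sup>+x. ennreal (V x) \<partial>\<mu>)"
    using r by (intro nn_integral_mono) (auto split: split_indicator intro: ennreal_leI)
  also have "\<dots> \<le> ennreal R" using \<mu> by (simp add: moment_set_def mV_def)
  finally have "C * measure \<mu> {x. r \<le> \<bar>x\<bar>} \<le> R" using R by simp
  then show ?thesis using C by (simp add: field_simps)
qed

lemma moment_uniform_tail:
  assumes R: "0 < R" and e: "0 < e"
  shows "\<exists>r>0. \<forall>\<mu>\<in>moment_set R. \<forall>s\<ge>r. measure \<mu> {x. s \<le> \<bar>x\<bar>} \<le> e"
proof -
  obtain r where r: "r > 0" "\<And>x. \<bar>x\<bar> \<ge> r \<Longrightarrow> V x > R / e" using V_gt_outside[of "R / e"] by auto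
  have "measure \<mu> {x. s \<le> \<bar>x\<bar>} \<le> e" if "\<mu> \<in> moment_set R" "s \<ge> r" for \<mu> s
  proof -
    have "measure \<mu> {x. s \<le> \<bar>x\<bar>} \<le> R / (R / e)"
      by (rule moment_tail[OF that(1)]) (use R e r that in \<open>auto intro: less_imp_le\<close>)
    then show ?thesis using R e by simp
  qed
  then show ?thesis using r by blast
qed

text \<open>The moment bound makes the sequence tight, so a subsequence converges weakly. The bound
  survives in the limit because V is the increasing limit of the bounded continuous functions min m
  V, whose integrals pass to the limit before m is sent to infinity.\<close>

lemma moment_set_subseq:
  assumes R: "0 < R" and X: "\<And>n :: nat. X n \<in> moment_set R"
  shows "\<exists>\<nu>\<in>moment_set R. \<exists>r. strict_mono r \<and>
    (\<forall>f :: real \<Rightarrow> real. continuous_on UNIV f \<and> bounded (range f) \<longrightarrow> (\<lambda>n. \<integral>x. f x \<partial>X (r n)) \<longlonglongrightarrow> (\<integral>x. f x \<partial>\<nu>))"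
proof -
  have rd: "real_distribution (X n)" for n
    using X[of n] M1_D[OF moment_set_M1, OF X[of n]]
    by (auto simp: real_distribution_def real_distribution_axioms_def)
  have "tight X"
    unfolding tight_def
  proof (intro conjI allI impI rd)
    fix e :: real assume e: "e > 0"
    obtain r where r: "r > 0" "\<And>\<mu>. \<mu> \<in> moment_set R \<Longrightarrow> measure \<mu> {x. r \<le> \<bar>x\<bar>} \<le> e / 2"
      using moment_uniform_tail[OF R, of "e / 2"] e by auto
    have "1 - e < measure (X n) {- r<..r}" for n
    proof -
      interpret real_distribution "X n" by (rule rd)
      have "1 - measure (X n) {x. r \<le> \<bar>x\<bar>} = measure (X n) (space (X n) - {x. r \<le> \<bar>x\<bar>})"
        by (rule prob_compl[symmetric]) auto
      also have "\<dots> \<le> measure (X n) {- r<..r}" by (intro finite_measure_mono) auto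
      finally show ?thesis using r(2)[OF X[of n]] e by linarith
    qed
    then show "\<exists>a b. a < b \<and> (\<forall>n. 1 - e < measure (X n) {a<..b})" using r(1) by (intro exI[of _ "- r"] exI[of _ r]) auto
  qed
  then obtain r \<nu> where r: "strict_mono (r :: nat \<Rightarrow> nat)" and \<nu>: "real_distribution \<nu>" and w: "weak_conv_m (X \<circ> id \<circ> r) \<nu>"
    using tight_imp_convergent_subsubsequence[of X id] by (auto simp: strict_mono_id)
  interpret N: real_distribution \<nu> by fact
  have lim: "(\<lambda>n. \<integral>x. f x \<partial>X (r n)) \<longlonglongrightarrow> (\<integral>x. f x \<partial>\<nu>)"
    if f: "continuous_on UNIV f" "bounded (range f)" for f :: "real \<Rightarrow> real"
  proof -
    obtain B where "\<And>x. \<bar>f x\<bar> \<le> B" using bounded_continuous_measurable[OF f] by auto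
    then show ?thesis
      using weak_conv_imp_integral_bdd_continuous_conv[of "X \<circ> id \<circ> r" \<nu> f B] rd \<nu> w f(1)
      by (auto simp: continuous_on_eq_continuous_at)
  qed
  have \<nu>1: "\<nu> \<in> M1" by (simp add: M1_def N.prob_space_axioms)
  have "mV V \<nu> \<le> ennreal R"
  proof -
    have "mV V \<nu> \<le> (\<integral>\<^sup>+x. liminf (\<lambda>m. ennreal (min (real m) (V x))) \<partial>\<nu>)"
      unfolding mV_def
    proof (intro nn_integral_mono Liminf_bounded)
      fix x
      obtain m :: nat where "V x \<le> real m" using real_arch_simple by blast
      then have "min (real n) (V x) = V x" if "n \<ge> m" for n using that by (metis min.absorb2 of_nat_mono order_trans)
      then show "eventually (\<lambda>m. ennreal (V x) \<le> ennreal (min (real m) (V x))) sequentially"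
        unfolding eventually_sequentially by (metis order_refl)
    qed
    also have "\<dots> \<le> liminf (\<lambda>m. \<integral>\<^sup>+x. ennreal (min (real m) (V x)) \<partial>\<nu>)"
      by (rule nn_integral_liminf) auto
    also have "\<dots> \<le> ennreal R"
    proof (rule liminf_le_const)
      fix m :: nat
      let ?f = "\<lambda>x. min (real m) (V x)"
      have fb: "\<bar>?f x\<bar> \<le> real m" for x using V_nonneg[of x] by auto
      have f: "continuous_on UNIV ?f" "bounded (range ?f)"
        using fb by (auto intro!: continuous_intros V_continuous boundedI[of _ "real m"])
      have "(\<integral>x. ?f x \<partial>X (r n)) \<le> R" for n
      proof -
        have "integrable (X (r n)) ?f" using fb by (intro integrable_bounded_M1[OF moment_set_M1[OF X], where B = "real m"]) auto
        then have "ennreal (\<integral>x. ?f x \<partial>X (r n)) = (\<integral>\<^sup>+x. ennreal (?f x) \<partial>X (r n))"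
          by (intro nn_integral_eq_integral[symmetric]) auto
        also have "\<dots> \<le> mV V (X (r n))" unfolding mV_def by (intro nn_integral_mono ennreal_leI) auto
        also have "\<dots> \<le> ennreal R" using X[of "r n"] by (simp add: moment_set_def)
        finally show ?thesis using R by simp
      qed
      then have "(\<integral>x. ?f x \<partial>\<nu>) \<le> R" using lim[OF f] by (auto intro: LIMSEQ_le_const2)
      moreover have "integrable \<nu> ?f" using fb by (intro integrable_bounded_M1[OF \<nu>1, where B = "real m"]) auto
      ultimately show "(\<integral>\<^sup>+x. ennreal (?f x) \<partial>\<nu>) \<le> ennreal R"
        by (subst nn_integral_eq_integral) (auto intro: ennreal_leI)
    qed
    finally show ?thesis .
  qed
  then show ?thesis using \<nu>1 r lim by (auto simp: moment_set_def)
qed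

text \<open>On a large interval f is a rescaled function on [0, 1], approximated by its Bernstein
  polynomial to within e / 2. Outside, the error is at most 2B on a set of mass at most e / (4B).
  Both estimates are uniform over the moment set, so \<open>i\<close>, \<open>n\<close> and
  \<open>c\<close> depend on f and e only.\<close>

lemma bern_approx:
  assumes R: "0 < R" and f: "continuous_on UNIV f" "bounded (range f)" and e: "0 < e"
  shows "\<exists>i n c. \<forall>\<mu>\<in>moment_set R. \<bar>(\<integral>x. f x \<partial>\<mu>) - (\<Sum>k\<le>n. c k * bern_coords \<mu> (i, n, k))\<bar> \<le> e"
proof -
  obtain B where B: "B > 0" "\<And>x. \<bar>f x\<bar> \<le> B" and [measurable]: "f \<in> borel_measurable borel"
    using bounded_continuous_measurable[OF f] by auto
  obtain r0 where r0: "\<And>\<mu> s. \<mu> \<in> moment_set R \<Longrightarrow> s \<ge> r0 \<Longrightarrow> measure \<mu> {x. s \<le> \<bar>x\<bar>} \<le> e / (4 * B)"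
    using moment_uniform_tail[OF R, of "e / (4 * B)"] e B by auto
  obtain i :: nat where i: "r0 \<le> real i" using real_arch_simple by blast
  \<comment> \<open>Equals the clamping radius built into \<open>bern\<close>, whose first index is
    offset by one to keep the radius positive.\<close>
  define r where "r = real (Suc i)"
  have r: "r > 0" "r \<ge> r0" using i by (auto simp: r_def)
  define F where "F u = f (2 * r * u - r)" for u
  have "continuous_on {0..1} F" unfolding F_def
    by (intro continuous_on_compose2[OF f(1)] continuous_intros) auto
  then obtain n where n: "\<And>u. u \<in> {0..1} \<Longrightarrow> \<bar>F u - (\<Sum>k\<le>n. F (k / n) * Bernstein n k u)\<bar> < e / 2"
    using Bernstein_Weierstrass[of F "e / 2"] e by auto
  define g where "g x = (\<Sum>k\<le>n. F (k / n) * bern (i, n, k) x)" for x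
  have bm: "bern j \<in> borel_measurable borel" for j by (rule borel_measurable_continuous_onI[OF bern_continuous])
  have [measurable]: "g \<in> borel_measurable borel" unfolding g_def using bm by measurable
  have gu: "g x = (\<Sum>k\<le>n. F (k / n) * Bernstein n k ((max (- r) (min r x) + r) / (2 * r)))" for x
    by (simp add: g_def bern_def r_def)
  \<comment> \<open>The Bernstein basis is a partition of unity, so g is at each point a convex
    combination of values of f; the clamping keeps this true on the whole line.\<close>
  have gB: "\<bar>g x\<bar> \<le> B" for x
  proof -
    let ?u = "(max (- r) (min r x) + r) / (2 * r)"
    have "\<bar>g x\<bar> \<le> (\<Sum>k\<le>n. \<bar>F (k / n) * Bernstein n k ?u\<bar>)" unfolding gu by (rule sum_abs)
    also have "\<dots> \<le> (\<Sum>k\<le>n. B * Bernstein n k ?u)"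
      using clamp_unit[OF r(1), of x] B by (intro sum_mono) (auto simp: abs_mult Bernstein_nonneg F_def intro!: mult_right_mono)
    also have "\<dots> = B" by (simp flip: sum_distrib_left)
    finally show ?thesis .
  qed
  have fg: "\<bar>f x - g x\<bar> \<le> e / 2 + 2 * B * indicator {x. r \<le> \<bar>x\<bar>} x" for x
  proof (cases "r \<le> \<bar>x\<bar>")
    case True
    have "\<bar>f x - g x\<bar> \<le> 2 * B" using B(2)[of x] gB[of x] by linarith
    then show ?thesis using True e by simp
  next
    case False
    then have c: "max (- r) (min r x) = x" by auto
    have "F ((x + r) / (2 * r)) = f x" using r by (simp add: F_def)
    then have "\<bar>f x - g x\<bar> < e / 2" using n[of "(x + r) / (2 * r)"] clamp_unit[OF r(1), of x] unfolding gu c by simp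
    then show ?thesis using False by simp
  qed
  have "\<bar>(\<integral>x. f x \<partial>\<mu>) - (\<Sum>k\<le>n. F (k / n) * bern_coords \<mu> (i, n, k))\<bar> \<le> e" if \<mu>: "\<mu> \<in> moment_set R" for \<mu>
  proof -
    have \<mu>1: "\<mu> \<in> M1" using \<mu> by (rule moment_set_M1)
    interpret prob_space \<mu> using \<mu>1 by (rule M1_D)
    have [measurable_cong]: "sets \<mu> = sets borel" using \<mu>1 by (rule M1_D)
    have fi: "integrable \<mu> f" using B by (intro integrable_bounded_M1[OF \<mu>1, where B = B]) auto
    have gi: "integrable \<mu> g" using gB by (intro integrable_bounded_M1[OF \<mu>1, where B = B]) auto
    have bi: "integrable \<mu> (bern j)" for j
      using bern_01[of j] bm by (intro integrable_bounded_M1[OF \<mu>1, of _ 1]) (auto simp: abs_of_nonneg)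
    have "(\<integral>x. g x \<partial>\<mu>) = (\<Sum>k\<le>n. F (k / n) * bern_coords \<mu> (i, n, k))"
      unfolding g_def bern_coords_def using bi by (subst Bochner_Integration.integral_sum) auto
    then have "\<bar>(\<integral>x. f x \<partial>\<mu>) - (\<Sum>k\<le>n. F (k / n) * bern_coords \<mu> (i, n, k))\<bar> = \<bar>\<integral>x. f x - g x \<partial>\<mu>\<bar>"
      using fi gi by simp
    also have "\<dots> \<le> (\<integral>x. \<bar>f x - g x\<bar> \<partial>\<mu>)" by (rule integral_abs_bound)
    also have "\<dots> \<le> (\<integral>x. e / 2 + 2 * B * indicator {x. r \<le> \<bar>x\<bar>} x \<partial>\<mu>)"
      using fg fi gi by (intro integral_mono) (auto simp: emeasure_eq_measure intro!: integrable_mult_right integrable_real_indicator)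
    also have "\<dots> = e / 2 + 2 * B * measure \<mu> {x. r \<le> \<bar>x\<bar>}"
      by (subst Bochner_Integration.integral_add)
        (auto simp: emeasure_eq_measure prob_space intro!: integrable_mult_right integrable_real_indicator)
    also have "\<dots> \<le> e / 2 + 2 * B * (e / (4 * B))"
      using r0[OF \<mu> r(2)] B by (intro add_left_mono mult_left_mono) auto
    also have "\<dots> = e" using B by (simp add: field_simps)
    finally show ?thesis .
  qed
  then show ?thesis by (intro exI[of _ i] exI[of _ n] exI[of _ "\<lambda>k. F (real k / real n)"]) auto
qed

text \<open>It suffices to treat a subbasic set: on the moment set, the integral of f is a uniform
  limit of finite linear combinations of the coordinates, so it is continuous for the topology that
  the coordinates induce.\<close>

lemma weak_open_pullback:
  assumes R: "0 < R" and U: "openin weak_top U"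
  shows "\<exists>O'. open O' \<and> U \<inter> moment_set R = bern_coords -` O' \<inter> moment_set R"
proof -
  let ?T = "pullback_topology (moment_set R) bern_coords euclidean"
  have tsp: "topspace ?T = moment_set R" by (simp add: topspace_pullback_topology)
  have "continuous_map ?T weak_top id"
    unfolding weak_top_def
  proof (rule continuous_on_generated_topo)
    show "id ` topspace ?T \<subseteq> \<Union> weak_subbase"
      using topspace_weak_top moment_set_M1 unfolding tsp weak_top_def topology_generated_by_topspace by auto
    fix S assume "S \<in> weak_subbase"
    then obtain f A where S: "S = {\<mu> \<in> M1. (\<integral>x. f x \<partial>\<mu>) \<in> A}" and f: "continuous_on UNIV f" "bounded (range f)" and A: "open (A :: real set)"
      by (auto simp: weak_subbase_def)
    have "\<exists>W. openin ?T W \<and> \<mu>0 \<in> W \<and> W \<subseteq> S \<inter> moment_set R" if \<mu>0: "\<mu>0 \<in> S \<inter> moment_set R" for \<mu>0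
    proof -
      obtain d where d: "d > 0" "\<And>y. \<bar>y - (\<integral>x. f x \<partial>\<mu>0)\<bar> < d \<Longrightarrow> y \<in> A"
        using A \<mu>0 unfolding S open_real by auto
      obtain i n c where c: "\<And>\<mu>. \<mu> \<in> moment_set R \<Longrightarrow> \<bar>(\<integral>x. f x \<partial>\<mu>) - (\<Sum>k\<le>n. c k * bern_coords \<mu> (i, n, k))\<bar> \<le> d / 4"
        using bern_approx[OF R f, of "d / 4"] d(1) by (meson zero_less_divide_iff zero_less_numeral)
      \<comment> \<open>Two approximation errors and the variation inside \<open>O'\<close>, each at
        most d / 4, stay below d together.\<close>
      define O' where "O' = {y :: nat \<times> nat \<times> nat \<Rightarrow> real. \<bar>(\<Sum>k\<le>n. c k * y (i, n, k)) - (\<Sum>k\<le>n. c k * bern_coords \<mu>0 (i, n, k))\<bar> < d / 4}"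
      have "open O'" unfolding O'_def by (intro open_Collect_less continuous_intros continuous_on_product_coordinates)
      then have "openin ?T (bern_coords -` O' \<inter> moment_set R)" by (auto simp: openin_pullback_topology)
      moreover have "\<mu>0 \<in> bern_coords -` O' \<inter> moment_set R" using \<mu>0 d by (simp add: O'_def)
      moreover have "bern_coords -` O' \<inter> moment_set R \<subseteq> S \<inter> moment_set R"
      proof
        fix \<mu> assume \<mu>: "\<mu> \<in> bern_coords -` O' \<inter> moment_set R"
        then have "\<bar>(\<Sum>k\<le>n. c k * bern_coords \<mu> (i, n, k)) - (\<Sum>k\<le>n. c k * bern_coords \<mu>0 (i, n, k))\<bar> < d / 4"
          by (simp add: O'_def)
        then have "\<bar>(\<integral>x. f x \<partial>\<mu>) - (\<integral>x. f x \<partial>\<mu>0)\<bar> < d"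
          using c[OF IntD2[OF \<mu>]] c[OF IntD2[OF \<mu>0]] d(1) by linarith
        then show "\<mu> \<in> S \<inter> moment_set R" using d(2) \<mu> moment_set_M1 by (auto simp: S)
      qed
      ultimately show ?thesis by blast
    qed
    then have "openin ?T (S \<inter> moment_set R)" by (subst openin_subopen) blast
    then show "openin ?T (id -` S \<inter> topspace ?T)" by (simp add: tsp)
  qed
  then have "openin ?T (id -` U \<inter> topspace ?T)" using U by (simp add: continuous_map_alt)
  then show ?thesis by (auto simp: openin_pullback_topology tsp)
qed

text \<open>The image under \<open>bern_coords\<close> lies in a countable product of lines, which
  is metrizable, so sequential compactness is enough there. A weakly open cover has the traces of an
  open cover of the image, whose finite subcover transfers back.\<close>

theorem compactin_moment_set:
  assumes R: "0 < R" shows "compactin weak_top (moment_set R)"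
proof -
  have "compact (bern_coords ` moment_set R)"
    unfolding compact_eq_seq_compact_metric
  proof (rule seq_compactI)
    fix Y :: "nat \<Rightarrow> nat \<times> nat \<times> nat \<Rightarrow> real" assume "\<forall>n. Y n \<in> bern_coords ` moment_set R"
    then have "\<forall>n. \<exists>\<mu>. \<mu> \<in> moment_set R \<and> Y n = bern_coords \<mu>" by auto
    from choice[OF this] obtain X where X: "\<And>n. X n \<in> moment_set R" "\<And>n. Y n = bern_coords (X n)" by blast
    obtain \<nu> r where \<nu>: "\<nu> \<in> moment_set R" "strict_mono r"
      and lim: "\<forall>f :: real \<Rightarrow> real. continuous_on UNIV f \<and> bounded (range f) \<longrightarrow> (\<lambda>n. \<integral>x. f x \<partial>X (r n)) \<longlonglongrightarrow> (\<integral>x. f x \<partial>\<nu>)"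
      using moment_set_subseq[where X = X, OF R X(1)] by (elim bexE exE conjE)
    have "(Y \<circ> r) \<longlonglongrightarrow> bern_coords \<nu>"
      by (rule tendsto_fun_coordinatewise)
        (use lim[rule_format, OF conjI[OF bern_continuous bern_bounded]] in \<open>auto simp: X bern_coords_def\<close>)
    then show "\<exists>l\<in>bern_coords ` moment_set R. \<exists>r. strict_mono r \<and> (Y \<circ> r) \<longlonglongrightarrow> l" using \<nu> by blast
  qed
  moreover have "moment_set R \<subseteq> topspace weak_top" using moment_set_M1 by auto
  ultimately show ?thesis
    unfolding compactin_def
  proof (intro conjI allI impI)
    fix \<U> assume \<U>: "Ball \<U> (openin weak_top) \<and> moment_set R \<subseteq> \<Union>\<U>"
    then have "\<forall>U\<in>\<U>. \<exists>O'. open O' \<and> U \<inter> moment_set R = bern_coords -` O' \<inter> moment_set R"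
      using weak_open_pullback[OF R] by auto
    then obtain O' where O': "\<And>U. U \<in> \<U> \<Longrightarrow> open (O' U)" "\<And>U. U \<in> \<U> \<Longrightarrow> U \<inter> moment_set R = bern_coords -` O' U \<inter> moment_set R"
      by metis
    have "bern_coords ` moment_set R \<subseteq> (\<Union>U\<in>\<U>. O' U)" using \<U> O'(2) by blast
    then obtain F where F: "F \<subseteq> \<U>" "finite F" "bern_coords ` moment_set R \<subseteq> (\<Union>U\<in>F. O' U)"
      using compactE_image[OF \<open>compact (bern_coords ` moment_set R)\<close>] O'(1) by metis
    then have "moment_set R \<subseteq> \<Union>F" using O'(2) by blast
    then show "\<exists>\<F>. finite \<F> \<and> \<F> \<subseteq> \<U> \<and> moment_set R \<subseteq> \<Union>\<F>" using F by blast
  qed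
qed

end

section \<open>Empirical measures and the weak law of large numbers\<close>

lemma uniform_measure_pmf_of_set:
  assumes "finite A" "A \<noteq> {}"
  shows "uniform_measure (count_space UNIV) A = measure_pmf (pmf_of_set A)"
proof (rule measure_eqI)
  fix B :: "'a set"
  have "emeasure (count_space UNIV) (A \<inter> B) = ennreal (card (A \<inter> B))" "emeasure (count_space UNIV) A = ennreal (card A)"
    using assms by (auto simp: emeasure_count_space_finite ennreal_of_nat_eq_real_of_nat)
  moreover have "card A > 0" using assms by (simp add: card_gt_0_iff)
  ultimately show "emeasure (uniform_measure (count_space UNIV) A) B = emeasure (measure_pmf (pmf_of_set A)) B"
    using assms by (simp add: emeasure_pmf_of_set divide_ennreal)
qed auto

lemma empirical_in_M1: "0 < n \<Longrightarrow> empirical n x \<in> M1"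
  unfolding empirical_def M1_def
  by (subst uniform_measure_pmf_of_set) (auto intro!: prob_space.prob_space_distr measure_pmf.prob_space_axioms)

lemma integral_empirical:
  fixes f :: "real \<Rightarrow> real"
  assumes "0 < n" "f \<in> borel_measurable borel"
  shows "(\<integral>y. f y \<partial>empirical n x) = (\<Sum>i<n. f (x i)) / real n"
  using assms unfolding empirical_def
  by (subst uniform_measure_pmf_of_set) (auto simp: integral_distr integral_pmf_of_set lessThan_empty_iff bot_nat_def)

lemma nn_integral_empirical:
  fixes f :: "real \<Rightarrow> real"
  assumes "0 < n" "f \<in> borel_measurable borel" "\<And>x. 0 \<le> f x"
  shows "(\<integral>\<^sup>+y. ennreal (f y) \<partial>empirical n x) = ennreal ((\<Sum>i<n. f (x i)) / real n)"
  using assms unfolding empirical_def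
  by (subst uniform_measure_pmf_of_set)
    (auto simp: nn_integral_distr nn_integral_pmf_of_set sum_nonneg divide_ennreal ennreal_of_nat_eq_real_of_nat lessThan_empty_iff bot_nat_def)

lemma space_lebesgue_n: "space (lebesgue_n n) = extensional {..<n}"
  by (auto simp: lebesgue_n_def space_PiM PiE_def)

lemma sets_lebesgue_n: "(\<And>i. sets (M i) = sets borel) \<Longrightarrow> sets (lebesgue_n n) = sets (PiM {..<n} M)"
  unfolding lebesgue_n_def by (intro sets_PiM_cong) auto

lemma sets_lebesgue_n_borel [measurable_cong]: "sets (lebesgue_n n) = sets (PiM {..<n} (\<lambda>_. borel))"
  by (rule sets_lebesgue_n) simp

lemma coordinate_measurable: "i < n \<Longrightarrow> (\<lambda>x. x i) \<in> borel_measurable (lebesgue_n n)"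
  by measurable

text \<open>Points of the n-fold product are functions equal to \<open>undefined\<close> from index
  n on. Viewed as points of nat => real, their coordinates are measurable, being constant from n on,
  and over a countable index set the product \<sigma>-algebra contains all open sets.\<close>

lemma open_measurable_lebesgue_n:
  assumes "open (A :: (nat \<Rightarrow> real) set)"
  shows "{x \<in> space (lebesgue_n n). x \<in> A} \<in> sets (lebesgue_n n)"
proof -
  have A: "A \<in> sets (PiM UNIV (\<lambda>_. borel))" using assms by (simp add: sets_PiM_equal_borel)
  have "(\<lambda>x. x) \<in> measurable (lebesgue_n n) (PiM UNIV (\<lambda>_. borel :: real measure))"
  proof (rule measurable_PiM_single')
    fix i
    show "(\<lambda>x. x i) \<in> borel_measurable (lebesgue_n n)"
    proof (cases "i < n")
      case False
      then have "(\<lambda>x. x i) \<in> borel_measurable (lebesgue_n n) \<longleftrightarrow> (\<lambda>x. undefined :: real) \<in> borel_measurable (lebesgue_n n)"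
        by (intro measurable_cong) (auto simp: space_lebesgue_n extensional_def)
      then show ?thesis by simp
    qed (rule coordinate_measurable)
  qed auto
  from measurable_sets[OF this A] show ?thesis by (simp add: vimage_def Int_def conj_commute)
qed

section \<open>Continuity of the empirical map\<close>

text \<open>Continuity on all sequences makes the event measurable for every open set of X at once,
  without an appeal to a countable base of X; measurability on a subbase would reach countable
  unions only. The index 0 is excluded because the empirical measure of no points is not a
  probability measure.\<close>

definition empirical_continuous :: "real measure topology \<Rightarrow> bool" where
  "empirical_continuous X \<longleftrightarrow> (\<forall>n>0. continuous_map euclidean X (empirical n))"

lemma empirical_continuous_measurable:
  assumes "empirical_continuous X" "0 < n" "openin X U"
  shows "{x \<in> space (lebesgue_n n). empirical n x \<in> U} \<in> sets (lebesgue_n n)"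
proof -
  have "openin euclidean {x \<in> topspace euclidean. empirical n x \<in> U}"
    using assms unfolding empirical_continuous_def by (intro openin_continuous_map_preimage) auto
  then have "open {x. empirical n x \<in> U}" by simp
  from open_measurable_lebesgue_n[OF this, of n] show ?thesis by simp
qed

lemma empirical_continuous_measurable_closed:
  assumes X: "empirical_continuous X" "0 < n" "closedin X C"
  shows "{x \<in> space (lebesgue_n n). empirical n x \<in> C} \<in> sets (lebesgue_n n)"
proof -
  have "empirical n x \<in> topspace X" for x
    using X unfolding empirical_continuous_def continuous_map_def by auto
  then have "{x \<in> space (lebesgue_n n). empirical n x \<in> C} =
    space (lebesgue_n n) - {x \<in> space (lebesgue_n n). empirical n x \<in> topspace X - C}" by auto
  then show ?thesis
    using empirical_continuous_measurable[OF X(1,2), of "topspace X - C"] X(3) by auto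
qed

lemma continuous_average:
  assumes "continuous_on UNIV (f :: real \<Rightarrow> real)"
  shows "continuous_on UNIV (\<lambda>x :: nat \<Rightarrow> real. (\<Sum>i<n. f (x i)) / real n)"
proof (cases "n = 0")
  case False
  then show ?thesis
    by (intro continuous_intros continuous_on_compose2[OF assms] continuous_on_product_coordinates) auto
qed simp

lemma empirical_continuous_weak: "empirical_continuous weak_top"
  unfolding empirical_continuous_def
proof safe
  fix n :: nat assume n: "0 < n"
  show "continuous_map euclidean weak_top (empirical n)"
    unfolding weak_top_def
  proof (rule continuous_on_generated_topo)
    show "empirical n ` topspace euclidean \<subseteq> \<Union> weak_subbase"
      using empirical_in_M1[OF n] topspace_weak_top unfolding weak_top_def topology_generated_by_topspace by auto
    fix S assume "S \<in> weak_subbase"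
    then obtain f A where S: "S = {\<mu> \<in> M1. (\<integral>x. f x \<partial>\<mu>) \<in> A}" and f: "continuous_on UNIV f" "bounded (range f)" and A: "open (A :: real set)"
      by (auto simp: weak_subbase_def)
    have "empirical n -` S \<inter> topspace euclidean = (\<lambda>x. (\<Sum>i<n. f (x i)) / real n) -` A"
      using empirical_in_M1[OF n] bounded_continuous_measurable(1)[OF f] by (auto simp: S integral_empirical[OF n])
    moreover have "open ((\<lambda>x. (\<Sum>i<n. f (x i)) / real n) -` A)"
      using continuous_average[OF f(1)] A by (auto simp: continuous_on_open_vimage)
    ultimately show "openin euclidean (empirical n -` S \<inter> topspace euclidean)" by simp
  qed
qed

section \<open>Products of densities and independent samples\<close>

text \<open>Both sides agree on boxes, where the integral factorises. This is what converts
  probabilities under independent sampling into volumes.\<close>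

lemma PiM_density_lborel:
  assumes [measurable]: "q \<in> borel_measurable borel" and pr: "prob_space (density lborel q)"
  shows "PiM {..<n} (\<lambda>_. density lborel q) = density (lebesgue_n n) (\<lambda>x. \<Prod>i<n. q (x i))"
proof -
  interpret D: product_sigma_finite "\<lambda>_ :: nat. density lborel q"
    using prob_space_imp_sigma_finite[OF pr] by (simp add: product_sigma_finite_def)
  interpret L: product_sigma_finite "\<lambda>_ :: nat. lborel :: real measure"
    by (simp add: product_sigma_finite_def sigma_finite_lborel)
  show ?thesis
  proof (rule D.PiM_eqI[symmetric])
    show "sets (density (lebesgue_n n) (\<lambda>x. \<Prod>i<n. q (x i))) = sets (PiM {..<n} (\<lambda>_. density lborel q))"
      by (simp, rule sets_lebesgue_n) simp
    fix A assume A: "\<And>i. i \<in> {..<n} \<Longrightarrow> A i \<in> sets (density lborel q)"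
    then have A'[measurable]: "\<And>i. i < n \<Longrightarrow> A i \<in> sets borel" by simp
    have m: "Pi\<^sub>E {..<n} A \<in> sets (lebesgue_n n)" unfolding lebesgue_n_def by (rule sets_PiM_I_finite) (use A' in auto)
    have "emeasure (density (lebesgue_n n) (\<lambda>x. \<Prod>i<n. q (x i))) (Pi\<^sub>E {..<n} A) =
      (\<integral>\<^sup>+x. (\<Prod>i<n. q (x i)) * indicator (Pi\<^sub>E {..<n} A) x \<partial>lebesgue_n n)"
      using m by (intro emeasure_density) measurable
    also have "\<dots> = (\<integral>\<^sup>+x. (\<Prod>i<n. q (x i) * indicator (A i) (x i)) \<partial>lebesgue_n n)"
    proof (rule nn_integral_cong)
      fix x assume "x \<in> space (lebesgue_n n)"
      then have "indicator (Pi\<^sub>E {..<n} A) x = (\<Prod>i<n. indicator (A i) (x i) :: ennreal)"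
        by (auto simp: space_lebesgue_n PiE_def Pi_def indicator_def prod_eq_1_iff split: if_splits)
      then show "(\<Prod>i<n. q (x i)) * indicator (Pi\<^sub>E {..<n} A) x = (\<Prod>i<n. q (x i) * indicator (A i) (x i))"
        by (simp add: prod.distrib)
    qed
    also have "\<dots> = (\<Prod>i<n. \<integral>\<^sup>+y. q y * indicator (A i) y \<partial>lborel)"
      unfolding lebesgue_n_def by (rule L.product_nn_integral_prod) (use A' in auto)
    also have "\<dots> = (\<Prod>i<n. emeasure (density lborel q) (A i))"
      using A' by (intro prod.cong) (auto simp: emeasure_density)
    finally show "emeasure (density (lebesgue_n n) (\<lambda>x. \<Prod>i<n. q (x i))) (Pi\<^sub>E {..<n} A) = (\<Prod>i<n. emeasure (density lborel q) (A i))" .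
  qed auto
qed

lemma nn_integral_prod_lebesgue_n:
  assumes [measurable]: "h \<in> borel_measurable borel"
  shows "(\<integral>\<^sup>+x. (\<Prod>i<n. h (x i)) \<partial>lebesgue_n n) = (\<integral>\<^sup>+y. h y \<partial>lborel) ^ n"
proof -
  interpret L: product_sigma_finite "\<lambda>_ :: nat. lborel :: real measure"
    by (simp add: product_sigma_finite_def sigma_finite_lborel)
  show ?thesis unfolding lebesgue_n_def by (subst L.product_nn_integral_prod) auto
qed

definition sample_space :: "real measure \<Rightarrow> nat \<Rightarrow> (nat \<Rightarrow> real) measure" where
  "sample_space \<mu> n = PiM {..<n} (\<lambda>_. \<mu>)"

lemma
  assumes "\<mu> \<in> M1"
  shows prob_space_sample_space: "prob_space (sample_space \<mu> n)"
    and sets_sample_space: "sets (sample_space \<mu> n) = sets (lebesgue_n n)"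
    and space_sample_space: "space (sample_space \<mu> n) = space (lebesgue_n n)"
    and distr_sample_space: "i < n \<Longrightarrow> distr (sample_space \<mu> n) \<mu> (\<lambda>x. x i) = \<mu>"
proof -
  interpret product_prob_space "\<lambda>_ :: nat. \<mu>" "{..<n}"
    using M1_D[OF assms] by (auto simp: product_prob_space_def product_prob_space_axioms_def product_sigma_finite_def prob_space_imp_sigma_finite)
  show "prob_space (sample_space \<mu> n)" unfolding sample_space_def by (rule P.prob_space_axioms)
  show s: "sets (sample_space \<mu> n) = sets (lebesgue_n n)" unfolding sample_space_def
    using M1_D[OF assms] by (intro sets_lebesgue_n[symmetric]) auto
  show "space (sample_space \<mu> n) = space (lebesgue_n n)" using s by (rule sets_eq_imp_space_eq)
  show "distr (sample_space \<mu> n) \<mu> (\<lambda>x. x i) = \<mu>" if "i < n" unfolding sample_space_def using that by (intro PiM_component) simp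
qed

lemma integral_sample_space_component:
  fixes f :: "real \<Rightarrow> real"
  assumes \<mu>: "\<mu> \<in> M1" and i: "i < n" and [measurable]: "f \<in> borel_measurable borel"
  shows "(\<integral>x. f (x i) \<partial>sample_space \<mu> n) = (\<integral>y. f y \<partial>\<mu>)"
    and "integrable (sample_space \<mu> n) (\<lambda>x. f (x i)) \<longleftrightarrow> integrable \<mu> f"
proof -
  note [measurable_cong] = sets_sample_space[OF \<mu>] M1_D(1)[OF \<mu>]
  have [measurable]: "(\<lambda>x. x i) \<in> measurable (sample_space \<mu> n) \<mu>"
    unfolding measurable_cong_sets[OF sets_sample_space[OF \<mu>] M1_D(1)[OF \<mu>]] by (rule coordinate_measurable[OF i])
  show "(\<integral>x. f (x i) \<partial>sample_space \<mu> n) = (\<integral>y. f y \<partial>\<mu>)"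
    by (subst (2) distr_sample_space[OF \<mu> i, symmetric], subst integral_distr) auto
  show "integrable (sample_space \<mu> n) (\<lambda>x. f (x i)) \<longleftrightarrow> integrable \<mu> f"
    by (subst (2) distr_sample_space[OF \<mu> i, symmetric], subst integrable_distr_eq) auto
qed

section \<open>The weak law of large numbers\<close>

text \<open>Hoeffding's inequality for the independent coordinates: each variable ranges over an
  interval of length 2B, so the exponent is - 2 (e n)^2 / (4 n B^2).\<close>

lemma weak_law_bounded:
  fixes f :: "real \<Rightarrow> real"
  assumes \<mu>: "\<mu> \<in> M1" and [measurable]: "f \<in> borel_measurable borel" and B: "\<And>x. \<bar>f x\<bar> \<le> B" "0 < B" and e: "0 \<le> e"
  shows "measure (sample_space \<mu> n) {x \<in> space (lebesgue_n n). e * real n \<le> \<bar>(\<Sum>i<n. f (x i)) - real n * (\<integral>y. f y \<partial>\<mu>)\<bar>}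
    \<le> 2 * exp (- (e\<^sup>2 / (2 * B\<^sup>2)) * real n)"
proof (cases "n = 0")
  case False
  interpret prob_space "sample_space \<mu> n" by (rule prob_space_sample_space[OF \<mu>])
  note [measurable_cong] = sets_sample_space[OF \<mu>] M1_D(1)[OF \<mu>]
  have coord[measurable]: "(\<lambda>x. x i) \<in> measurable (sample_space \<mu> n) \<mu>" if "i < n" for i
    unfolding measurable_cong_sets[OF sets_sample_space[OF \<mu>] M1_D(1)[OF \<mu>]] by (rule coordinate_measurable[OF that])
  have "indep_vars (\<lambda>_. \<mu>) (\<lambda>i x. x i) {..<n}"
  proof (subst indep_vars_iff_distr_eq_PiM')
    have "distr (sample_space \<mu> n) (PiM {..<n} (\<lambda>_. \<mu>)) (\<lambda>x. \<lambda>i\<in>{..<n}. x i) = distr (sample_space \<mu> n) (sample_space \<mu> n) (\<lambda>x. x)"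
      by (rule distr_cong) (auto simp: sample_space_def space_PiM PiE_def extensional_restrict)
    also have "\<dots> = PiM {..<n} (\<lambda>_. \<mu>)" by (simp add: sample_space_def)
    also have "\<dots> = PiM {..<n} (\<lambda>i. distr (sample_space \<mu> n) \<mu> (\<lambda>x. x i))"
      using distr_sample_space[OF \<mu>] by (intro PiM_cong) auto
    finally show "distr (sample_space \<mu> n) (PiM {..<n} (\<lambda>_. \<mu>)) (\<lambda>x. \<lambda>i\<in>{..<n}. x i) = PiM {..<n} (\<lambda>i. distr (sample_space \<mu> n) \<mu> (\<lambda>x. x i))" .
  qed (use False in auto)
  then have ind: "indep_vars (\<lambda>_. borel) (\<lambda>i x. f (x i)) {..<n}"
    by (rule indep_vars_compose2) simp
  have ab: "- B \<le> f y \<and> f y \<le> B" for y using B(1)[of y] by linarith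
  have "Hoeffding_ineq (sample_space \<mu> n) {..<n} (\<lambda>i x. f (x i)) (\<lambda>_. - B) (\<lambda>_. B)"
    by unfold_locales (use ind ab in auto)
  then interpret H: Hoeffding_ineq "sample_space \<mu> n" "{..<n}" "\<lambda>i x. f (x i)" "\<lambda>_. - B" "\<lambda>_. B"
    "\<Sum>i<n. (\<integral>x. f (x i) \<partial>sample_space \<mu> n)"
    by simp_all
  have m: "(\<Sum>i<n. (\<integral>x. f (x i) \<partial>sample_space \<mu> n)) = real n * (\<integral>y. f y \<partial>\<mu>)"
    using integral_sample_space_component(1)[OF \<mu>] by simp
  have v: "(\<Sum>i<n. (B - - B)\<^sup>2) = real n * (4 * B\<^sup>2)" by (simp add: power2_eq_square)
  have "measure (sample_space \<mu> n) {x \<in> space (sample_space \<mu> n). e * real n \<le> \<bar>(\<Sum>i<n. f (x i)) - (\<Sum>i<n. (\<integral>x. f (x i) \<partial>sample_space \<mu> n))\<bar>}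
    \<le> 2 * exp (- 2 * (e * real n)\<^sup>2 / (\<Sum>i<n. (B - - B)\<^sup>2))"
    by (rule H.Hoeffding_ineq_abs_ge) (use e B False in \<open>simp_all only: v, simp_all\<close>)
  also have "- 2 * (e * real n)\<^sup>2 / (\<Sum>i<n. (B - - B)\<^sup>2) = - (e\<^sup>2 / (2 * B\<^sup>2)) * real n"
    unfolding v using False B by (simp add: field_simps power2_eq_square)
  finally show ?thesis unfolding m space_sample_space[OF \<mu>] .
next
  case True
  interpret prob_space "sample_space \<mu> n" by (rule prob_space_sample_space[OF \<mu>])
  show ?thesis using True order_trans[OF prob_le_1, of 2] by auto
qed

text \<open>For merely integrable f, the clipped function \<open>Y B\<close> obeys Hoeffding's
  inequality, and the average of |f - Y B| is small in probability by Markov's inequality.\<close>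

lemma weak_law:
  fixes f :: "real \<Rightarrow> real"
  assumes \<mu>: "\<mu> \<in> M1" and f[measurable]: "f \<in> borel_measurable borel" and fi: "integrable \<mu> f" and e: "0 < e"
  shows "(\<lambda>n. measure (sample_space \<mu> n) {x \<in> space (lebesgue_n n). e * real n \<le> \<bar>(\<Sum>i<n. f (x i)) - real n * (\<integral>y. f y \<partial>\<mu>)\<bar>}) \<longlonglongrightarrow> 0"
    (is "?P \<longlonglongrightarrow> 0")
proof (rule LIMSEQ_I)
  fix \<eta> :: real assume \<eta>: "\<eta> > 0"
  interpret M: prob_space \<mu> by (rule M1_D[OF \<mu>])
  note [measurable_cong] = M1_D(1)[OF \<mu>]
  define Y where "Y B x = max (- real B) (min (real B) (f x))" for B :: nat and x
  have [measurable]: "Y B \<in> borel_measurable borel" for B unfolding Y_def by measurable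
  have "(\<lambda>B. \<integral>x. \<bar>f x - Y B x\<bar> \<partial>\<mu>) \<longlonglongrightarrow> (\<integral>x. 0 \<partial>\<mu>)"
  proof (rule integral_dominated_convergence)
    show "integrable \<mu> (\<lambda>x. \<bar>f x\<bar>)" using fi by simp
    show "AE x in \<mu>. (\<lambda>B. \<bar>f x - Y B x\<bar>) \<longlonglongrightarrow> 0"
    proof (rule AE_I2)
      fix x
      obtain m :: nat where m: "\<bar>f x\<bar> \<le> real m" using real_arch_simple by blast
      have "\<bar>f x - Y B x\<bar> = 0" if "B \<ge> m" for B using that m by (auto simp: Y_def)
      then show "(\<lambda>B. \<bar>f x - Y B x\<bar>) \<longlonglongrightarrow> 0" by (intro tendsto_eventually) (auto simp: eventually_sequentially)
    qed
    show "AE x in \<mu>. norm \<bar>f x - Y B x\<bar> \<le> \<bar>f x\<bar>" for B by (auto simp: Y_def)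
  qed auto
  \<comment> \<open>The bound e / 3 controls the difference of the two means; the bound e / 3 *
    (\<eta> / 2) makes Markov's inequality at level e / 3 yield probability at most \<eta> /
    2.\<close>
  then have "eventually (\<lambda>B. (\<integral>x. \<bar>f x - Y B x\<bar> \<partial>\<mu>) < min (e / 3) (e / 3 * (\<eta> / 2))) sequentially"
    using e \<eta> by (intro order_tendstoD) auto
  then have "eventually (\<lambda>B. B > 0 \<and> (\<integral>x. \<bar>f x - Y B x\<bar> \<partial>\<mu>) < min (e / 3) (e / 3 * (\<eta> / 2))) sequentially"
    using eventually_gt_at_top[of "0 :: nat"] by eventually_elim auto
  then obtain B where B0: "B > 0" and B: "(\<integral>x. \<bar>f x - Y B x\<bar> \<partial>\<mu>) < e / 3" "(\<integral>x. \<bar>f x - Y B x\<bar> \<partial>\<mu>) < e / 3 * (\<eta> / 2)"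
    by (auto simp: eventually_sequentially)
  define D where "D = (\<integral>x. \<bar>f x - Y B x\<bar> \<partial>\<mu>)"
  have YB: "\<bar>Y B x\<bar> \<le> real B" for x by (auto simp: Y_def)
  have Yi: "integrable \<mu> (Y B)" using YB by (intro integrable_bounded_M1[OF \<mu>, where B = "real B"]) auto
  have dm: "\<bar>(\<integral>y. f y \<partial>\<mu>) - (\<integral>y. Y B y \<partial>\<mu>)\<bar> \<le> D"
    unfolding D_def using fi Yi integral_abs_bound[of \<mu> "\<lambda>x. f x - Y B x"] by simp
  have bound: "?P n \<le> 2 * exp (- ((e / 3)\<^sup>2 / (2 * (real B)\<^sup>2)) * real n) + \<eta> / 2" if n: "n > 0" for n
  proof -
    interpret prob_space "sample_space \<mu> n" by (rule prob_space_sample_space[OF \<mu>])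
    note [measurable_cong] = sets_sample_space[OF \<mu>]
    note sp = space_sample_space[OF \<mu>, of n]
    let ?A = "{x \<in> space (lebesgue_n n). e / 3 * real n \<le> \<bar>(\<Sum>i<n. Y B (x i)) - real n * (\<integral>y. Y B y \<partial>\<mu>)\<bar>}"
    let ?Z = "\<lambda>x. \<Sum>i<n. \<bar>f (x i) - Y B (x i)\<bar>"
    let ?C = "{x \<in> space (lebesgue_n n). e / 3 * real n \<le> ?Z x}"
    have mA: "?A \<in> sets (lebesgue_n n)" "?C \<in> sets (lebesgue_n n)" by measurable
    have "?P n \<le> measure (sample_space \<mu> n) (?A \<union> ?C)"
    proof (rule finite_measure_mono)
      show "?A \<union> ?C \<in> sets (sample_space \<mu> n)" using mA by (simp add: sets_sample_space[OF \<mu>])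
      show "{x \<in> space (lebesgue_n n). e * real n \<le> \<bar>(\<Sum>i<n. f (x i)) - real n * (\<integral>y. f y \<partial>\<mu>)\<bar>} \<subseteq> ?A \<union> ?C"
      proof safe
        fix x assume x: "x \<in> space (lebesgue_n n)" "e * real n \<le> \<bar>(\<Sum>i<n. f (x i)) - real n * (\<integral>y. f y \<partial>\<mu>)\<bar>" "\<not> e / 3 * real n \<le> ?Z x"
        have "\<bar>(\<Sum>i<n. f (x i)) - (\<Sum>i<n. Y B (x i))\<bar> \<le> ?Z x"
          by (simp only: sum_subtractf[symmetric] sum_abs)
        moreover have "\<bar>real n * (\<integral>y. f y \<partial>\<mu>) - real n * (\<integral>y. Y B y \<partial>\<mu>)\<bar> \<le> e / 3 * real n"
        proof -
          have "\<bar>real n * (\<integral>y. f y \<partial>\<mu>) - real n * (\<integral>y. Y B y \<partial>\<mu>)\<bar> = real n * \<bar>(\<integral>y. f y \<partial>\<mu>) - (\<integral>y. Y B y \<partial>\<mu>)\<bar>"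
            by (simp add: abs_mult right_diff_distrib[symmetric])
          also have "\<dots> \<le> real n * (e / 3)" using dm B(1) unfolding D_def by (intro mult_left_mono) auto
          finally show ?thesis by (simp add: mult.commute)
        qed
        moreover have 3: "e * real n = e / 3 * real n + e / 3 * real n + e / 3 * real n" by (simp add: field_simps)
        ultimately show "e / 3 * real n \<le> \<bar>(\<Sum>i<n. Y B (x i)) - real n * (\<integral>y. Y B y \<partial>\<mu>)\<bar>"
          using x(2,3) 3 by linarith
      qed
    qed
    also have "\<dots> \<le> measure (sample_space \<mu> n) ?A + measure (sample_space \<mu> n) ?C"
      using mA by (intro measure_Un_le) (auto simp: sets_sample_space[OF \<mu>])
    also have "measure (sample_space \<mu> n) ?A \<le> 2 * exp (- ((e / 3)\<^sup>2 / (2 * (real B)\<^sup>2)) * real n)"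
      by (rule weak_law_bounded[OF \<mu> _ YB]) (use e B0 in auto)
    also have "measure (sample_space \<mu> n) ?C \<le> \<eta> / 2"
    proof -
      have Zi: "integrable (sample_space \<mu> n) (\<lambda>x. \<bar>f (x i) - Y B (x i)\<bar>)" if "i < n" for i
        using that fi Yi by (subst integral_sample_space_component(2)[OF \<mu>, of _ _ "\<lambda>y. \<bar>f y - Y B y\<bar>"]) auto
      have "measure (sample_space \<mu> n) {x \<in> space (sample_space \<mu> n). e / 3 * real n \<le> ?Z x} \<le> (\<integral>x. ?Z x \<partial>sample_space \<mu> n) / (e / 3 * real n)"
        by (rule integral_Markov_inequality_measure[where A = "{}"]) (use e n Zi in \<open>auto intro!: sum_nonneg\<close>)
      also have "(\<integral>x. ?Z x \<partial>sample_space \<mu> n) = real n * D"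
        using Zi integral_sample_space_component(1)[OF \<mu>, of _ n "\<lambda>y. \<bar>f y - Y B y\<bar>"]
        by (subst Bochner_Integration.integral_sum) (auto simp: D_def)
      also have "real n * D / (e / 3 * real n) = D / (e / 3)" using n by simp
      also have "\<dots> \<le> \<eta> / 2" using B(2) e by (simp add: D_def field_simps)
      finally show ?thesis unfolding sp .
    qed
    finally show ?thesis by simp
  qed
  define k where "k = (e / 3)\<^sup>2 / (2 * (real B)\<^sup>2)"
  have "k > 0" using e B0 by (simp add: k_def)
  then have "(\<lambda>n. 2 * exp (- k * real n)) \<longlonglongrightarrow> 0" by real_asymp
  then have "eventually (\<lambda>n. 2 * exp (- k * real n) < \<eta> / 2) sequentially" using \<eta> by (intro order_tendstoD(2)[of _ 0]) auto
  then have "eventually (\<lambda>n. norm (?P n - 0) < \<eta>) sequentially"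
    using eventually_gt_at_top[of "0 :: nat"]
  proof eventually_elim
    case (elim n)
    then show ?case using bound[of n] by (simp add: k_def)
  qed
  then show "\<exists>no. \<forall>n\<ge>no. norm (?P n - 0) < \<eta>" by (simp add: eventually_sequentially)
qed

section \<open>Volume estimates\<close>

text \<open>Induction over the generation of the topology. Finite intersections follow from the
  inclusion-exclusion formula, unions by monotonicity from a single member containing \<mu>, and
  subbasic sets from the weak law. At every stage the event is measurable because the set is weakly
  open.\<close>

lemma sample_weak_open:
  assumes \<mu>: "\<mu> \<in> M1" and U: "openin weak_top U" "\<mu> \<in> U"
  shows "(\<lambda>n. measure (sample_space \<mu> n) {x \<in> space (lebesgue_n n). empirical n x \<in> U}) \<longlonglongrightarrow> 1"
proof -
  let ?P = "\<lambda>n A. measure (sample_space \<mu> n) {x \<in> space (lebesgue_n n). empirical n x \<in> A}"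
  have ms: "{x \<in> space (lebesgue_n n). empirical n x \<in> A} \<in> sets (sample_space \<mu> n)"
    if "generate_topology_on weak_subbase A" "n > 0" for A n
    using empirical_continuous_measurable[OF empirical_continuous_weak that(2), of A] that(1)
    by (simp add: weak_top_def openin_topology_generated_by_iff sets_sample_space[OF \<mu>])
  have le1: "?P n A \<le> 1" for n A
    using prob_space.prob_le_1[OF prob_space_sample_space[OF \<mu>]] by simp
  have squeeze: "X \<longlonglongrightarrow> 1" if "Y \<longlonglongrightarrow> 1" "eventually (\<lambda>n. Y n \<le> X n) sequentially" "\<And>n. X n \<le> 1" for X Y :: "nat \<Rightarrow> real"
    by (rule tendsto_sandwich[OF that(2) _ that(1) tendsto_const]) (use that(3) in auto)
  have "generate_topology_on weak_subbase U" using U(1) by (simp add: weak_top_def openin_topology_generated_by_iff)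
  then show ?thesis using U(2)
  proof (induction rule: generate_topology_on.induct)
    case (Int a b)
    have "(\<lambda>n. ?P n a + ?P n b - 1) \<longlonglongrightarrow> 1 + 1 - 1" using Int by (intro tendsto_intros) auto
    then have "(\<lambda>n. ?P n a + ?P n b - 1) \<longlonglongrightarrow> 1" by simp
    then show ?case
    proof (rule squeeze)
      show "eventually (\<lambda>n. ?P n a + ?P n b - 1 \<le> ?P n (a \<inter> b)) sequentially"
        using eventually_gt_at_top[of "0 :: nat"]
      proof eventually_elim
        case (elim n)
        interpret prob_space "sample_space \<mu> n" by (rule prob_space_sample_space[OF \<mu>])
        let ?A = "{x \<in> space (lebesgue_n n). empirical n x \<in> a}" and ?B = "{x \<in> space (lebesgue_n n). empirical n x \<in> b}"
        have "{x \<in> space (lebesgue_n n). empirical n x \<in> a \<inter> b} = ?A \<inter> ?B" by auto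
        moreover have "measure (sample_space \<mu> n) (?A \<union> ?B) = ?P n a + ?P n b - measure (sample_space \<mu> n) (?A \<inter> ?B)"
          using ms[OF Int.hyps(1) elim] ms[OF Int.hyps(2) elim] by (intro measure_Un3) (auto simp: fmeasurable_eq_sets)
        ultimately show ?case using prob_le_1[of "?A \<union> ?B"] by simp
      qed
    qed (rule le1)
  next
    case (UN K)
    then obtain k where k: "k \<in> K" "\<mu> \<in> k" by auto
    have gK: "generate_topology_on weak_subbase (\<Union>K)" using UN.hyps by (rule generate_topology_on.UN)
    show ?case
    proof (rule squeeze[OF UN.IH[OF k]])
      show "eventually (\<lambda>n. ?P n k \<le> ?P n (\<Union>K)) sequentially"
        using eventually_gt_at_top[of "0 :: nat"]
      proof eventually_elim
        case (elim n)
        interpret prob_space "sample_space \<mu> n" by (rule prob_space_sample_space[OF \<mu>])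
        show ?case using ms[OF gK elim] k by (intro finite_measure_mono) auto
      qed
    qed (rule le1)
  next
    case (Basis S)
    then obtain f A where S: "S = {\<mu> \<in> M1. (\<integral>x. f x \<partial>\<mu>) \<in> A}" and f: "continuous_on UNIV f" "bounded (range f)" and A: "open (A :: real set)"
      by (auto simp: weak_subbase_def)
    obtain B where B: "\<And>x. \<bar>f x\<bar> \<le> B" and fm: "f \<in> borel_measurable borel"
      using bounded_continuous_measurable[OF f] by auto
    define m where "m = (\<integral>x. f x \<partial>\<mu>)"
    obtain d where d: "d > 0" "\<And>y. \<bar>y - m\<bar> < d \<Longrightarrow> y \<in> A"
      using A Basis.prems unfolding S open_real m_def by auto
    let ?bad = "\<lambda>n. {x \<in> space (lebesgue_n n). d * real n \<le> \<bar>(\<Sum>i<n. f (x i)) - real n * m\<bar>}"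
    have "(\<lambda>n. 1 - measure (sample_space \<mu> n) (?bad n)) \<longlonglongrightarrow> 1 - 0"
      unfolding m_def by (intro tendsto_intros weak_law[OF \<mu> fm integrable_bounded_M1[OF \<mu> fm B] d(1)])
    then have "(\<lambda>n. 1 - measure (sample_space \<mu> n) (?bad n)) \<longlonglongrightarrow> 1" by simp
    then show ?case
    proof (rule squeeze)
      show "eventually (\<lambda>n. 1 - measure (sample_space \<mu> n) (?bad n) \<le> ?P n S) sequentially"
        using eventually_gt_at_top[of "0 :: nat"]
      proof eventually_elim
        case (elim n)
        interpret prob_space "sample_space \<mu> n" by (rule prob_space_sample_space[OF \<mu>])
        note [measurable] = fm
        have b: "?bad n \<in> sets (sample_space \<mu> n)" unfolding sets_sample_space[OF \<mu>] by measurable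
        have "1 - measure (sample_space \<mu> n) (?bad n) = measure (sample_space \<mu> n) (space (sample_space \<mu> n) - ?bad n)"
          using b by (rule prob_compl[symmetric])
        also have "\<dots> \<le> ?P n S"
        proof (intro finite_measure_mono)
          show "{x \<in> space (lebesgue_n n). empirical n x \<in> S} \<in> sets (sample_space \<mu> n)"
            by (rule ms[OF _ elim]) (rule generate_topology_on.Basis[OF Basis.hyps])
          show "space (sample_space \<mu> n) - ?bad n \<subseteq> {x \<in> space (lebesgue_n n). empirical n x \<in> S}"
          proof
            fix x assume x: "x \<in> space (sample_space \<mu> n) - ?bad n"
            then have "\<bar>(\<Sum>i<n. f (x i)) - real n * m\<bar> < d * real n" by (auto simp: space_sample_space[OF \<mu>])
            moreover have "\<bar>(\<Sum>i<n. f (x i)) / real n - m\<bar> = \<bar>(\<Sum>i<n. f (x i)) - real n * m\<bar> / real n"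
            proof -
              have "(\<Sum>i<n. f (x i)) / real n - m = ((\<Sum>i<n. f (x i)) - real n * m) / real n"
                using elim by (simp add: field_simps)
              then show ?thesis by (simp add: abs_divide)
            qed
            ultimately have "\<bar>(\<Sum>i<n. f (x i)) / real n - m\<bar> < d" using elim by (simp add: divide_less_eq)
            then show "x \<in> {x \<in> space (lebesgue_n n). empirical n x \<in> S}"
              using x d(2) empirical_in_M1[OF elim] by (auto simp: S integral_empirical[OF elim fm] space_sample_space[OF \<mu>])
          qed
        qed
        finally show ?case .
      qed
    qed (rule le1)
  qed auto
qed

context orlicz_function
begin

lemma sets_orlicz_ball: "orlicz_ball V R n \<in> sets (lebesgue_n n)"
  unfolding orlicz_ball_def by measurable

lemma mV_empirical: "0 < n \<Longrightarrow> mV V (empirical n x) = ennreal ((\<Sum>i<n. V (x i)) / real n)"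
  unfolding mV_def by (rule nn_integral_empirical) auto

lemma orlicz_ball_iff:
  assumes "0 < n" "0 \<le> R"
  shows "x \<in> orlicz_ball V R n \<longleftrightarrow> x \<in> space (lebesgue_n n) \<and> empirical n x \<in> moment_set R"
  using assms by (auto simp: orlicz_ball_def moment_set_def mV_empirical empirical_in_M1 field_simps)

lemma nn_integral_exp_tilt:
  assumes \<beta>: "\<beta> < 0" and f[measurable]: "f \<in> borel_measurable borel" and B: "\<And>x. \<bar>f x\<bar> \<le> B"
  shows "(\<integral>\<^sup>+x. ennreal (exp (f x + \<beta> * V x)) \<partial>lborel) = ennreal (exp (ln (Z \<beta>) + ln (\<integral>x. exp (f x) \<partial>gibbs V \<beta>)))"
proof -
  interpret G: prob_space "gibbs V \<beta>" by (rule prob_space_gibbs[OF \<beta>])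
  have ei: "integrable (gibbs V \<beta>) (\<lambda>x. exp (f x))"
    using B by (intro G.integrable_const_bound[of _ "exp B"]) (auto intro: order_trans[OF abs_ge_self])
  then have I: "0 < (\<integral>x. exp (f x) \<partial>gibbs V \<beta>)" by (rule G.expectation_greater) auto
  note Z = Z_pos[OF \<beta>]
  have "(\<integral>\<^sup>+x. ennreal (exp (f x + \<beta> * V x)) \<partial>lborel) = (\<integral>\<^sup>+x. ennreal (Z \<beta>) * (ennreal (exp (\<beta> * V x) / Z \<beta>) * ennreal (exp (f x))) \<partial>lborel)"
    using Z by (intro nn_integral_cong) (auto simp: exp_add mult.commute simp flip: ennreal_mult)
  also have "\<dots> = ennreal (Z \<beta>) * (\<integral>\<^sup>+x. ennreal (exp (f x)) \<partial>gibbs V \<beta>)"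
    by (subst nn_integral_cmult) (auto simp: nn_integral_gibbs[OF \<beta>])
  also have "(\<integral>\<^sup>+x. ennreal (exp (f x)) \<partial>gibbs V \<beta>) = ennreal (\<integral>x. exp (f x) \<partial>gibbs V \<beta>)"
    using ei by (intro nn_integral_eq_integral) auto
  finally show ?thesis using Z I by (simp add: exp_add ennreal_mult)
qed

text \<open>On D the sum of f is at least s n, and \<beta> < 0 turns the constraint of the ball into
  a lower bound for \<beta> times the sum of V. The indicator of D is thus below a constant times a
  product of one-variable functions, whose integral factorises.\<close>

lemma volume_upper:
  assumes \<beta>: "\<beta> < 0" and f[measurable]: "f \<in> borel_measurable borel" and B: "\<And>x. \<bar>f x\<bar> \<le> B"
    and D: "D \<in> sets (lebesgue_n n)" "D \<subseteq> orlicz_ball V R n" "\<And>x. x \<in> D \<Longrightarrow> s * real n \<le> (\<Sum>i<n. f (x i))"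
  shows "emeasure (lebesgue_n n) D \<le> ennreal (exp (real n * (ln (Z \<beta>) + ln (\<integral>x. exp (f x) \<partial>gibbs V \<beta>) - s - \<beta> * R)))"
proof -
  define L where "L = ln (Z \<beta>) + ln (\<integral>x. exp (f x) \<partial>gibbs V \<beta>)"
  have "emeasure (lebesgue_n n) D = (\<integral>\<^sup>+x. indicator D x \<partial>lebesgue_n n)" using D(1) by simp
  also have "\<dots> \<le> (\<integral>\<^sup>+x. ennreal (exp (- real n * (s + \<beta> * R))) * (\<Prod>i<n. ennreal (exp (f (x i) + \<beta> * V (x i)))) \<partial>lebesgue_n n)"
  proof (intro nn_integral_mono)
    fix x
    have "indicator D x \<le> exp (- real n * (s + \<beta> * R)) * (\<Prod>i<n. exp (f (x i) + \<beta> * V (x i)))"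
    proof (cases "x \<in> D")
      case True
      have "(\<Sum>i<n. V (x i)) \<le> R * real n" using D(2) True by (auto simp: orlicz_ball_def)
      then have "\<beta> * (R * real n) \<le> \<beta> * (\<Sum>i<n. V (x i))" using \<beta> by (intro mult_left_mono_neg) auto
      then have "0 \<le> - real n * (s + \<beta> * R) + ((\<Sum>i<n. f (x i)) + \<beta> * (\<Sum>i<n. V (x i)))"
        using D(3)[OF True] by (simp add: algebra_simps)
      then have "1 \<le> exp (- real n * (s + \<beta> * R) + ((\<Sum>i<n. f (x i)) + \<beta> * (\<Sum>i<n. V (x i))))" by simp
      also have "\<dots> = exp (- real n * (s + \<beta> * R)) * (\<Prod>i<n. exp (f (x i) + \<beta> * V (x i)))"
        by (simp only: exp_add exp_sum[symmetric] finite_lessThan sum_distrib_left prod.distrib)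
      finally show ?thesis using True by simp
    qed (auto intro!: mult_nonneg_nonneg prod_nonneg)
    then have "ennreal (indicator D x) \<le> ennreal (exp (- real n * (s + \<beta> * R)) * (\<Prod>i<n. exp (f (x i) + \<beta> * V (x i))))"
      by (rule ennreal_leI)
    then show "indicator D x \<le> ennreal (exp (- real n * (s + \<beta> * R))) * (\<Prod>i<n. ennreal (exp (f (x i) + \<beta> * V (x i))))"
      by (simp add: ennreal_mult prod_nonneg prod_ennreal ennreal_indicator)
  qed
  also have "\<dots> = ennreal (exp (- real n * (s + \<beta> * R))) * ennreal (exp L) ^ n"
    unfolding L_def nn_integral_exp_tilt[OF \<beta> f B, symmetric]
    by (subst nn_integral_cmult, measurable)
      (subst nn_integral_prod_lebesgue_n[of "\<lambda>y. ennreal (exp (f y + \<beta> * V y))"], auto)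
  also have "\<dots> = ennreal (exp (real n * (L - s - \<beta> * R)))"
    by (simp add: ennreal_power ennreal_mult[symmetric] exp_of_nat_mult[symmetric] flip: exp_add) (simp add: algebra_simps)
  finally show ?thesis by (simp add: L_def)
qed

text \<open>Change of measure: where the sum of ln q is at most n (h + e), the sampling density is
  at most exp (n (h + e)), so the volume is at least exp (- n (h + e)) times the sampling
  probability. The latter exceeds 1/2 eventually, and the strict moment inequality is what lets the
  law of large numbers keep the sample inside the ball.\<close>

lemma volume_lower:
  assumes R: "0 < R" and \<mu>: "\<mu> \<in> M1" "\<mu> = density lborel (\<lambda>x. ennreal (q x))"
    and q[measurable]: "q \<in> borel_measurable borel" and q0: "\<And>x. 0 \<le> q x"
    and qi: "integrable \<mu> (\<lambda>x. ln (q x))" and mom: "mV V \<mu> < ennreal R"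
    and U: "openin weak_top U" "\<mu> \<in> U" and e: "0 < e"
  shows "eventually (\<lambda>n. ennreal (exp (- real n * ((\<integral>x. ln (q x) \<partial>\<mu>) + e)) / 2) \<le>
    emeasure (lebesgue_n n) {x \<in> orlicz_ball V R n. empirical n x \<in> U}) sequentially"
proof -
  interpret M: prob_space \<mu> by (rule M1_D[OF \<mu>(1)])
  note [measurable_cong] = M1_D(1)[OF \<mu>(1)]
  define h where "h = (\<integral>x. ln (q x) \<partial>\<mu>)"
  have Vi: "integrable \<mu> V"
    using mom unfolding mV_def by (intro integrableI_nonneg) (auto intro: order.strict_trans)
  define m where "m = (\<integral>x. V x \<partial>\<mu>)"
  have "mV V \<mu> = ennreal m" unfolding mV_def m_def using Vi by (intro nn_integral_eq_integral) auto
  then have m: "m < R" using mom R by (simp add: ennreal_less_iff m_def)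
  let ?P = "\<lambda>n. measure (sample_space \<mu> n)"
  let ?A = "\<lambda>n. {x \<in> space (lebesgue_n n). empirical n x \<in> U}"
  let ?bV = "\<lambda>n. {x \<in> space (lebesgue_n n). (R - m) * real n \<le> \<bar>(\<Sum>i<n. V (x i)) - real n * m\<bar>}"
  let ?bq = "\<lambda>n. {x \<in> space (lebesgue_n n). e * real n \<le> \<bar>(\<Sum>i<n. ln (q (x i))) - real n * h\<bar>}"
  let ?S = "\<lambda>n. {x \<in> orlicz_ball V R n. empirical n x \<in> U \<and> (\<Sum>i<n. ln (q (x i))) \<le> real n * (h + e)}"
  have "(\<lambda>n. ?P n (?A n) - ?P n (?bV n) - ?P n (?bq n)) \<longlonglongrightarrow> 1 - 0 - 0"
    unfolding h_def m_def
    by (intro tendsto_intros sample_weak_open[OF \<mu>(1) U] weak_law[OF \<mu>(1)] Vi qi) (use m e in \<open>auto simp: m_def\<close>)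
  then have "eventually (\<lambda>n. ?P n (?A n) - ?P n (?bV n) - ?P n (?bq n) > 1 / 2) sequentially"
    by (intro order_tendstoD) auto
  then show ?thesis using eventually_gt_at_top[of "0 :: nat"]
  proof eventually_elim
    case (elim n)
    interpret prob_space "sample_space \<mu> n" by (rule prob_space_sample_space[OF \<mu>(1)])
    have sA: "?A n \<in> sets (lebesgue_n n)" using elim by (intro empirical_continuous_measurable[OF empirical_continuous_weak _ U(1)]) auto
    have sb: "?bV n \<in> sets (lebesgue_n n)" "?bq n \<in> sets (lebesgue_n n)" by measurable
    have "?S n = orlicz_ball V R n \<inter> ?A n \<inter> {x \<in> space (lebesgue_n n). (\<Sum>i<n. ln (q (x i))) \<le> real n * (h + e)}"
      by (auto simp: orlicz_ball_def)
    also have "\<dots> \<in> sets (lebesgue_n n)"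
    proof (rule sets.Int[OF sets.Int[OF sets_orlicz_ball sA]])
      show "{x \<in> space (lebesgue_n n). (\<Sum>i<n. ln (q (x i))) \<le> real n * (h + e)} \<in> sets (lebesgue_n n)" by measurable
    qed
    finally have sS: "?S n \<in> sets (lebesgue_n n)" .
    have sB: "{x \<in> orlicz_ball V R n. empirical n x \<in> U} \<in> sets (lebesgue_n n)"
    proof -
      have "{x \<in> orlicz_ball V R n. empirical n x \<in> U} = orlicz_ball V R n \<inter> ?A n" by (auto simp: orlicz_ball_def)
      then show ?thesis using sA sets_orlicz_ball[of R n] by auto
    qed
    have "?A n \<subseteq> ?S n \<union> (?bV n \<union> ?bq n)"
    proof
      fix x assume x: "x \<in> ?A n"
      have "(\<Sum>i<n. V (x i)) \<le> R * real n" if "\<bar>(\<Sum>i<n. V (x i)) - real n * m\<bar> < (R - m) * real n"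
        using that by (simp add: algebra_simps abs_less_iff)
      moreover have "(\<Sum>i<n. ln (q (x i))) \<le> real n * (h + e)" if "\<bar>(\<Sum>i<n. ln (q (x i))) - real n * h\<bar> < e * real n"
        using that by (simp add: algebra_simps abs_less_iff)
      ultimately show "x \<in> ?S n \<union> (?bV n \<union> ?bq n)" using x by (auto simp: orlicz_ball_def not_le)
    qed
    then have "?P n (?A n) \<le> ?P n (?S n \<union> (?bV n \<union> ?bq n))"
      using sS sb by (intro finite_measure_mono) (auto simp: sets_sample_space[OF \<mu>(1)])
    also have "\<dots> \<le> ?P n (?S n) + ?P n (?bV n \<union> ?bq n)"
      using sS sb by (intro measure_Un_le) (auto simp: sets_sample_space[OF \<mu>(1)])
    also have "?P n (?bV n \<union> ?bq n) \<le> ?P n (?bV n) + ?P n (?bq n)"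
      using sb by (intro measure_Un_le) (auto simp: sets_sample_space[OF \<mu>(1)])
    finally have S2: "1 / 2 < ?P n (?S n)" using elim by simp
    have ss: "sample_space \<mu> n = density (lebesgue_n n) (\<lambda>x. \<Prod>i<n. ennreal (q (x i)))"
      unfolding sample_space_def \<mu>(2) by (rule PiM_density_lborel) (use M.prob_space_axioms \<mu>(2) in auto)
    have "ennreal (?P n (?S n)) = (\<integral>\<^sup>+x. (\<Prod>i<n. ennreal (q (x i))) * indicator (?S n) x \<partial>lebesgue_n n)"
      unfolding emeasure_eq_measure[symmetric] unfolding ss by (rule emeasure_density[OF _ sS]) measurable
    also have "\<dots> \<le> (\<integral>\<^sup>+x. ennreal (exp (real n * (h + e))) * indicator (?S n) x \<partial>lebesgue_n n)"
    proof (intro nn_integral_mono)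
      fix x
      show "(\<Prod>i<n. ennreal (q (x i))) * indicator (?S n) x \<le> ennreal (exp (real n * (h + e))) * indicator (?S n) x"
      proof (cases "x \<in> ?S n")
        case True
        have "(\<Prod>i<n. q (x i)) \<le> exp (real n * (h + e))"
        \<comment> \<open>With ln 0 = 0, the sum of logarithms says nothing about vanishing factors,
          but in that case the product itself is 0.\<close>
        proof (cases "\<exists>i<n. q (x i) = 0")
          case True
          then have "(\<Prod>i<n. q (x i)) = 0" by (intro prod_zero) auto
          then show ?thesis by (simp only: exp_ge_zero)
        next
          case False
          then have "q (x i) > 0" if "i < n" for i using that q0[of "x i"] by (auto simp: less_le)
          then have "(\<Prod>i<n. q (x i)) = (\<Prod>i<n. exp (ln (q (x i))))" by (intro prod.cong) auto
          also have "\<dots> = exp (\<Sum>i<n. ln (q (x i)))" by (simp add: exp_sum)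
          also have "\<dots> \<le> exp (real n * (h + e))" using \<open>x \<in> ?S n\<close> by simp
          finally show ?thesis .
        qed
        then show ?thesis using True q0 by (simp add: prod_ennreal ennreal_leI)
      qed simp
    qed
    also have "\<dots> = ennreal (exp (real n * (h + e))) * emeasure (lebesgue_n n) (?S n)"
      using sS by (rule nn_integral_cmult_indicator)
    also have "\<dots> \<le> ennreal (exp (real n * (h + e))) * emeasure (lebesgue_n n) {x \<in> orlicz_ball V R n. empirical n x \<in> U}"
      using sB by (intro mult_left_mono emeasure_mono) auto
    finally have *: "ennreal (?P n (?S n)) \<le> ennreal (exp (real n * (h + e))) * emeasure (lebesgue_n n) {x \<in> orlicz_ball V R n. empirical n x \<in> U}" .
    have "ennreal (exp (- real n * (h + e)) / 2) = ennreal (exp (- real n * (h + e))) * ennreal (1 / 2)"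
      by (subst ennreal_mult[symmetric]) auto
    also have "\<dots> \<le> ennreal (exp (- real n * (h + e))) * ennreal (?P n (?S n))"
      using S2 by (intro mult_left_mono ennreal_leI) auto
    also have "\<dots> \<le> ennreal (exp (- real n * (h + e))) * (ennreal (exp (real n * (h + e))) * emeasure (lebesgue_n n) {x \<in> orlicz_ball V R n. empirical n x \<in> U})"
      by (intro mult_left_mono *) auto
    also have "\<dots> = emeasure (lebesgue_n n) {x \<in> orlicz_ball V R n. empirical n x \<in> U}"
      by (simp add: mult.assoc[symmetric] ennreal_mult[symmetric] flip: exp_add)
    finally show ?case by (simp add: h_def)
  qed
qed

end

section \<open>The rate function\<close>

lemma integral_mix:
  fixes f :: "real \<Rightarrow> real"
  assumes \<mu>: "\<mu> \<in> M1" "\<nu> \<in> M1" and t: "0 \<le> t" "t \<le> 1" and f[measurable]: "f \<in> borel_measurable borel" and B: "\<And>x. \<bar>f x\<bar> \<le> B"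
  shows "(\<integral>x. f x \<partial>mix t \<mu> \<nu>) = t * (\<integral>x. f x \<partial>\<mu>) + (1 - t) * (\<integral>x. f x \<partial>\<nu>)"
proof -
  have mix: "mix t \<mu> \<nu> \<in> M1" using \<mu> t by (rule mix_in_M1)
  have pos: "0 \<le> f x + B" for x using B[of x] by linarith
  have *: "(\<integral>\<^sup>+x. ennreal (f x + B) \<partial>\<rho>) = ennreal ((\<integral>x. f x \<partial>\<rho>) + B)" "0 \<le> (\<integral>x. f x \<partial>\<rho>) + B" if \<rho>: "\<rho> \<in> M1" for \<rho>
  proof -
    interpret prob_space \<rho> by (rule M1_D[OF \<rho>])
    have i: "integrable \<rho> f" by (rule integrable_bounded_M1[OF \<rho> f B])
    have eq: "(\<integral>x. f x + B \<partial>\<rho>) = (\<integral>x. f x \<partial>\<rho>) + B" using i by (simp add: prob_space)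
    show "(\<integral>\<^sup>+x. ennreal (f x + B) \<partial>\<rho>) = ennreal ((\<integral>x. f x \<partial>\<rho>) + B)"
      using i pos by (subst nn_integral_eq_integral) (auto simp: eq)
    show "0 \<le> (\<integral>x. f x \<partial>\<rho>) + B" unfolding eq[symmetric] using pos by (intro Bochner_Integration.integral_nonneg)
  qed
  have "ennreal ((\<integral>x. f x \<partial>mix t \<mu> \<nu>) + B) = ennreal t * ennreal ((\<integral>x. f x \<partial>\<mu>) + B) + ennreal (1 - t) * ennreal ((\<integral>x. f x \<partial>\<nu>) + B)"
    unfolding *(1)[OF mix, symmetric] *(1)[OF \<mu>(1), symmetric] *(1)[OF \<mu>(2), symmetric]
    by (rule nn_integral_mix) (use \<mu> in \<open>auto dest: M1_D\<close>)
  also have "\<dots> = ennreal (t * ((\<integral>x. f x \<partial>\<mu>) + B) + (1 - t) * ((\<integral>x. f x \<partial>\<nu>) + B))"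
    using t *(2)[OF \<mu>(1)] *(2)[OF \<mu>(2)] by (simp add: ennreal_mult ennreal_plus)
  finally have "(\<integral>x. f x \<partial>mix t \<mu> \<nu>) + B = t * ((\<integral>x. f x \<partial>\<mu>) + B) + (1 - t) * ((\<integral>x. f x \<partial>\<nu>) + B)"
    using t *(2)[OF \<mu>(1)] *(2)[OF \<mu>(2)] *(2)[OF mix] by (subst (asm) ennreal_inj) (auto intro!: add_nonneg_nonneg mult_nonneg_nonneg)
  then show ?thesis by (simp add: algebra_simps)
qed

lemma mix_1: assumes "\<mu> \<in> M1" "\<nu> \<in> M1" shows "mix 1 \<mu> \<nu> = \<mu>"
  by (rule measure_eqI) (auto simp: emeasure_mix M1_D(1)[OF assms(1)] M1_D(1)[OF assms(2)])

text \<open>Used near t = 1: a small admixture of another measure stays inside a given neighbourhood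
  of \<mu>.\<close>

lemma continuous_mix:
  assumes \<mu>: "\<mu> \<in> M1" "\<nu> \<in> M1"
  shows "continuous_map (subtopology euclideanreal {0..1}) weak_top (\<lambda>t. mix t \<mu> \<nu>)"
  unfolding weak_top_def
proof (rule continuous_on_generated_topo)
  have "mix t \<mu> \<nu> \<in> M1" if "0 \<le> t" "t \<le> 1" for t using mix_in_M1[OF \<mu> that] .
  then show "(\<lambda>t. mix t \<mu> \<nu>) ` topspace (subtopology euclideanreal {0..1}) \<subseteq> \<Union> weak_subbase"
    using topspace_weak_top unfolding weak_top_def topology_generated_by_topspace by auto
  fix S assume "S \<in> weak_subbase"
  then obtain f A where S: "S = {\<mu> \<in> M1. (\<integral>x. f x \<partial>\<mu>) \<in> A}" and f: "continuous_on UNIV f" "bounded (range f)" and A: "open (A :: real set)"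
    by (auto simp: weak_subbase_def)
  obtain B where B: "\<And>x. \<bar>f x\<bar> \<le> B" and fm: "f \<in> borel_measurable borel"
    using bounded_continuous_measurable[OF f] by auto
  let ?g = "\<lambda>t. t * (\<integral>x. f x \<partial>\<mu>) + (1 - t) * (\<integral>x. f x \<partial>\<nu>)"
  have "(\<lambda>t. mix t \<mu> \<nu>) -` S \<inter> topspace (subtopology euclideanreal {0..1}) = ?g -` A \<inter> {0..1}"
    using mix_in_M1[OF \<mu>] integral_mix[OF \<mu> _ _ fm B] by (auto simp: S)
  moreover have "open (?g -` A)" using A
    by (intro open_vimage continuous_intros)
  ultimately show "openin (subtopology euclideanreal {0..1}) ((\<lambda>t. mix t \<mu> \<nu>) -` S \<inter> topspace (subtopology euclideanreal {0..1}))"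
    by (auto simp: openin_subtopology)
qed

lemma rel_entropy_self:
  assumes \<gamma>: "\<gamma> \<in> M1" shows "rel_entropy \<gamma> \<gamma> = 0"
  using rel_entropy_density(1)[OF \<gamma>, of "\<lambda>_. 1" \<gamma>] \<gamma> by (simp add: density_1)

lemma rel_entropy_nonneg:
  assumes \<gamma>: "\<gamma> \<in> M1" and \<mu>: "\<mu> \<in> M1" shows "0 \<le> rel_entropy \<mu> \<gamma>"
proof (rule ccontr)
  assume "\<not> 0 \<le> rel_entropy \<mu> \<gamma>"
  then obtain h where h: "rel_entropy \<mu> \<gamma> \<le> ereal h" "h < 0"
    using ereal_dense2[of "rel_entropy \<mu> \<gamma>" 0] by (auto simp: not_le intro: less_imp_le)
  interpret prob_space \<gamma> by (rule M1_D[OF \<gamma>])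
  have "(\<integral>x. 0 \<partial>\<mu>) \<le> h + ln (\<integral>x. exp 0 \<partial>\<gamma>)" by (rule gibbs_variational[OF \<gamma> \<mu> _ _ h(1), of _ 0]) auto
  then show False using h by (simp add: prob_space)
qed

context orlicz_function
begin

definition \<phi> :: "real \<Rightarrow> real \<Rightarrow> real" where
  "\<phi> R \<beta> = ln (Z \<beta>) - \<beta> * R"

lemma moment_set_integrable:
  assumes \<mu>: "\<mu> \<in> moment_set R" and R: "0 \<le> R"
  shows "integrable \<mu> V" "mV V \<mu> = ennreal (\<integral>x. V x \<partial>\<mu>)" "0 \<le> (\<integral>x. V x \<partial>\<mu>)" "(\<integral>x. V x \<partial>\<mu>) \<le> R"
proof -
  have \<mu>1: "\<mu> \<in> M1" using \<mu> by (rule moment_set_M1)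
  note [measurable_cong] = M1_D(1)[OF \<mu>1]
  have le: "mV V \<mu> \<le> ennreal R" using \<mu> by (simp add: moment_set_def)
  show i: "integrable \<mu> V" using le unfolding mV_def by (intro integrableI_nonneg) (auto intro: order.strict_trans1)
  show eq: "mV V \<mu> = ennreal (\<integral>x. V x \<partial>\<mu>)" unfolding mV_def using i by (intro nn_integral_eq_integral) auto
  show "0 \<le> (\<integral>x. V x \<partial>\<mu>)" by simp
  show "(\<integral>x. V x \<partial>\<mu>) \<le> R" using le R unfolding eq by simp
qed

lemma rate_moment_set:
  assumes "\<mu> \<in> moment_set R" "0 \<le> R"
  shows "rate_IV V R \<alpha> \<mu> = rel_entropy \<mu> (gibbs V \<alpha>) + ereal (\<alpha> * ((\<integral>x. V x \<partial>\<mu>) - R))"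
  using assms moment_set_integrable[OF assms] by (simp add: rate_IV_def moment_set_def ennreal_leI)

lemma rate_outside: "\<mu> \<in> M1 \<Longrightarrow> \<mu> \<notin> moment_set R \<Longrightarrow> rate_IV V R \<alpha> \<mu> = \<infinity>"
  by (simp add: rate_IV_def moment_set_def)

lemma rate_finite_moment_set: "\<mu> \<in> M1 \<Longrightarrow> rate_IV V R \<alpha> \<mu> < \<infinity> \<Longrightarrow> \<mu> \<in> moment_set R"
  using rate_outside by force

text \<open>The linear part of the rate is squeezed between 0 and a quantity tending to 0 with
  \<beta>; the first bound permits dropping it, the second makes the loss negligible.\<close>

lemma tilt_nonneg:
  assumes "\<mu> \<in> moment_set R" "0 \<le> R" "\<beta> < 0"
  shows "0 \<le> \<beta> * ((\<integral>x. V x \<partial>\<mu>) - R)" "\<beta> * ((\<integral>x. V x \<partial>\<mu>) - R) \<le> - \<beta> * R"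
proof -
  note m = moment_set_integrable[OF assms(1,2)]
  show "0 \<le> \<beta> * ((\<integral>x. V x \<partial>\<mu>) - R)" using m assms by (intro mult_nonpos_nonpos) auto
  have "\<beta> * (\<integral>x. V x \<partial>\<mu>) \<le> 0" using m assms by (intro mult_nonpos_nonneg) auto
  then show "\<beta> * ((\<integral>x. V x \<partial>\<mu>) - R) \<le> - \<beta> * R" by (simp add: algebra_simps)
qed

lemma rate_nonneg:
  assumes "\<mu> \<in> M1" "0 \<le> R" "\<alpha> < 0" shows "0 \<le> rate_IV V R \<alpha> \<mu>"
proof (cases "\<mu> \<in> moment_set R")
  case True
  then show ?thesis unfolding rate_moment_set[OF True assms(2)]
    using rel_entropy_nonneg[OF gibbs_in_M1[OF assms(3)] assms(1)] tilt_nonneg(1)[OF True assms(2,3)] by simp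
qed (use rate_outside assms in simp)

lemma gibbs_density_gibbs:
  assumes "\<alpha> < 0" "\<beta> < 0"
  shows "gibbs V \<alpha> = density (gibbs V \<beta>) (\<lambda>x. ennreal (exp ((\<alpha> - \<beta>) * V x) * Z \<beta> / Z \<alpha>))"
  unfolding gibbs_eq using Z_pos[OF assms(1)] Z_pos[OF assms(2)]
  by (subst density_density_eq)
    (auto intro!: density_cong simp: field_simps simp flip: ennreal_mult exp_add)

text \<open>The logarithms of the two densities of \<mu> differ by an affine function of V, which is
  integrable on the moment set. Finiteness is assumed at \<alpha> only; exchanging the roles of the
  parameters transfers infiniteness.\<close>

lemma rel_entropy_gibbs_shift:
  assumes \<alpha>: "\<alpha> < 0" and \<beta>: "\<beta> < 0" and \<mu>: "\<mu> \<in> moment_set R" and R: "0 \<le> R"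
    and fin: "rel_entropy \<mu> (gibbs V \<alpha>) < \<infinity>"
  shows "rel_entropy \<mu> (gibbs V \<beta>) = rel_entropy \<mu> (gibbs V \<alpha>) + ereal ((\<alpha> - \<beta>) * (\<integral>x. V x \<partial>\<mu>) + ln (Z \<beta>) - ln (Z \<alpha>))"
proof -
  have \<mu>1: "\<mu> \<in> M1" using \<mu> by (rule moment_set_M1)
  interpret M: prob_space \<mu> by (rule M1_D[OF \<mu>1])
  note [measurable_cong] = M1_D(1)[OF \<mu>1]
  note Vi = moment_set_integrable(1)[OF \<mu> R]
  note Z = Z_pos[OF \<alpha>] Z_pos[OF \<beta>]
  obtain p where p[measurable]: "p \<in> borel_measurable borel" and p0: "\<And>x. 0 \<le> p x" and \<mu>p: "\<mu> = density (gibbs V \<alpha>) (\<lambda>x. ennreal (p x))"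
    and pi: "integrable \<mu> (\<lambda>x. ln (p x))" and pH: "rel_entropy \<mu> (gibbs V \<alpha>) = ereal (\<integral>x. ln (p x) \<partial>\<mu>)"
    using rel_entropy_finite_density[OF gibbs_in_M1[OF \<alpha>] \<mu>1 fin] by metis
  have pos: "AE x in \<mu>. 0 < p x" using density_pos_AE[OF _ \<mu>p] by simp
  define w where "w x = exp ((\<alpha> - \<beta>) * V x) * Z \<beta> / Z \<alpha>" for x
  have [measurable]: "w \<in> borel_measurable borel" unfolding w_def by measurable
  have w0: "0 < w x" for x using Z by (simp add: w_def)
  define k where "k x = (\<alpha> - \<beta>) * V x + (ln (Z \<beta>) - ln (Z \<alpha>))" for x
  have [measurable]: "k \<in> borel_measurable borel" unfolding k_def by measurable
  have lw: "ln (w x) = k x" for x using Z by (simp add: w_def k_def ln_mult ln_div)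
  have ki: "integrable \<mu> k" unfolding k_def using Vi by auto
  have \<mu>w: "\<mu> = density (gibbs V \<beta>) (\<lambda>x. ennreal (w x * p x))"
    unfolding \<mu>p gibbs_density_gibbs[OF \<alpha> \<beta>] w_def[symmetric]
    using w0 p0 by (subst density_density_eq) (auto simp: ennreal_mult less_imp_le)
  have ae: "AE x in \<mu>. ln (w x * p x) = k x + ln (p x)"
    using pos
  proof eventually_elim
    case (elim x)
    have "ln (w x * p x) = ln (w x) + ln (p x)" using elim w0[of x] by (rule ln_mult_pos[rotated])
    then show ?case by (simp add: lw)
  qed
  have wi: "integrable \<mu> (\<lambda>x. ln (w x * p x))"
    using ki pi ae by (subst integrable_cong_AE[where g = "\<lambda>x. k x + ln (p x)"]) auto
  have "(\<integral>x. ln (w x * p x) \<partial>\<mu>) = (\<integral>x. k x + ln (p x) \<partial>\<mu>)"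
    using ae by (intro integral_cong_AE) auto
  also have "\<dots> = (\<integral>x. k x \<partial>\<mu>) + (\<integral>x. ln (p x) \<partial>\<mu>)" using ki pi by (rule Bochner_Integration.integral_add)
  also have "(\<integral>x. k x \<partial>\<mu>) = (\<alpha> - \<beta>) * (\<integral>x. V x \<partial>\<mu>) + (ln (Z \<beta>) - ln (Z \<alpha>))"
    unfolding k_def using Vi by (subst Bochner_Integration.integral_add) (auto simp: M.prob_space)
  finally have eq: "(\<integral>x. ln (w x * p x) \<partial>\<mu>) = \<dots> + (\<integral>x. ln (p x) \<partial>\<mu>)" .
  have "rel_entropy \<mu> (gibbs V \<beta>) = ereal (\<integral>x. ln (w x * p x) \<partial>\<mu>)"
    using rel_entropy_density(1)[OF gibbs_in_M1[OF \<beta>] _ _ \<mu>1 \<mu>w] wi w0 p0 by (auto simp: less_imp_le)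
  then show ?thesis unfolding eq pH by simp
qed

text \<open>The change of the entropy is (\<alpha> - \<beta>) m_V plus constants, and the change of
  the linear term is (\<beta> - \<alpha>) (m_V - R). The moments cancel, and what remains does not
  depend on \<mu>.\<close>

lemma rate_shift:
  assumes \<alpha>: "\<alpha> < 0" and \<beta>: "\<beta> < 0" and \<mu>1: "\<mu> \<in> M1" and R: "0 \<le> R"
  shows "rate_IV V R \<beta> \<mu> = rate_IV V R \<alpha> \<mu> + ereal (\<phi> R \<beta> - \<phi> R \<alpha>)"
proof (cases "\<mu> \<in> moment_set R")
  case True
  show ?thesis
  proof (cases "rel_entropy \<mu> (gibbs V \<alpha>) < \<infinity>")
    case fin: True
    have "\<bar>rel_entropy \<mu> (gibbs V \<alpha>)\<bar> \<noteq> \<infinity>" using fin rel_entropy_nonneg[OF gibbs_in_M1[OF \<alpha>] \<mu>1] by auto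
    then show ?thesis
      unfolding rate_moment_set[OF True R] rel_entropy_gibbs_shift[OF \<alpha> \<beta> True R fin] \<phi>_def
      by (cases "rel_entropy \<mu> (gibbs V \<alpha>)") (auto simp: algebra_simps)
  next
    case inf: False
    have "\<not> rel_entropy \<mu> (gibbs V \<beta>) < \<infinity>"
    proof
      assume fin: "rel_entropy \<mu> (gibbs V \<beta>) < \<infinity>"
      show False using rel_entropy_gibbs_shift[OF \<beta> \<alpha> True R fin] fin inf by (cases "rel_entropy \<mu> (gibbs V \<beta>)") auto
    qed
    then show ?thesis unfolding rate_moment_set[OF True R] using inf by simp
  qed
qed (use rate_outside \<mu>1 in simp)

text \<open>Each condition on the right is a weakly closed half-space, so this is the dual form of
  the rate. Forward, the entropy at \<beta> is at most the rate at \<beta>, and the easy duality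
  applies. Backward, the hard duality bounds the entropy at every \<beta>, and as \<beta> tends to 0
  the entropy exhausts the rate.\<close>

lemma rate_le_iff:
  assumes \<alpha>: "\<alpha> < 0" and \<mu>: "\<mu> \<in> moment_set R" and R: "0 < R"
  shows "rate_IV V R \<alpha> \<mu> \<le> ereal a \<longleftrightarrow>
    (\<forall>\<beta> f. \<beta> < 0 \<and> continuous_on UNIV f \<and> bounded (range f) \<longrightarrow>
      (\<integral>x. f x \<partial>\<mu>) \<le> a + \<phi> R \<beta> - \<phi> R \<alpha> + ln (\<integral>x. exp (f x) \<partial>gibbs V \<beta>))" (is "?L \<longleftrightarrow> ?D")
proof safe
  have \<mu>1: "\<mu> \<in> M1" using \<mu> by (rule moment_set_M1)
  have R0: "0 \<le> R" using R by simp
  fix \<beta> f assume L: ?L and \<beta>: "\<beta> < (0 :: real)" and f: "continuous_on UNIV f" "bounded (range (f :: real \<Rightarrow> real))"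
  obtain B where B: "\<And>x. \<bar>f x\<bar> \<le> B" and fm: "f \<in> borel_measurable borel"
    using bounded_continuous_measurable[OF f] by auto
  have "rel_entropy \<mu> (gibbs V \<beta>) \<le> rate_IV V R \<beta> \<mu>"
    unfolding rate_moment_set[OF \<mu> R0] using tilt_nonneg(1)[OF \<mu> R0 \<beta>] by (simp add: ereal_le_add_self)
  also have "\<dots> = rate_IV V R \<alpha> \<mu> + ereal (\<phi> R \<beta> - \<phi> R \<alpha>)" by (rule rate_shift[OF \<alpha> \<beta> \<mu>1 R0])
  also have "\<dots> \<le> ereal a + ereal (\<phi> R \<beta> - \<phi> R \<alpha>)" using L by (intro add_right_mono)
  finally have "rel_entropy \<mu> (gibbs V \<beta>) \<le> ereal (a + \<phi> R \<beta> - \<phi> R \<alpha>)" by (simp add: add_diff_eq)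
  from gibbs_variational[OF gibbs_in_M1[OF \<beta>] \<mu>1 fm B this]
  show "(\<integral>x. f x \<partial>\<mu>) \<le> a + \<phi> R \<beta> - \<phi> R \<alpha> + ln (\<integral>x. exp (f x) \<partial>gibbs V \<beta>)" .
next
  have \<mu>1: "\<mu> \<in> M1" using \<mu> by (rule moment_set_M1)
  have R0: "0 \<le> R" using R by simp
  assume D: ?D
  show ?L
  proof (rule ereal_le_epsilon2)
    fix e :: real assume e: "0 < e"
    \<comment> \<open>Chosen so that - \<beta> R = e, the largest possible value of the linear term
      at \<beta>.\<close>
    define \<beta> where "\<beta> = - e / R"
    have \<beta>: "\<beta> < 0" using e R by (simp add: \<beta>_def)
    have H: "rel_entropy \<mu> (gibbs V \<beta>) \<le> ereal (a + \<phi> R \<beta> - \<phi> R \<alpha>)"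
      by (rule donsker_varadhan[OF gibbs_in_M1[OF \<beta>] \<mu>1]) (use D \<beta> in auto)
    have "rate_IV V R \<alpha> \<mu> = rate_IV V R \<beta> \<mu> + ereal (\<phi> R \<alpha> - \<phi> R \<beta>)" by (rule rate_shift[OF \<beta> \<alpha> \<mu>1 R0])
    also have "\<dots> = rel_entropy \<mu> (gibbs V \<beta>) + ereal (\<beta> * ((\<integral>x. V x \<partial>\<mu>) - R)) + ereal (\<phi> R \<alpha> - \<phi> R \<beta>)"
      by (simp add: rate_moment_set[OF \<mu> R0])
    also have "\<dots> \<le> ereal (a + \<phi> R \<beta> - \<phi> R \<alpha>) + ereal e + ereal (\<phi> R \<alpha> - \<phi> R \<beta>)"
      using H tilt_nonneg(2)[OF \<mu> R0 \<beta>] R by (intro add_mono) (auto simp: \<beta>_def)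
    also have "\<dots> = ereal a + ereal e" by simp
    finally show "rate_IV V R \<alpha> \<mu> \<le> ereal a + ereal e" .
  qed
qed

text \<open>By the dual form, a level set is an intersection of closed half-spaces with the compact
  moment set.\<close>

lemma good_rate_weak:
  assumes \<alpha>: "\<alpha> < 0" and R: "0 < R"
  shows "good_rate weak_top (rate_IV V R \<alpha>)"
  unfolding good_rate_def
proof safe
  fix \<mu> assume "\<mu> \<in> topspace weak_top"
  then show "0 \<le> rate_IV V R \<alpha> \<mu>" using rate_nonneg[of \<mu> R \<alpha>] \<alpha> R by simp
next
  fix c :: real
  let ?C = "\<lambda>(\<beta>, f). {\<mu> \<in> M1. (\<integral>x. f x \<partial>\<mu>) \<in> {..c + \<phi> R \<beta> - \<phi> R \<alpha> + ln (\<integral>x. exp (f x) \<partial>gibbs V \<beta>)}}"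
  let ?I = "{(\<beta>, f). \<beta> < (0 :: real) \<and> continuous_on UNIV f \<and> bounded (range (f :: real \<Rightarrow> real))}"
  \<comment> \<open>A nonempty family is needed for the intersection of its members to be
    closed.\<close>
  have ne: "(-1, \<lambda>_. 0) \<in> ?I" by auto
  have level: "{\<mu> \<in> topspace weak_top. rate_IV V R \<alpha> \<mu> \<le> ereal c} = (\<Inter>j\<in>?I. ?C j) \<inter> moment_set R"
  proof (intro set_eqI iffI)
    fix \<mu> assume \<mu>: "\<mu> \<in> {\<mu> \<in> topspace weak_top. rate_IV V R \<alpha> \<mu> \<le> ereal c}"
    then have "rate_IV V R \<alpha> \<mu> < \<infinity>" by (cases "rate_IV V R \<alpha> \<mu>") auto
    then have m: "\<mu> \<in> moment_set R" using \<mu> rate_finite_moment_set[of \<mu> R \<alpha>] by simp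
    then show "\<mu> \<in> (\<Inter>j\<in>?I. ?C j) \<inter> moment_set R" using \<mu> rate_le_iff[OF \<alpha> m R, of c] by auto
  next
    fix \<mu> assume \<mu>: "\<mu> \<in> (\<Inter>j\<in>?I. ?C j) \<inter> moment_set R"
    then have m: "\<mu> \<in> moment_set R" by simp
    have "(\<integral>x. f x \<partial>\<mu>) \<le> c + \<phi> R \<beta> - \<phi> R \<alpha> + ln (\<integral>x. exp (f x) \<partial>gibbs V \<beta>)"
      if "\<beta> < 0" "continuous_on UNIV f" "bounded (range f)" for \<beta> f
    proof -
      have "(\<beta>, f) \<in> ?I" using that by simp
      then have "\<mu> \<in> ?C (\<beta>, f)" using \<mu> by blast
      then show ?thesis by simp
    qed
    then show "\<mu> \<in> {\<mu> \<in> topspace weak_top. rate_IV V R \<alpha> \<mu> \<le> ereal c}"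
      using rate_le_iff[OF \<alpha> m R, of c] moment_set_M1[OF m] by simp
  qed
  have closed: "closedin weak_top (\<Inter>j\<in>?I. ?C j)"
  proof (rule closedin_Inter)
    show "?C ` ?I \<noteq> {}" using ne by blast
    fix S assume "S \<in> ?C ` ?I"
    then obtain \<beta> f where "\<beta> < 0" "continuous_on UNIV f" "bounded (range f)" "S = ?C (\<beta>, f)" by auto
    then show "closedin weak_top S" by (simp only: case_prod_conv) (rule closedin_weak_top, auto)
  qed
  show "compactin weak_top {\<mu> \<in> topspace weak_top. rate_IV V R \<alpha> \<mu> \<le> ereal c}"
    unfolding level by (rule closed_Int_compactin[OF closed compactin_moment_set[OF R]])
qed

lemma mix_moment_set:
  assumes \<mu>: "\<mu> \<in> moment_set R" "\<nu> \<in> moment_set R" and R: "0 \<le> R" and t: "0 \<le> t" "t \<le> 1"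
  shows "mV V (mix t \<mu> \<nu>) = ennreal (t * (\<integral>x. V x \<partial>\<mu>) + (1 - t) * (\<integral>x. V x \<partial>\<nu>))"
    "mix t \<mu> \<nu> \<in> moment_set R" "(\<integral>x. V x \<partial>mix t \<mu> \<nu>) = t * (\<integral>x. V x \<partial>\<mu>) + (1 - t) * (\<integral>x. V x \<partial>\<nu>)"
proof -
  note m = moment_set_integrable[OF \<mu>(1) R] and n = moment_set_integrable[OF \<mu>(2) R]
  have "mV V (mix t \<mu> \<nu>) = ennreal t * mV V \<mu> + ennreal (1 - t) * mV V \<nu>"
    unfolding mV_def
    by (rule nn_integral_mix) (simp_all add: M1_D(1)[OF moment_set_M1[OF \<mu>(1)]] M1_D(1)[OF moment_set_M1[OF \<mu>(2)]])
  also have "\<dots> = ennreal (t * (\<integral>x. V x \<partial>\<mu>) + (1 - t) * (\<integral>x. V x \<partial>\<nu>))"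
    unfolding m(2) n(2) using t m(3) n(3) by (simp add: ennreal_mult ennreal_plus)
  finally show 1: "mV V (mix t \<mu> \<nu>) = ennreal (t * (\<integral>x. V x \<partial>\<mu>) + (1 - t) * (\<integral>x. V x \<partial>\<nu>))" .
  have "t * (\<integral>x. V x \<partial>\<mu>) + (1 - t) * (\<integral>x. V x \<partial>\<nu>) \<le> t * R + (1 - t) * R"
    using t m(4) n(4) by (intro add_mono mult_left_mono) auto
  then have "t * (\<integral>x. V x \<partial>\<mu>) + (1 - t) * (\<integral>x. V x \<partial>\<nu>) \<le> R" by (simp add: algebra_simps)
  then show 2: "mix t \<mu> \<nu> \<in> moment_set R" unfolding moment_set_def using 1 mix_in_M1[OF moment_set_M1[OF \<mu>(1)] moment_set_M1[OF \<mu>(2)] t]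
    by (auto intro: ennreal_leI)
  show "(\<integral>x. V x \<partial>mix t \<mu> \<nu>) = t * (\<integral>x. V x \<partial>\<mu>) + (1 - t) * (\<integral>x. V x \<partial>\<nu>)"
  proof (rule ennreal_inj[THEN iffD1])
    show "ennreal (\<integral>x. V x \<partial>mix t \<mu> \<nu>) = ennreal (t * (\<integral>x. V x \<partial>\<mu>) + (1 - t) * (\<integral>x. V x \<partial>\<nu>))"
      using 1 moment_set_integrable(2)[OF 2 R] by (simp only:)
  qed (use t in \<open>auto intro!: add_nonneg_nonneg mult_nonneg_nonneg\<close>)
qed

text \<open>The moment is affine under mixing and the moment set is convex, so the strictness comes
  entirely from the relative entropy.\<close>

lemma strictly_convex_rate_IV:
  assumes \<alpha>: "\<alpha> < 0" and R: "0 \<le> R"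
  shows "strictly_convex_rate M1 (rate_IV V R \<alpha>)"
  unfolding strictly_convex_rate_def
proof safe
  fix \<mu> \<nu> t
  assume M: "\<mu> \<in> M1" "\<nu> \<in> M1" and ne: "\<mu> \<noteq> \<nu>" and t: "0 < t" "t < (1 :: real)"
    and fin: "rate_IV V R \<alpha> \<mu> < \<infinity>" "rate_IV V R \<alpha> \<nu> < \<infinity>"
  have m: "\<mu> \<in> moment_set R" "\<nu> \<in> moment_set R" using M fin by (auto intro: rate_finite_moment_set)
  have H: "rel_entropy \<mu> (gibbs V \<alpha>) < \<infinity>" "rel_entropy \<nu> (gibbs V \<alpha>) < \<infinity>"
    using fin unfolding rate_moment_set[OF m(1) R] rate_moment_set[OF m(2) R] by auto
  have mm: "mix t \<mu> \<nu> \<in> moment_set R" "(\<integral>x. V x \<partial>mix t \<mu> \<nu>) = t * (\<integral>x. V x \<partial>\<mu>) + (1 - t) * (\<integral>x. V x \<partial>\<nu>)"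
    using mix_moment_set[OF m R, of t] t by auto
  obtain a b where ab: "rel_entropy \<mu> (gibbs V \<alpha>) = ereal a" "rel_entropy \<nu> (gibbs V \<alpha>) = ereal b"
    using H rel_entropy_nonneg[OF gibbs_in_M1[OF \<alpha>] M(1)] rel_entropy_nonneg[OF gibbs_in_M1[OF \<alpha>] M(2)]
    by (cases "rel_entropy \<mu> (gibbs V \<alpha>)"; cases "rel_entropy \<nu> (gibbs V \<alpha>)") auto
  have "rel_entropy (mix t \<mu> \<nu>) (gibbs V \<alpha>) < ereal (t * a + (1 - t) * b)"
    using rel_entropy_strict_convex[OF gibbs_in_M1[OF \<alpha>] M ne t H] by (simp add: ab)
  moreover have "0 \<le> rel_entropy (mix t \<mu> \<nu>) (gibbs V \<alpha>)"
    by (rule rel_entropy_nonneg[OF gibbs_in_M1[OF \<alpha>] moment_set_M1[OF mm(1)]])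
  ultimately obtain c where c: "rel_entropy (mix t \<mu> \<nu>) (gibbs V \<alpha>) = ereal c" "c < t * a + (1 - t) * b"
    by (cases "rel_entropy (mix t \<mu> \<nu>) (gibbs V \<alpha>)") auto
  show "rate_IV V R \<alpha> (mix t \<mu> \<nu>) < ereal t * rate_IV V R \<alpha> \<mu> + ereal (1 - t) * rate_IV V R \<alpha> \<nu>"
    unfolding rate_moment_set[OF m(1) R] rate_moment_set[OF m(2) R] rate_moment_set[OF mm(1) R] mm(2) ab c(1)
    using c(2) by (simp add: algebra_simps)
qed

text \<open>With t = \<beta> - \<alpha>, the difference of Z \<beta> and exp (t R) * Z \<alpha> is
  the integral of a positive weight times exp y - 1 - y at y = t (V - R): the first-order term
  integrates to 0 because \<alpha> solves the moment equation. The remainder is nonnegative, and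
  positive on an interval around 0 where V < R.\<close>

lemma phi_strict_min:
  assumes R: "0 < R" and \<alpha>: "\<alpha> < 0" "excess R \<alpha> = 0" and \<beta>: "\<beta> < 0" "\<beta> \<noteq> \<alpha>"
  shows "\<phi> R \<alpha> < \<phi> R \<beta>"
proof -
  define t where "t = \<beta> - \<alpha>"
  have t: "t \<noteq> 0" using \<beta> by (simp add: t_def)
  let ?g = "\<lambda>x. exp (t * R) * (exp (\<alpha> * V x) + t * ((V x - R) * exp (\<alpha> * V x)))"
  have gi: "integrable lborel ?g"
    using integrable_exp_V[OF \<alpha>(1)] integrable_excess[OF \<alpha>(1), of R] by auto
  have bi: "integrable lborel (\<lambda>x. exp (\<beta> * V x))" by (rule integrable_exp_V[OF \<beta>(1)])
  have eq: "exp (\<beta> * V x) - ?g x = exp (t * R) * exp (\<alpha> * V x) * (exp (t * (V x - R)) - 1 - t * (V x - R))" for x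
  proof -
    have "exp (\<beta> * V x) = exp (t * R) * exp (\<alpha> * V x) * exp (t * (V x - R))"
      by (simp add: t_def algebra_simps flip: exp_add)
    then show ?thesis by (simp add: algebra_simps)
  qed
  have ge: "0 \<le> exp (\<beta> * V x) - ?g x" for x
  proof -
    have "0 \<le> exp (t * (V x - R)) - 1 - t * (V x - R)"
      using exp_ge_add_one_self[of "t * (V x - R)"] by linarith
    then show ?thesis unfolding eq by (intro mult_nonneg_nonneg) auto
  qed
  have gI: "(\<integral>x. ?g x \<partial>lborel) = exp (t * R) * Z \<alpha>"
    using integrable_exp_V[OF \<alpha>(1)] integrable_excess[OF \<alpha>(1), of R] \<alpha>(2) by (simp add: Z_def excess_def)
  have "exp (t * R) * Z \<alpha> \<noteq> Z \<beta>"
  proof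
    assume "exp (t * R) * Z \<alpha> = Z \<beta>"
    then have "(\<integral>x. exp (\<beta> * V x) - ?g x \<partial>lborel) = 0"
      unfolding Bochner_Integration.integral_diff[OF bi gi] gI by (simp add: Z_def[of \<beta>])
    then have ae: "AE x in lborel. exp (\<beta> * V x) - ?g x = 0"
      using ge gi bi by (subst (asm) integral_nonneg_eq_0_iff_AE) auto
    obtain r where r: "r > 0" "\<And>x. \<bar>x\<bar> \<le> r \<Longrightarrow> V x < R" using V_lt_inside[OF R] by auto
    from ae have "AE x in lborel. x \<notin> {- r..r}"
    proof eventually_elim
      case (elim x)
      then have "exp (t * (V x - R)) - 1 - t * (V x - R) = 0" unfolding eq by simp
      then have "exp (t * (V x - R)) = 1" by (intro ln_eq_minus_one) auto
      then have "t * (V x - R) = 0" by simp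
      then show ?case using t r(2)[of x] by (auto simp: abs_le_iff)
    qed
    then have "emeasure lborel {- r..r} = 0" by (subst (asm) AE_iff_null_sets[symmetric]) auto
    then show False using r by simp
  qed
  moreover have "exp (t * R) * Z \<alpha> \<le> Z \<beta>"
    unfolding gI[symmetric] Z_def[of \<beta>] using gi bi ge by (intro integral_mono) auto
  ultimately have "exp (t * R) * Z \<alpha> < Z \<beta>" by simp
  then have "ln (exp (t * R) * Z \<alpha>) < ln (Z \<beta>)" using Z_pos[OF \<alpha>(1)] Z_pos[OF \<beta>(1)] by simp
  then show ?thesis using Z_pos[OF \<alpha>(1)] by (simp add: ln_mult \<phi>_def t_def algebra_simps)
qed

end

section \<open>From volumes to the logarithmic scale\<close>

lemma INF_Int_top:
  fixes f :: "'a \<Rightarrow> 'b :: complete_lattice"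
  assumes "\<And>x. x \<in> A \<Longrightarrow> x \<notin> K \<Longrightarrow> f x = top"
  shows "(INF x\<in>A. f x) = (INF x\<in>A \<inter> K. f x)"
proof (rule antisym)
  show "(INF x\<in>A. f x) \<le> (INF x\<in>A \<inter> K. f x)" by (rule INF_superset_mono) auto
  show "(INF x\<in>A \<inter> K. f x) \<le> (INF x\<in>A. f x)"
  proof (rule INF_greatest)
    fix x assume "x \<in> A"
    then show "(INF x\<in>A \<inter> K. f x) \<le> f x" using assms[of x] by (cases "x \<in> K") (auto intro: INF_lower)
  qed
qed

lemma openin_borel_sets_of: "openin X U \<Longrightarrow> U \<in> borel_sets_of X"
  by (auto simp: borel_sets_of_def)

lemma closedin_borel_sets_of:
  assumes "closedin X C" shows "C \<in> borel_sets_of X"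
proof -
  have "topspace X - C \<in> sigma_sets (topspace X) {S. openin X S}" using assms by (auto simp: closedin_def)
  then have "topspace X - (topspace X - C) \<in> sigma_sets (topspace X) {S. openin X S}" by (rule sigma_sets.Compl)
  moreover have "topspace X - (topspace X - C) = C" using assms closedin_subset by fastforce
  ultimately show ?thesis by (simp add: borel_sets_of_def)
qed

lemma scaled_elog_ge:
  assumes "0 < n" "exp (- real n * a) / c \<le> p" "0 < c"
  shows "ereal (- a - ln c / real n) \<le> ereal (1 / real n) * elog p"
proof -
  have "0 < exp (- real n * a) / c" using assms by simp
  then have p: "0 < p" using assms(2) by linarith
  have "ln (exp (- real n * a) / c) \<le> ln p" using assms p by (subst ln_le_cancel_iff) auto
  then have "- real n * a - ln c \<le> ln p" using assms by (simp add: ln_div)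
  then have "(- real n * a - ln c) / real n \<le> ln p / real n" by (rule divide_right_mono) simp
  moreover have "(- real n * a - ln c) / real n = - a - ln c / real n" using assms by (simp add: field_simps)
  ultimately show ?thesis using p by (simp add: elog_def)
qed

lemma scaled_elog_le:
  assumes "0 < n" "p \<le> c * exp (- real n * a)" "0 < c"
  shows "ereal (1 / real n) * elog p \<le> ereal (- a + ln c / real n)"
proof (cases "p \<le> 0")
  case True
  then show ?thesis using assms by (simp add: elog_def)
next
  case False
  have "ln p \<le> ln (c * exp (- real n * a))" using assms False by (subst ln_le_cancel_iff) auto
  then have "ln p \<le> ln c - real n * a" using assms by (simp add: ln_mult)
  then have "ln p / real n \<le> (ln c - real n * a) / real n" by (rule divide_right_mono) simp
  moreover have "(ln c - real n * a) / real n = - a + ln c / real n" using assms by (simp add: field_simps)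
  ultimately show ?thesis using False by (simp add: elog_def)
qed

context orlicz_function
begin

lemma gibbs_moment_set:
  assumes "\<beta> < 0" "excess R \<beta> \<le> 0" "0 < R"
  shows "gibbs V \<beta> \<in> moment_set R"
proof -
  have "R + excess R \<beta> / Z \<beta> \<le> R" using Z_pos[OF assms(1)] assms(2) by (simp add: divide_nonpos_pos)
  then have "mV V (gibbs V \<beta>) \<le> ennreal R" unfolding mV_gibbs[OF assms(1), of R] by (rule ennreal_leI)
  then show ?thesis using gibbs_in_M1[OF assms(1)] by (simp add: moment_set_def)
qed

lemma rate_gibbs:
  assumes \<alpha>: "\<alpha> < 0" "excess R \<alpha> = 0" and R: "0 < R"
  shows "rate_IV V R \<alpha> (gibbs V \<alpha>) = 0"
proof -
  have m: "gibbs V \<alpha> \<in> moment_set R" using assms by (intro gibbs_moment_set) auto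
  have "ennreal (\<integral>x. V x \<partial>gibbs V \<alpha>) = ennreal R"
    using mV_gibbs[OF \<alpha>(1), of R] moment_set_integrable(2)[OF m] \<alpha>(2) R by simp
  then have "(\<integral>x. V x \<partial>gibbs V \<alpha>) = R" using R by simp
  then show ?thesis using rate_moment_set[OF m, of \<alpha>] R rel_entropy_self[OF gibbs_in_M1[OF \<alpha>(1)]] by simp
qed

text \<open>Expressed by the Lebesgue density q of \<mu>, the rate is the integral of ln q plus
  \<phi> R \<alpha>, so the exponent of \<open>volume_lower\<close> becomes I - \<phi> R
  \<alpha>.\<close>

lemma volume_lower_interior:
  assumes \<alpha>: "\<alpha> < 0" and R: "0 < R" and \<mu>: "\<mu> \<in> M1" "rate_IV V R \<alpha> \<mu> = ereal I" "mV V \<mu> < ennreal R"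
    and U: "openin weak_top U" "\<mu> \<in> U" and e: "0 < e"
  shows "eventually (\<lambda>n. ennreal (exp (- real n * (I - \<phi> R \<alpha> + e)) / 2) \<le>
    emeasure (lebesgue_n n) {x \<in> orlicz_ball V R n. empirical n x \<in> U}) sequentially"
proof -
  have R0: "0 \<le> R" using R by simp
  have m: "\<mu> \<in> moment_set R" using \<mu> by (simp add: moment_set_def)
  note Vi = moment_set_integrable(1)[OF m R0]
  interpret M: prob_space \<mu> by (rule M1_D[OF \<mu>(1)])
  note [measurable_cong] = M1_D(1)[OF \<mu>(1)]
  note Z = Z_pos[OF \<alpha>]
  have rate: "rel_entropy \<mu> (gibbs V \<alpha>) + ereal (\<alpha> * ((\<integral>x. V x \<partial>\<mu>) - R)) = ereal I"
    using \<mu>(2) unfolding rate_moment_set[OF m R0] .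
  then have fin: "rel_entropy \<mu> (gibbs V \<alpha>) < \<infinity>" by (cases "rel_entropy \<mu> (gibbs V \<alpha>)") auto
  obtain p where p[measurable]: "p \<in> borel_measurable borel" and p0: "\<And>x. 0 \<le> p x" and \<mu>p: "\<mu> = density (gibbs V \<alpha>) (\<lambda>x. ennreal (p x))"
    and pi: "integrable \<mu> (\<lambda>x. ln (p x))" and pH: "rel_entropy \<mu> (gibbs V \<alpha>) = ereal (\<integral>x. ln (p x) \<partial>\<mu>)"
    using rel_entropy_finite_density[OF gibbs_in_M1[OF \<alpha>] \<mu>(1) fin] by metis
  have pos: "AE x in \<mu>. 0 < p x" using density_pos_AE[OF _ \<mu>p] by simp
  define q where "q x = exp (\<alpha> * V x) / Z \<alpha> * p x" for x
  have [measurable]: "q \<in> borel_measurable borel" unfolding q_def by measurable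
  have q0: "0 \<le> q x" for x using Z p0[of x] by (simp add: q_def)
  have \<mu>q: "\<mu> = density lborel (\<lambda>x. ennreal (q x))"
    unfolding \<mu>p gibbs_eq using Z p0 by (subst density_density_eq) (auto simp: q_def ennreal_mult[symmetric])
  let ?k = "\<lambda>x. \<alpha> * V x - ln (Z \<alpha>) + ln (p x)"
  have ae: "AE x in \<mu>. ln (q x) = ?k x"
    using pos by eventually_elim (use Z in \<open>simp add: q_def ln_mult ln_div\<close>)
  have ki: "integrable \<mu> ?k" using Vi pi by auto
  have qi: "integrable \<mu> (\<lambda>x. ln (q x))" using ki ae by (subst integrable_cong_AE[where g = ?k]) auto
  have "(\<integral>x. ln (q x) \<partial>\<mu>) = (\<integral>x. ?k x \<partial>\<mu>)" using ae by (intro integral_cong_AE) auto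
  also have "\<dots> = \<alpha> * (\<integral>x. V x \<partial>\<mu>) - ln (Z \<alpha>) + (\<integral>x. ln (p x) \<partial>\<mu>)"
    using Vi pi by (simp add: M.prob_space)
  also have "\<dots> = I - \<phi> R \<alpha>" using rate unfolding pH by (simp add: \<phi>_def algebra_simps)
  finally have h: "(\<integral>x. ln (q x) \<partial>\<mu>) = I - \<phi> R \<alpha>" .
  show ?thesis using volume_lower[OF R \<mu>(1) \<mu>q _ q0 qi \<mu>(3) U e] unfolding h by simp
qed

text \<open>On the boundary \<open>m_V(\<mu>) = R\<close> the law of large numbers does not keep the sample inside the
  ball; mixing with a Gibbs measure of smaller moment moves \<open>\<mu>\<close> inside at small cost in rate.\<close>
lemma volume_lower_rate:
  assumes \<alpha>: "\<alpha> < 0" and R: "0 < R" and \<mu>: "\<mu> \<in> M1" "rate_IV V R \<alpha> \<mu> = ereal I"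
    and U: "openin weak_top U" "\<mu> \<in> U" and e: "0 < e"
  shows "eventually (\<lambda>n. ennreal (exp (- real n * (I - \<phi> R \<alpha> + e)) / 2) \<le>
    emeasure (lebesgue_n n) {x \<in> orlicz_ball V R n. empirical n x \<in> U}) sequentially"
proof (cases "mV V \<mu> < ennreal R")
  case True
  then show ?thesis by (rule volume_lower_interior[OF \<alpha> R \<mu> _ U e])
next
  case False
  have R0: "0 \<le> R" using R by simp
  have m: "\<mu> \<in> moment_set R" using \<mu> by (intro rate_finite_moment_set[of \<mu> R \<alpha>]) auto
  obtain b where b: "b < 0" "excess R b < 0" using excess_neg[OF R] by blast
  define \<nu> where "\<nu> = gibbs V b"
  have n: "\<nu> \<in> moment_set R" unfolding \<nu>_def using b R by (intro gibbs_moment_set) auto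
  have \<nu>1: "\<nu> \<in> M1" using n by (rule moment_set_M1)
  have mn: "mV V \<nu> < ennreal R"
    unfolding \<nu>_def mV_gibbs[OF b(1), of R] using b Z_pos[OF b(1)] R
    by (intro ennreal_lessI) (auto simp: divide_neg_pos)
  then have nm: "(\<integral>x. V x \<partial>\<nu>) < R" unfolding moment_set_integrable(2)[OF n R0] using R by (simp add: ennreal_less_iff)
  have "rate_IV V R b \<nu> < \<infinity>" unfolding rate_moment_set[OF n R0] using rel_entropy_self[OF \<nu>1] by (simp add: \<nu>_def)
  then have "rate_IV V R \<alpha> \<nu> < \<infinity>" unfolding rate_shift[OF b(1) \<alpha> \<nu>1 R0] by (cases "rate_IV V R b \<nu>") auto
  then obtain J where J: "rate_IV V R \<alpha> \<nu> = ereal J" using rate_nonneg[OF \<nu>1 R0 \<alpha>] by (cases "rate_IV V R \<alpha> \<nu>") auto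
  \<comment> \<open>The convexity estimate below is the strict one and needs distinct measures; they
    differ because \<mu> violates the strict moment inequality that \<nu> satisfies.\<close>
  have ne: "\<mu> \<noteq> \<nu>" using False mn by auto
  have "openin (subtopology euclideanreal {0..1}) {t \<in> topspace (subtopology euclideanreal {0..1}). mix t \<mu> \<nu> \<in> U}"
    by (rule openin_continuous_map_preimage[OF continuous_mix[OF \<mu>(1) \<nu>1] U(1)])
  then obtain T where T: "open T" "{t \<in> {0..1}. mix t \<mu> \<nu> \<in> U} = T \<inter> {0..1}"
    by (auto simp: openin_subtopology)
  have "(1 :: real) \<in> {t \<in> {0..1}. mix t \<mu> \<nu> \<in> U}" using U(2) mix_1[OF \<mu>(1) \<nu>1] by simp
  then have "(1 :: real) \<in> T" unfolding T(2) by blast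
  then obtain d where d: "d > 0" "\<And>t. \<bar>t - 1\<bar> < d \<Longrightarrow> t \<in> T" using T(1) unfolding open_real by auto
  \<comment> \<open>The summand 1 keeps \<open>k\<close> positive when the two rates
    coincide.\<close>
  define k where "k = \<bar>J - I\<bar> + 1"
  have k: "0 < k" unfolding k_def by (rule add_nonneg_pos) auto
  \<comment> \<open>The weight of the Gibbs measure: 1/2 keeps t inside (0, 1), d / 2 keeps the
    mixture in U, and e / (2k) limits the increase of the rate to e / 2.\<close>
  define s where "s = min (1 / 2) (min (d / 2) (e / (2 * k)))"
  define t where "t = 1 - s"
  have s: "0 < s" "s \<le> 1 / 2" "s < d" "s * k \<le> e / 2"
  proof -
    have "0 < e / (2 * k)" using e k by simp
    then show "0 < s" using d unfolding s_def by simp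
    show "s \<le> 1 / 2" unfolding s_def by (rule min.cobounded1)
    have "s \<le> d / 2" unfolding s_def by simp
    then show "s < d" using d by simp
    have "s \<le> e / (2 * k)" by (simp add: s_def)
    then have "s * k \<le> e / (2 * k) * k" using k by (intro mult_right_mono) auto
    also have "\<dots> = e / 2" using k by simp
    finally show "s * k \<le> e / 2" .
  qed
  have t: "0 < t" "t < 1" using s by (auto simp: t_def)
  have tU: "mix t \<mu> \<nu> \<in> U"
  proof -
    have "t \<in> T" by (rule d) (use s in \<open>simp add: t_def\<close>)
    then have "t \<in> T \<inter> {0..1}" using t by simp
    then show ?thesis unfolding T(2)[symmetric] by simp
  qed
  have mm: "mV V (mix t \<mu> \<nu>) < ennreal R"
  proof -
    have "t * (\<integral>x. V x \<partial>\<mu>) + (1 - t) * (\<integral>x. V x \<partial>\<nu>) < t * R + (1 - t) * R"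
      using t nm moment_set_integrable(4)[OF m R0] by (intro add_le_less_mono mult_left_mono mult_strict_left_mono) auto
    then show ?thesis using mix_moment_set(1)[OF m n R0, of t] t R by (auto simp: algebra_simps intro!: ennreal_lessI)
  qed
  have mM: "mix t \<mu> \<nu> \<in> M1" using mix_in_M1[OF \<mu>(1) \<nu>1] t by simp
  have "rate_IV V R \<alpha> (mix t \<mu> \<nu>) < ereal t * rate_IV V R \<alpha> \<mu> + ereal (1 - t) * rate_IV V R \<alpha> \<nu>"
    by (rule strictly_convex_rate_IV[OF \<alpha> R0, unfolded strictly_convex_rate_def, rule_format, OF \<mu>(1) \<nu>1])
      (use ne t \<mu>(2) J in auto)
  then obtain I' where I': "rate_IV V R \<alpha> (mix t \<mu> \<nu>) = ereal I'" "I' < t * I + (1 - t) * J"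
    using rate_nonneg[OF mM R0 \<alpha>] by (cases "rate_IV V R \<alpha> (mix t \<mu> \<nu>)") (auto simp: \<mu>(2) J)
  have "t * I + (1 - t) * J = I + s * (J - I)" by (simp add: t_def algebra_simps)
  also have "s * (J - I) \<le> s * k" using s unfolding k_def by (intro mult_left_mono) auto
  finally have "I' \<le> I + e / 2" using I'(2) s(4) by linarith
  then have le: "I' - \<phi> R \<alpha> + e / 2 \<le> I - \<phi> R \<alpha> + e" by simp
  have "eventually (\<lambda>n. ennreal (exp (- real n * (I' - \<phi> R \<alpha> + e / 2)) / 2) \<le>
    emeasure (lebesgue_n n) {x \<in> orlicz_ball V R n. empirical n x \<in> U}) sequentially"
    by (rule volume_lower_interior[OF \<alpha> R mM I'(1) mm U(1) tU]) (use e in simp)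
  then show ?thesis
  proof eventually_elim
    case (elim n)
    have "- real n * (I - \<phi> R \<alpha> + e) \<le> - real n * (I' - \<phi> R \<alpha> + e / 2)"
      using le by (simp add: mult_left_mono)
    then have "ennreal (exp (- real n * (I - \<phi> R \<alpha> + e)) / 2) \<le> ennreal (exp (- real n * (I' - \<phi> R \<alpha> + e / 2)) / 2)"
      by (intro ennreal_leI divide_right_mono) auto
    then show ?case using elim by (rule order_trans)
  qed
qed

lemma ball_volume_upper:
  assumes \<alpha>: "\<alpha> < 0"
  shows "emeasure (lebesgue_n n) (orlicz_ball V R n) \<le> ennreal (exp (real n * \<phi> R \<alpha>))"
proof -
  interpret prob_space "gibbs V \<alpha>" by (rule prob_space_gibbs[OF \<alpha>])
  show ?thesis
    using volume_upper[OF \<alpha>, of "\<lambda>_. 0" 0 "orlicz_ball V R n" n R 0] sets_orlicz_ball[of R n]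
    by (simp add: \<phi>_def prob_space)
qed

text \<open>The lower bound is taken for the neighbourhood of all of M1 around the Gibbs measure at
  \<alpha>, whose rate is 0. This measure lies on the boundary m_V = R, so the version for arbitrary
  finite rate is required.\<close>

lemma ball_volume_lower:
  assumes \<alpha>: "\<alpha> < 0" "excess R \<alpha> = 0" and R: "0 < R" and e: "0 < e"
  shows "eventually (\<lambda>n. exp (real n * (\<phi> R \<alpha> - e)) / 2 \<le> measure (lebesgue_n n) (orlicz_ball V R n)) sequentially"
proof -
  have "eventually (\<lambda>n. ennreal (exp (- real n * (0 - \<phi> R \<alpha> + e)) / 2) \<le>
    emeasure (lebesgue_n n) {x \<in> orlicz_ball V R n. empirical n x \<in> M1}) sequentially"
    using volume_lower_rate[OF \<alpha>(1) R gibbs_in_M1[OF \<alpha>(1)], of 0 M1 e] rate_gibbs[OF \<alpha> R] e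
      openin_topspace[of weak_top] gibbs_in_M1[OF \<alpha>(1)] by (simp add: zero_ereal_def)
  then show ?thesis
  proof eventually_elim
    case (elim n)
    have "ennreal (exp (real n * (\<phi> R \<alpha> - e)) / 2) = ennreal (exp (- real n * (0 - \<phi> R \<alpha> + e)) / 2)"
      by (simp add: algebra_simps)
    also note elim
    also have "emeasure (lebesgue_n n) {x \<in> orlicz_ball V R n. empirical n x \<in> M1} \<le> emeasure (lebesgue_n n) (orlicz_ball V R n)"
      by (intro emeasure_mono sets_orlicz_ball) auto
    also have "\<dots> = ennreal (measure (lebesgue_n n) (orlicz_ball V R n))"
      using ball_volume_upper[OF \<alpha>(1), of n R] by (intro emeasure_eq_ennreal_measure) (auto simp: top_unique)
    finally show ?case by simp
  qed
qed

lemma emp_prob_eq: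
  assumes D: "{x \<in> space (lebesgue_n n). empirical n x \<in> A} \<in> sets (lebesgue_n n)"
    and pos: "0 < measure (lebesgue_n n) (orlicz_ball V R n)"
  shows "emp_prob V R n A = measure (lebesgue_n n) {x \<in> orlicz_ball V R n. empirical n x \<in> A} / measure (lebesgue_n n) (orlicz_ball V R n)"
proof -
  have "emeasure (lebesgue_n n) (orlicz_ball V R n) \<noteq> 0" "emeasure (lebesgue_n n) (orlicz_ball V R n) \<noteq> \<infinity>"
    using pos by (auto simp: measure_def enn2real_positive_iff)
  moreover have "orlicz_ball V R n \<inter> {x \<in> space (lebesgue_n n). empirical n x \<in> A} = {x \<in> orlicz_ball V R n. empirical n x \<in> A}"
    by (auto simp: orlicz_ball_def)
  ultimately show ?thesis unfolding emp_prob_def using D by (subst measure_uniform_measure) auto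
qed

lemma emp_prob_cong:
  assumes n: "0 < n" and R: "0 \<le> R"
    and D: "{x \<in> space (lebesgue_n n). empirical n x \<in> A} \<in> sets (lebesgue_n n)" "{x \<in> space (lebesgue_n n). empirical n x \<in> A'} \<in> sets (lebesgue_n n)"
    and eq: "A \<inter> moment_set R = A' \<inter> moment_set R"
  shows "emp_prob V R n A = emp_prob V R n A'"
proof -
  have "orlicz_ball V R n \<inter> {x \<in> space (lebesgue_n n). empirical n x \<in> A} = orlicz_ball V R n \<inter> {x \<in> space (lebesgue_n n). empirical n x \<in> A'}"
    using eq orlicz_ball_iff[OF n R] by blast
  then show ?thesis unfolding emp_prob_def measure_def
    using D sets_orlicz_ball[of R n] by (subst (1 2) emeasure_uniform_measure) auto
qed

end

section \<open>Large deviations\<close>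

lemma ereal_le_uminus_swap: "a \<le> - b \<longleftrightarrow> b \<le> - a" for a b :: ereal
  by (metis ereal_minus_le_minus ereal_uminus_uminus)

lemma topspace_dW_top: "topspace (dW_top W) = M1V W"
  unfolding dW_top_def topology_generated_by_topspace
proof (rule antisym)
  have "M1V W = {\<mu> \<in> M1V W. enn2real (mV W \<mu>) \<in> UNIV}" by simp
  then have "M1V W \<in> {{\<mu> \<in> M1V W. enn2real (mV W \<mu>) \<in> U} |U. open U}" by blast
  then show "M1V W \<subseteq> \<Union> ({S \<inter> M1V W |S. S \<in> weak_subbase} \<union> {{\<mu> \<in> M1V W. enn2real (mV W \<mu>) \<in> U} |U. open U})"
    by (intro Union_upper UnI2)
qed auto

context orlicz_function
begin

text \<open>The volume bound around a point of U is divided by the upper bound exp (n * \<phi> R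
  \<alpha>) for the volume of the ball, and \<phi> R \<alpha> cancels. The lower bound for the ball
  only serves to make the denominator positive.\<close>

lemma ldp_lower:
  assumes \<alpha>: "\<alpha> < 0" "excess R \<alpha> = 0" and R: "0 < R" and U: "openin weak_top U"
  shows "- (INF \<mu>\<in>U. rate_IV V R \<alpha> \<mu>) \<le> liminf (\<lambda>n. ereal (1 / real n) * elog (emp_prob V R n U))"
    (is "_ \<le> ?L")
proof -
  have U1: "U \<subseteq> M1" using openin_subset[OF U] by simp
  have "- rate_IV V R \<alpha> \<mu> \<le> ?L" if \<mu>: "\<mu> \<in> U" for \<mu>
  proof (cases "rate_IV V R \<alpha> \<mu> = \<infinity>")
    case False
    have \<mu>1: "\<mu> \<in> M1" using \<mu> U1 by auto
    obtain I where I: "rate_IV V R \<alpha> \<mu> = ereal I"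
      using False rate_nonneg[OF \<mu>1 _ \<alpha>(1), of R] R by (cases "rate_IV V R \<alpha> \<mu>") auto
    show ?thesis
    proof (rule ereal_le_epsilon2)
      fix e :: real assume e: "0 < e"
      have "(\<lambda>n. ln 2 / real n) \<longlonglongrightarrow> 0" by real_asymp
      \<comment> \<open>The factor 1/2 of the volume bound costs ln 2 / n in the exponent, paid from
        one half of e; the other half pays for the volume estimate.\<close>
      then have ev: "eventually (\<lambda>n. ln 2 / real n < e / 2) sequentially" using e by (intro order_tendstoD(2)[of _ 0]) auto
      have e2: "0 < e / 2" using e by simp
      have "eventually (\<lambda>n. ereal (- I - e) \<le> ereal (1 / real n) * elog (emp_prob V R n U)) sequentially"
        using volume_lower_rate[OF \<alpha>(1) R \<mu>1 I U \<mu> e2] ball_volume_lower[OF \<alpha> R e] ev eventually_gt_at_top[of "0 :: nat"]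
      proof (eventually_elim)
        case (elim n)
        let ?b = "measure (lebesgue_n n) (orlicz_ball V R n)"
        let ?G = "{x \<in> orlicz_ball V R n. empirical n x \<in> U}"
        have bpos: "0 < ?b" using elim(2) by (rule less_le_trans[rotated]) simp
        have "emeasure (lebesgue_n n) (orlicz_ball V R n) = ennreal ?b"
          using ball_volume_upper[OF \<alpha>(1), of n R] by (intro emeasure_eq_ennreal_measure) (auto simp: top_unique)
        then have bup: "?b \<le> exp (real n * \<phi> R \<alpha>)" using ball_volume_upper[OF \<alpha>(1), of n R] by simp
        have Gfin: "emeasure (lebesgue_n n) ?G \<noteq> top"
          using emeasure_mono[of ?G "orlicz_ball V R n" "lebesgue_n n"] sets_orlicz_ball[of R n] ball_volume_upper[OF \<alpha>(1), of n R]
          by (auto simp: top_unique)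
        have G: "exp (- real n * (I - \<phi> R \<alpha> + e / 2)) / 2 \<le> measure (lebesgue_n n) ?G"
          using elim(1) e unfolding emeasure_eq_ennreal_measure[OF Gfin] by simp
        have "exp (- real n * (I + e / 2)) / 2 = exp (- real n * (I - \<phi> R \<alpha> + e / 2)) / 2 / exp (real n * \<phi> R \<alpha>)"
          by (simp add: algebra_simps flip: exp_diff)
        also have "\<dots> \<le> measure (lebesgue_n n) ?G / ?b"
          using G bup bpos by (intro frac_le) auto
        also have "\<dots> = emp_prob V R n U"
          by (rule emp_prob_eq[OF _ bpos, symmetric]) (rule empirical_continuous_measurable[OF empirical_continuous_weak elim(4) U])
        finally have "ereal (- (I + e / 2) - ln 2 / real n) \<le> ereal (1 / real n) * elog (emp_prob V R n U)"
          by (rule scaled_elog_ge[OF elim(4)]) simp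
        moreover have "ereal (- I - e) \<le> ereal (- (I + e / 2) - ln 2 / real n)" using elim(3) by simp
        ultimately show ?case by (rule order_trans[rotated])
      qed
      then have "ereal (- I - e) \<le> ?L" by (rule Liminf_bounded)
      then have "ereal (- I - e) + ereal e \<le> ?L + ereal e" by (rule add_right_mono)
      then show "- rate_IV V R \<alpha> \<mu> \<le> ?L + ereal e" by (simp add: I)
    qed
  qed simp
  then have "- ?L \<le> (INF \<mu>\<in>U. rate_IV V R \<alpha> \<mu>)" by (intro INF_greatest) (simp add: ereal_uminus_le_reorder)
  then show ?thesis by (simp add: ereal_uminus_le_reorder)
qed

text \<open>A level a strictly below the infimum makes every point of C inside the moment set
  violate some dual inequality at level a. Compactness leaves finitely many violated inequalities,
  and the finite number of pieces vanishes on the exponential scale.\<close>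

lemma ldp_upper:
  assumes \<alpha>: "\<alpha> < 0" "excess R \<alpha> = 0" and R: "0 < R" and C: "closedin weak_top C"
  shows "limsup (\<lambda>n. ereal (1 / real n) * elog (emp_prob V R n C)) \<le> - (INF \<mu>\<in>C. rate_IV V R \<alpha> \<mu>)"
    (is "?L \<le> _")
proof -
  have R0: "0 \<le> R" using R by simp
  have real_case: "?L \<le> - ereal a" if a: "ereal a < (INF \<mu>\<in>C. rate_IV V R \<alpha> \<mu>)" for a
  proof -
    \<comment> \<open>This threshold makes the Chebyshev bound equal to exp (n * (\<phi> R \<alpha>
      - a)) for every pair of \<beta> and f, so all pieces of the cover share one estimate.\<close>
    let ?s = "\<lambda>\<beta> f. a + \<phi> R \<beta> - \<phi> R \<alpha> + ln (\<integral>x. exp (f x) \<partial>gibbs V \<beta>)"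
    let ?G = "\<lambda>(\<beta>, f). {\<mu> \<in> M1. (\<integral>x. f x \<partial>\<mu>) \<in> {?s \<beta> f<..}}"
    let ?I = "{(\<beta>, f). \<beta> < (0 :: real) \<and> continuous_on UNIV f \<and> bounded (range (f :: real \<Rightarrow> real))}"
    have "compactin weak_top (C \<inter> moment_set R)" by (rule closed_Int_compactin[OF C compactin_moment_set[OF R]])
    moreover have "\<forall>S\<in>?G ` ?I. openin weak_top S"
    proof
      fix S assume "S \<in> ?G ` ?I"
      then obtain \<beta> f where f: "continuous_on UNIV f" "bounded (range f)" and S: "S = ?G (\<beta>, f)" by auto
      show "openin weak_top S" unfolding S case_prod_conv by (rule openin_weak_top[OF f]) auto
    qed
    moreover have "C \<inter> moment_set R \<subseteq> \<Union> (?G ` ?I)"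
    proof
      fix \<mu> assume \<mu>: "\<mu> \<in> C \<inter> moment_set R"
      then have m: "\<mu> \<in> moment_set R" by simp
      have "ereal a < rate_IV V R \<alpha> \<mu>" using a \<mu> by (auto simp: less_INF_D)
      then have "\<not> rate_IV V R \<alpha> \<mu> \<le> ereal a" by simp
      then obtain \<beta> f where f: "\<beta> < 0" "continuous_on UNIV f" "bounded (range f)" "\<not> (\<integral>x. f x \<partial>\<mu>) \<le> ?s \<beta> f"
        unfolding rate_le_iff[OF \<alpha>(1) m R] by blast
      then have "(\<beta>, f) \<in> ?I" "\<mu> \<in> ?G (\<beta>, f)" using moment_set_M1[OF m] by auto
      then show "\<mu> \<in> \<Union> (?G ` ?I)" by blast
    qed
    ultimately obtain \<F> where \<F>: "finite \<F>" "\<F> \<subseteq> ?G ` ?I" "C \<inter> moment_set R \<subseteq> \<Union>\<F>"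
      unfolding compactin_def by meson
    \<comment> \<open>The summand 1 keeps \<open>N\<close> positive even for an empty cover, so that
      its logarithm can be taken.\<close>
    define N where "N = real (card \<F>) + 1"
    have N: "N > 0" by (simp add: N_def)
    have vol: "measure (lebesgue_n n) {x \<in> orlicz_ball V R n. empirical n x \<in> C} \<le> N * exp (real n * (\<phi> R \<alpha> - a))" if n: "0 < n" for n
    proof -
      let ?E = "\<lambda>S. {x \<in> orlicz_ball V R n. empirical n x \<in> S}"
      have E: "?E S \<in> sets (lebesgue_n n)" "emeasure (lebesgue_n n) (?E S) \<le> ennreal (exp (real n * (\<phi> R \<alpha> - a)))" if SF: "S \<in> \<F>" for S
      proof -
        obtain \<beta> f where \<beta>: "\<beta> < 0" and f: "continuous_on UNIV f" "bounded (range f)" and S: "S = ?G (\<beta>, f)"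
        proof -
          have "S \<in> ?G ` ?I" using SF \<F>(2) by blast
          then obtain j where j: "j \<in> ?I" "S = ?G j" by (elim imageE)
          obtain \<beta> f where "j = (\<beta>, f)" by (cases j)
          then show ?thesis using j by (intro that[of \<beta> f]) auto
        qed
        obtain B where B: "\<And>x. \<bar>f x\<bar> \<le> B" and fm: "f \<in> borel_measurable borel"
          using bounded_continuous_measurable[OF f] by auto
        have So: "openin weak_top S" unfolding S case_prod_conv by (rule openin_weak_top[OF f]) auto
        have "?E S = orlicz_ball V R n \<inter> {x \<in> space (lebesgue_n n). empirical n x \<in> S}" by (auto simp: orlicz_ball_def)
        then show 1: "?E S \<in> sets (lebesgue_n n)"
          using empirical_continuous_measurable[OF empirical_continuous_weak n So] sets_orlicz_ball[of R n] by auto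
        have "emeasure (lebesgue_n n) (?E S) \<le>
          ennreal (exp (real n * (ln (Z \<beta>) + ln (\<integral>x. exp (f x) \<partial>gibbs V \<beta>) - ?s \<beta> f - \<beta> * R)))"
        proof (rule volume_upper[OF \<beta> fm B 1])
          fix x assume "x \<in> ?E S"
          then have "?s \<beta> f < (\<Sum>i<n. f (x i)) / real n" by (simp add: S integral_empirical[OF n fm])
          then show "?s \<beta> f * real n \<le> (\<Sum>i<n. f (x i))" using n by (simp add: less_divide_eq)
        qed auto
        then show "emeasure (lebesgue_n n) (?E S) \<le> ennreal (exp (real n * (\<phi> R \<alpha> - a)))"
          by (simp add: \<phi>_def algebra_simps)
      qed
      have "?E C \<subseteq> (\<Union>S\<in>\<F>. ?E S)" using \<F>(3) orlicz_ball_iff[OF n R0] by blast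
      then have "emeasure (lebesgue_n n) (?E C) \<le> emeasure (lebesgue_n n) (\<Union>S\<in>\<F>. ?E S)"
        using E(1) \<F>(1) by (intro emeasure_mono) auto
      also have "\<dots> \<le> (\<Sum>S\<in>\<F>. emeasure (lebesgue_n n) (?E S))"
        using E(1) \<F>(1) by (intro emeasure_subadditive_finite) auto
      also have "\<dots> \<le> (\<Sum>S\<in>\<F>. ennreal (exp (real n * (\<phi> R \<alpha> - a))))" by (intro sum_mono E(2))
      also have "\<dots> = ennreal (real (card \<F>) * exp (real n * (\<phi> R \<alpha> - a)))"
        by (simp add: ennreal_mult ennreal_of_nat_eq_real_of_nat)
      also have "\<dots> \<le> ennreal (N * exp (real n * (\<phi> R \<alpha> - a)))"
        by (intro ennreal_leI mult_right_mono) (auto simp: N_def)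
      finally show ?thesis unfolding measure_def using N by (intro enn2real_leI) auto
    qed
    show ?thesis
    proof (rule ereal_le_epsilon2)
      fix e :: real assume e: "0 < e"
      have "(\<lambda>n. ln (2 * N) / real n) \<longlonglongrightarrow> 0" by real_asymp
      then have ev: "eventually (\<lambda>n. ln (2 * N) / real n < e / 2) sequentially" using e by (intro order_tendstoD(2)[of _ 0]) auto
      have e2: "0 < e / 2" using e by simp
      have "eventually (\<lambda>n. ereal (1 / real n) * elog (emp_prob V R n C) \<le> ereal (- a + e)) sequentially"
        using ball_volume_lower[OF \<alpha> R e2] ev eventually_gt_at_top[of "0 :: nat"]
      proof eventually_elim
        case (elim n)
        let ?b = "measure (lebesgue_n n) (orlicz_ball V R n)"
        have bpos: "0 < ?b" using elim(1) by (rule less_le_trans[rotated]) simp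
        have "emp_prob V R n C = measure (lebesgue_n n) {x \<in> orlicz_ball V R n. empirical n x \<in> C} / ?b"
          by (rule emp_prob_eq[OF _ bpos]) (rule empirical_continuous_measurable_closed[OF empirical_continuous_weak elim(3) C])
        also have "\<dots> \<le> N * exp (real n * (\<phi> R \<alpha> - a)) / (exp (real n * (\<phi> R \<alpha> - e / 2)) / 2)"
          using vol[OF elim(3)] elim(1) N by (intro frac_le) auto
        also have "\<dots> = 2 * N * (exp (real n * (\<phi> R \<alpha> - a)) / exp (real n * (\<phi> R \<alpha> - e / 2)))" by simp
        also have "exp (real n * (\<phi> R \<alpha> - a)) / exp (real n * (\<phi> R \<alpha> - e / 2)) = exp (- real n * (a - e / 2))"
          by (simp add: algebra_simps flip: exp_diff)
        finally have "ereal (1 / real n) * elog (emp_prob V R n C) \<le> ereal (- (a - e / 2) + ln (2 * N) / real n)"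
          by (rule scaled_elog_le[OF elim(3)]) (use N in simp)
        also have "\<dots> \<le> ereal (- a + e)" unfolding ereal_less_eq(3) using elim(2) by linarith
        finally show ?case .
      qed
      then have "?L \<le> ereal (- a + e)" by (rule Limsup_bounded)
      then show "?L \<le> - ereal a + ereal e" by simp
    qed
  qed
  have "(INF \<mu>\<in>C. rate_IV V R \<alpha> \<mu>) \<le> - ?L"
  \<comment> \<open>Approaching the infimum from below also covers the case in which it is
    infinite.\<close>
  proof (rule dense_le)
    fix a assume a: "a < (INF \<mu>\<in>C. rate_IV V R \<alpha> \<mu>)"
    show "a \<le> - ?L"
    proof (cases a)
      case (real b)
      have "?L \<le> - ereal b" by (rule real_case) (use a real in simp)
      then show ?thesis unfolding real by (rule ereal_le_uminus_swap[THEN iffD1])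
    qed (use a in auto)
  qed
  then show ?thesis by (rule ereal_le_uminus_swap[THEN iffD1])
qed

theorem LDP_weak:
  assumes \<alpha>: "\<alpha> < 0" "excess R \<alpha> = 0" and R: "0 < R"
  shows "LDP weak_top (emp_prob V R) (rate_IV V R \<alpha>)"
  unfolding LDP_def
  using good_rate_weak[OF \<alpha>(1) R] ldp_lower[OF assms openin_interior_of] ldp_upper[OF assms closedin_closure_of] by simp

section \<open>Transfer to the finer topology\<close>

text \<open>Since the empirical measures live in the set \<open>m_V \<le> R\<close>, outside of which the rate is
  infinite, only the trace of the topology on this set matters.\<close>
lemma LDP_transfer:
  assumes \<alpha>: "\<alpha> < 0" and R: "0 < R" and L: "LDP weak_top (emp_prob V R) (rate_IV V R \<alpha>)"
    and X: "topspace X \<subseteq> M1" "empirical_continuous X"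
    and cm: "continuous_map (subtopology weak_top (moment_set R)) X id"
  shows "LDP X (emp_prob V R) (rate_IV V R \<alpha>)"
proof -
  let ?K = "moment_set R"
  have R0: "0 \<le> R" using R by simp
  have K1: "?K \<subseteq> M1" using moment_set_M1 by auto
  have tsp: "topspace (subtopology weak_top ?K) = ?K" using K1 by (auto simp: topspace_subtopology)
  have KX: "?K \<subseteq> topspace X" using continuous_map_image_subset_topspace[OF cm] unfolding tsp by simp
  have INF_eq: "(INF \<mu>\<in>A. rate_IV V R \<alpha> \<mu>) = (INF \<mu>\<in>A'. rate_IV V R \<alpha> \<mu>)" if "A \<subseteq> M1" "A' \<subseteq> M1" "A \<inter> ?K = A' \<inter> ?K" for A A'
  proof -
    have "(INF \<mu>\<in>A. rate_IV V R \<alpha> \<mu>) = (INF \<mu>\<in>A \<inter> ?K. rate_IV V R \<alpha> \<mu>)"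
      by (rule INF_Int_top) (use that rate_outside in \<open>auto simp: top_ereal_def\<close>)
    moreover have "(INF \<mu>\<in>A'. rate_IV V R \<alpha> \<mu>) = (INF \<mu>\<in>A' \<inter> ?K. rate_IV V R \<alpha> \<mu>)"
      by (rule INF_Int_top) (use that rate_outside in \<open>auto simp: top_ereal_def\<close>)
    ultimately show ?thesis using that by simp
  qed
  have good: "good_rate X (rate_IV V R \<alpha>)"
    unfolding good_rate_def
  proof safe
    fix \<mu> assume "\<mu> \<in> topspace X"
    then show "0 \<le> rate_IV V R \<alpha> \<mu>" using rate_nonneg[OF _ R0 \<alpha>] X(1) by auto
  next
    fix c :: real
    let ?S = "{\<mu> \<in> topspace weak_top. rate_IV V R \<alpha> \<mu> \<le> ereal c}"
    have inK: "\<mu> \<in> ?K" if "\<mu> \<in> M1" "rate_IV V R \<alpha> \<mu> \<le> ereal c" for \<mu>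
      using that by (intro rate_finite_moment_set[of \<mu> R \<alpha>]) (auto simp: less_top[symmetric] top_ereal_def)
    have "compactin weak_top ?S" using L unfolding LDP_def good_rate_def by blast
    moreover have "?S \<subseteq> ?K" using inK by auto
    ultimately have "compactin (subtopology weak_top ?K) ?S" by (simp add: compactin_subtopology)
    then have "compactin X (id ` ?S)" using cm by (rule image_compactin)
    moreover have "{\<mu> \<in> topspace X. rate_IV V R \<alpha> \<mu> \<le> ereal c} = ?S" using X(1) KX inK by auto
    ultimately show "compactin X {\<mu> \<in> topspace X. rate_IV V R \<alpha> \<mu> \<le> ereal c}" by simp
  qed
  have lower: "- (INF \<mu>\<in>U. rate_IV V R \<alpha> \<mu>) \<le> liminf (\<lambda>n. ereal (1 / real n) * elog (emp_prob V R n U))" if U: "openin X U" for U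
  proof -
    have "openin (subtopology weak_top ?K) {\<mu> \<in> topspace (subtopology weak_top ?K). id \<mu> \<in> U}"
      using cm U by (rule openin_continuous_map_preimage)
    \<comment> \<open>Continuity of the identity on the moment set provides a weakly open set with
      the same trace; probabilities and infima of the rate see nothing but this trace.\<close>
    then obtain U' where U': "openin weak_top U'" "U \<inter> ?K = U' \<inter> ?K"
      unfolding tsp openin_subtopology by auto
    have "eventually (\<lambda>n. ereal (1 / real n) * elog (emp_prob V R n U) = ereal (1 / real n) * elog (emp_prob V R n U')) sequentially"
      using eventually_gt_at_top[of "0 :: nat"]
    proof eventually_elim
      case (elim n)
      have "emp_prob V R n U = emp_prob V R n U'"
        by (rule emp_prob_cong[OF elim R0 empirical_continuous_measurable[OF X(2) elim U]
              empirical_continuous_measurable[OF empirical_continuous_weak elim U'(1)] U'(2)])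
      then show ?case by simp
    qed
    then have "liminf (\<lambda>n. ereal (1 / real n) * elog (emp_prob V R n U)) = liminf (\<lambda>n. ereal (1 / real n) * elog (emp_prob V R n U'))"
      by (rule Liminf_eq)
    moreover have "(INF \<mu>\<in>U. rate_IV V R \<alpha> \<mu>) = (INF \<mu>\<in>U'. rate_IV V R \<alpha> \<mu>)"
      using openin_subset[OF U] openin_subset[OF U'(1)] X(1) U'(2) by (intro INF_eq) auto
    ultimately show ?thesis
      using L openin_borel_sets_of[OF U'(1)] interior_of_openin[OF U'(1)] unfolding LDP_def by metis
  qed
  have upper: "limsup (\<lambda>n. ereal (1 / real n) * elog (emp_prob V R n C)) \<le> - (INF \<mu>\<in>C. rate_IV V R \<alpha> \<mu>)" if C: "closedin X C" for C
  proof -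
    have "closedin (subtopology weak_top ?K) {\<mu> \<in> topspace (subtopology weak_top ?K). id \<mu> \<in> C}"
      using cm C by (rule closedin_continuous_map_preimage)
    then obtain C' where C': "closedin weak_top C'" "C \<inter> ?K = C' \<inter> ?K"
      unfolding tsp closedin_subtopology by auto
    have "eventually (\<lambda>n. ereal (1 / real n) * elog (emp_prob V R n C) = ereal (1 / real n) * elog (emp_prob V R n C')) sequentially"
      using eventually_gt_at_top[of "0 :: nat"]
    proof eventually_elim
      case (elim n)
      have "emp_prob V R n C = emp_prob V R n C'"
        by (rule emp_prob_cong[OF elim R0 empirical_continuous_measurable_closed[OF X(2) elim C]
              empirical_continuous_measurable_closed[OF empirical_continuous_weak elim C'(1)] C'(2)])
      then show ?case by simp
    qed
    then have "limsup (\<lambda>n. ereal (1 / real n) * elog (emp_prob V R n C)) = limsup (\<lambda>n. ereal (1 / real n) * elog (emp_prob V R n C'))"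
      by (rule Limsup_eq)
    moreover have "(INF \<mu>\<in>C. rate_IV V R \<alpha> \<mu>) = (INF \<mu>\<in>C'. rate_IV V R \<alpha> \<mu>)"
      using closedin_subset[OF C] closedin_subset[OF C'(1)] X(1) C'(2) by (intro INF_eq) auto
    ultimately show ?thesis
      using L closedin_borel_sets_of[OF C'(1)] closure_of_closedin[OF C'(1)] unfolding LDP_def by metis
  qed
  show ?thesis unfolding LDP_def using good lower[OF openin_interior_of] upper[OF closedin_closure_of] by simp
qed

text \<open>Uniform integrability of W over the moment set: far out W is at most (e / R) V, which
  integrates to at most e, and closer in W is bounded by its value at the cut-off radius.\<close>

lemma moment_truncation:
  assumes W: "orlicz W" and VW: "filterlim (\<lambda>x. V x / W x) at_top at_infinity" and R: "0 < R" and e: "0 < e"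
  shows "\<exists>c\<ge>0. \<forall>\<mu>\<in>moment_set R. mV W \<mu> < \<infinity> \<and> \<bar>enn2real (mV W \<mu>) - (\<integral>x. min c (W x) \<partial>\<mu>)\<bar> \<le> e"
proof -
  interpret W: orlicz_function W by unfold_locales (rule W)
  have "eventually (\<lambda>x. R / e \<le> V x / W x) at_infinity" using VW by (simp add: filterlim_at_top)
  then obtain r0 where r0: "\<And>x. r0 \<le> \<bar>x\<bar> \<Longrightarrow> R / e \<le> V x / W x" by (auto simp: eventually_at_infinity)
  \<comment> \<open>A radius of at least 1 excludes x = 0 outside, where W x > 0 is needed to clear
    the quotient.\<close>
  define r where "r = max 1 r0"
  define c where "c = W r"
  have W_le: "W x \<le> min c (W x) + e / R * V x" for x
  proof (cases "\<bar>x\<bar> \<le> r")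
    case True
    then have "W x \<le> c" unfolding c_def by (intro W.V_mono) auto
    then show ?thesis using e R by simp
  next
    case False
    then have "R / e \<le> V x / W x" "x \<noteq> 0" by (auto simp: r_def intro: r0)
    then have "W x \<le> e / R * V x" using W.V_pos[of x] e R by (simp add: field_simps)
    moreover have "0 \<le> min c (W x)" by (simp add: c_def)
    ultimately show ?thesis by linarith
  qed
  have c0: "0 \<le> c" by (simp add: c_def)
  have "mV W \<mu> < \<infinity> \<and> \<bar>enn2real (mV W \<mu>) - (\<integral>x. min c (W x) \<partial>\<mu>)\<bar> \<le> e" if \<mu>: "\<mu> \<in> moment_set R" for \<mu>
  proof -
    have \<mu>1: "\<mu> \<in> M1" using \<mu> by (rule moment_set_M1)
    note [measurable_cong] = M1_D(1)[OF \<mu>1]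
    note Vi = moment_set_integrable[OF \<mu> less_imp_le[OF R]]
    have ci: "integrable \<mu> (\<lambda>x. min c (W x))" using c0 by (intro integrable_bounded_M1[OF \<mu>1, where B = c]) auto
    have bi: "integrable \<mu> (\<lambda>x. min c (W x) + e / R * V x)" using ci Vi(1) by auto
    have Wi: "integrable \<mu> W"
      by (rule Bochner_Integration.integrable_bound[OF bi]) (use W_le in \<open>auto intro: order_trans[OF _ abs_ge_self]\<close>)
    have eq: "mV W \<mu> = ennreal (\<integral>x. W x \<partial>\<mu>)" unfolding mV_def using Wi by (intro nn_integral_eq_integral) auto
    have "(\<integral>x. W x \<partial>\<mu>) \<le> (\<integral>x. min c (W x) + e / R * V x \<partial>\<mu>)" using Wi bi W_le by (intro integral_mono) auto
    also have "\<dots> = (\<integral>x. min c (W x) \<partial>\<mu>) + e / R * (\<integral>x. V x \<partial>\<mu>)" using ci Vi(1) by simp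
    also have "e / R * (\<integral>x. V x \<partial>\<mu>) \<le> e / R * R" using Vi(4) e R by (intro mult_left_mono) auto
    finally have "(\<integral>x. W x \<partial>\<mu>) \<le> (\<integral>x. min c (W x) \<partial>\<mu>) + e" using R by simp
    moreover have "(\<integral>x. min c (W x) \<partial>\<mu>) \<le> (\<integral>x. W x \<partial>\<mu>)" using ci Wi by (intro integral_mono) auto
    ultimately show ?thesis unfolding eq by simp
  qed
  then show ?thesis using c0 by blast
qed

text \<open>On the moment set m_W is a uniform limit of integrals of the bounded continuous
  functions min c W, hence weakly continuous there, although it is not on all of M1.\<close>

lemma continuous_map_dW_top:
  assumes W: "orlicz W" and VW: "filterlim (\<lambda>x. V x / W x) at_top at_infinity" and R: "0 < R"
  shows "continuous_map (subtopology weak_top (moment_set R)) (dW_top W) id"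
proof -
  let ?K = "moment_set R"
  interpret W: orlicz_function W by unfold_locales (rule W)
  have K1: "?K \<subseteq> M1" using moment_set_M1 by auto
  have tsp: "topspace (subtopology weak_top ?K) = ?K" using K1 by (auto simp: topspace_subtopology)
  have KW: "?K \<subseteq> M1V W" using moment_truncation[OF W VW R, of 1] K1 by (auto simp: M1V_def)
  show ?thesis
    unfolding dW_top_def
  proof (rule continuous_on_generated_topo)
    show "id ` topspace (subtopology weak_top ?K) \<subseteq>
      \<Union> ({S \<inter> M1V W |S. S \<in> weak_subbase} \<union> {{\<mu> \<in> M1V W. enn2real (mV W \<mu>) \<in> U} |U. open U})"
      using KW topspace_dW_top[of W] unfolding dW_top_def topology_generated_by_topspace tsp by simp
    fix Q assume "Q \<in> {S \<inter> M1V W |S. S \<in> weak_subbase} \<union> {{\<mu> \<in> M1V W. enn2real (mV W \<mu>) \<in> U} |U. open U}"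
    then consider S where "S \<in> weak_subbase" "Q = S \<inter> M1V W" | A where "open A" "Q = {\<mu> \<in> M1V W. enn2real (mV W \<mu>) \<in> A}" by auto
    then show "openin (subtopology weak_top ?K) (id -` Q \<inter> topspace (subtopology weak_top ?K))"
    proof cases
      case 1
      have "openin weak_top S" unfolding weak_top_def using 1(1) by (rule topology_generated_by_Basis)
      moreover have "id -` Q \<inter> topspace (subtopology weak_top ?K) = S \<inter> ?K" unfolding tsp 1(2) using KW by auto
      ultimately show ?thesis by (auto simp: openin_subtopology)
    next
      case 2
      have eq: "id -` Q \<inter> topspace (subtopology weak_top ?K) = {\<mu> \<in> ?K. enn2real (mV W \<mu>) \<in> A}"
        unfolding tsp 2(2) using KW by auto
      show ?thesis unfolding eq
      proof (subst openin_subopen, intro ballI)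
        fix \<mu>0 assume \<mu>0: "\<mu>0 \<in> {\<mu> \<in> ?K. enn2real (mV W \<mu>) \<in> A}"
        then obtain d where d: "d > 0" "\<And>y. \<bar>y - enn2real (mV W \<mu>0)\<bar> < d \<Longrightarrow> y \<in> A"
          using 2(1) unfolding open_real by auto
        have d4: "0 < d / 4" using d by simp
        obtain c where c: "0 \<le> c" and t: "\<And>\<mu>. \<mu> \<in> ?K \<Longrightarrow> \<bar>enn2real (mV W \<mu>) - (\<integral>x. min c (W x) \<partial>\<mu>)\<bar> \<le> d / 4"
          using moment_truncation[OF W VW R d4] by blast
        let ?f = "\<lambda>x. min c (W x)"
        have f: "continuous_on UNIV ?f" "bounded (range ?f)"
          using c by (auto intro!: continuous_intros W.V_continuous boundedI[of _ c])
        let ?O = "{\<mu> \<in> M1. (\<integral>x. ?f x \<partial>\<mu>) \<in> ball (\<integral>x. ?f x \<partial>\<mu>0) (d / 4)}"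
        have "openin (subtopology weak_top ?K) (?O \<inter> ?K)"
          by (rule openin_subtopology_Int[OF openin_weak_top[OF f open_ball]])
        moreover have "\<mu>0 \<in> ?O \<inter> ?K" using \<mu>0 K1 d by auto
        moreover have "?O \<inter> ?K \<subseteq> {\<mu> \<in> ?K. enn2real (mV W \<mu>) \<in> A}"
        proof
          fix \<mu> assume \<mu>: "\<mu> \<in> ?O \<inter> ?K"
          then have k: "\<mu> \<in> ?K" "\<bar>(\<integral>x. ?f x \<partial>\<mu>0) - (\<integral>x. ?f x \<partial>\<mu>)\<bar> < d / 4" by (auto simp: dist_real_def)
          have k0: "\<mu>0 \<in> ?K" using \<mu>0 by simp
          have "\<bar>enn2real (mV W \<mu>) - enn2real (mV W \<mu>0)\<bar> < d"
            using t[OF k(1)] t[OF k0] k(2) d(1) by linarith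
          then show "\<mu> \<in> {\<mu> \<in> ?K. enn2real (mV W \<mu>) \<in> A}" using d(2) k by auto
        qed
        ultimately show "\<exists>T. openin (subtopology weak_top ?K) T \<and> \<mu>0 \<in> T \<and> T \<subseteq> {\<mu> \<in> ?K. enn2real (mV W \<mu>) \<in> A}" by blast
      qed
    qed
  qed
qed

end

lemma empirical_continuous_dW:
  assumes W: "orlicz W" shows "empirical_continuous (dW_top W)"
  unfolding empirical_continuous_def
proof safe
  interpret W: orlicz_function W by unfold_locales (rule W)
  fix n :: nat assume n: "0 < n"
  have eM: "empirical n x \<in> M1V W" for x
    using empirical_in_M1[OF n] by (simp add: M1V_def W.mV_empirical[OF n])
  show "continuous_map euclidean (dW_top W) (empirical n)"
    unfolding dW_top_def
  proof (rule continuous_on_generated_topo)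
    show "empirical n ` topspace euclidean \<subseteq>
      \<Union> ({S \<inter> M1V W |S. S \<in> weak_subbase} \<union> {{\<mu> \<in> M1V W. enn2real (mV W \<mu>) \<in> U} |U. open U})"
      using eM topspace_dW_top[of W] unfolding dW_top_def topology_generated_by_topspace by auto
    fix Q assume "Q \<in> {S \<inter> M1V W |S. S \<in> weak_subbase} \<union> {{\<mu> \<in> M1V W. enn2real (mV W \<mu>) \<in> U} |U. open U}"
    then consider S where "S \<in> weak_subbase" "Q = S \<inter> M1V W" | A where "open A" "Q = {\<mu> \<in> M1V W. enn2real (mV W \<mu>) \<in> A}" by auto
    then show "openin euclidean (empirical n -` Q \<inter> topspace euclidean)"
    proof cases
      case 1
      have "openin weak_top S" unfolding weak_top_def using 1(1) by (rule topology_generated_by_Basis)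
      then have "openin euclidean {x \<in> topspace euclidean. empirical n x \<in> S}"
        using empirical_continuous_weak n unfolding empirical_continuous_def by (intro openin_continuous_map_preimage) auto
      moreover have "empirical n -` Q \<inter> topspace euclidean = {x \<in> topspace euclidean. empirical n x \<in> S}" using eM 1(2) by auto
      ultimately show ?thesis by simp
    next
      case 2
      have "empirical n -` Q \<inter> topspace euclidean = (\<lambda>x. (\<Sum>i<n. W (x i)) / real n) -` A"
        using eM by (auto simp: 2(2) W.mV_empirical[OF n] sum_nonneg)
      moreover have "open ((\<lambda>x. (\<Sum>i<n. W (x i)) / real n) -` A)"
        using continuous_average[OF W.V_continuous] 2(1) by (auto simp: continuous_on_open_vimage)
      ultimately show ?thesis by simp
    qed
  qed
qed

context orlicz_function
begin

section \<open>Uniqueness of the parameter\<close>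

text \<open>The upper bound for the whole space, which has probability 1, forces the infimum of the
  rate to be at most 0. By \<open>rate_shift\<close> the rate at \<beta> is at least \<phi> R
  \<beta> - \<phi> R \<alpha>, which is positive unless the parameters agree.\<close>

lemma LDP_rate_unique:
  assumes \<alpha>: "\<alpha> < 0" "excess R \<alpha> = 0" and R: "0 < R" and \<beta>: "\<beta> < 0" and L: "LDP weak_top (emp_prob V R) (rate_IV V R \<beta>)"
  shows "\<beta> = \<alpha>"
proof (rule ccontr)
  assume "\<beta> \<noteq> \<alpha>"
  then have d: "0 < \<phi> R \<beta> - \<phi> R \<alpha>" using phi_strict_min[OF R \<alpha> \<beta>] by simp
  have "M1 \<in> borel_sets_of weak_top" using openin_borel_sets_of[OF openin_topspace[of weak_top]] by simp
  moreover have "weak_top closure_of M1 = M1" using closure_of_topspace[of weak_top] by simp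
  ultimately have "limsup (\<lambda>n. ereal (1 / real n) * elog (emp_prob V R n M1)) \<le> - (INF \<mu>\<in>M1. rate_IV V R \<beta> \<mu>)"
    using L unfolding LDP_def by metis
  moreover have "eventually (\<lambda>n. ereal (1 / real n) * elog (emp_prob V R n M1) = 0) sequentially"
    using ball_volume_lower[OF \<alpha> R zero_less_one] eventually_gt_at_top[of "0 :: nat"]
  proof eventually_elim
    case (elim n)
    have pos: "0 < measure (lebesgue_n n) (orlicz_ball V R n)" using elim(1) by (rule less_le_trans[rotated]) simp
    have "{x \<in> orlicz_ball V R n. empirical n x \<in> M1} = orlicz_ball V R n" using empirical_in_M1[OF elim(2)] by auto
    then have "emp_prob V R n M1 = 1"
      using emp_prob_eq[OF _ pos, of M1] pos empirical_continuous_measurable[OF empirical_continuous_weak elim(2) openin_topspace] by simp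
    then show ?case by (simp add: elog_def zero_ereal_def)
  qed
  then have "limsup (\<lambda>n. ereal (1 / real n) * elog (emp_prob V R n M1)) = limsup (\<lambda>n. 0)" by (rule Limsup_eq)
  then have "limsup (\<lambda>n. ereal (1 / real n) * elog (emp_prob V R n M1)) = 0" by (simp add: Limsup_const)
  ultimately have "(INF \<mu>\<in>M1. rate_IV V R \<beta> \<mu>) \<le> 0" using ereal_le_uminus_swap[of 0 "INF \<mu>\<in>M1. rate_IV V R \<beta> \<mu>"] by simp
  moreover have "ereal (\<phi> R \<beta> - \<phi> R \<alpha>) \<le> (INF \<mu>\<in>M1. rate_IV V R \<beta> \<mu>)"
  proof (rule INF_greatest)
    fix \<mu> assume \<mu>: "\<mu> \<in> M1"
    have "rate_IV V R \<beta> \<mu> = rate_IV V R \<alpha> \<mu> + ereal (\<phi> R \<beta> - \<phi> R \<alpha>)" using R by (intro rate_shift[OF \<alpha>(1) \<beta> \<mu>]) simp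
    moreover have "0 \<le> rate_IV V R \<alpha> \<mu>" using R by (intro rate_nonneg[OF \<mu> _ \<alpha>(1)]) simp
    ultimately show "ereal (\<phi> R \<beta> - \<phi> R \<alpha>) \<le> rate_IV V R \<beta> \<mu>" by (simp add: add_increasing)
  qed
  ultimately have "ereal (\<phi> R \<beta> - \<phi> R \<alpha>) \<le> 0" by (rule order_trans[rotated])
  then show False using d by simp
qed

end

theorem theoremA:
  fixes V :: "real \<Rightarrow> real" and R :: real
  assumes "orlicz V" and "0 < R"
  shows "\<exists>\<alpha>::real.
           (\<alpha> < 0 \<and>
            LDP weak_top (emp_prob V R) (rate_IV V R \<alpha>) \<and>
            strictly_convex_rate M1 (rate_IV V R \<alpha>) \<and>
            (\<forall>W. orlicz W \<and> filterlim (\<lambda>x. V x / W x) at_top at_infinity \<longrightarrow>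
                 LDP (dW_top W) (emp_prob V R) (rate_IV V R \<alpha>))) \<and>
           (\<forall>\<beta>::real. \<beta> < 0 \<and> LDP weak_top (emp_prob V R) (rate_IV V R \<beta>) \<longrightarrow> \<beta> = \<alpha>)"
proof -
  interpret orlicz_function V by unfold_locales (rule assms)
  obtain \<alpha> where \<alpha>: "\<alpha> < 0" "excess R \<alpha> = 0" using excess_root[OF assms(2)] by auto
  note L = LDP_weak[OF \<alpha> assms(2)]
  have "LDP (dW_top W) (emp_prob V R) (rate_IV V R \<alpha>)"
    if "orlicz W" "filterlim (\<lambda>x. V x / W x) at_top at_infinity" for W
  proof (rule LDP_transfer[OF \<alpha>(1) assms(2) L])
    show "topspace (dW_top W) \<subseteq> M1" by (auto simp: topspace_dW_top M1V_def)
    show "empirical_continuous (dW_top W)" by (rule empirical_continuous_dW[OF that(1)])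
    show "continuous_map (subtopology weak_top (moment_set R)) (dW_top W) id"
      by (rule continuous_map_dW_top[OF that assms(2)])
  qed
  moreover have "strictly_convex_rate M1 (rate_IV V R \<alpha>)"
    by (rule strictly_convex_rate_IV[OF \<alpha>(1)]) (use assms(2) in simp)
  ultimately show ?thesis using \<alpha>(1) L LDP_rate_unique[OF \<alpha> assms(2)] by blast
qed

end
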